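(* Let $\varphi$ be an Orlicz N-function satisfying condition Q, and let $y=\{y(u),\,u\in\mathbb{R}\}$ be a real-valued strictly $\varphi$-sub-Gaussian random process with determining constant $C_y$ and covariance function $\Gamma_y(t,s)=\mathsf{E}\,y(t)y(s)$ of finite variation. Let $A>0$, $V=[-A,A]\times[0,+\infty)$, let $N\ge1$, let $a_1,\dots,a_N$ be real constants, and let $$U(t,x)=\int_{-\infty}^{\infty}I(t,x,\lambda)\,dy(\lambda),\qquad (x,t)\in V,$$ (mean-square integral), where $$I(t,x,\lambda)=\kappa\Big(\lambda x+t\sum_{k=1}^{N}a_k\lambda^{2k+1}(-1)^k\Big)$$ and $\kappa$ is either $\cos$ or $\sin$. Assume that $U(t,x)$ exists and is continuous with probability one. Let $Z$ be a function admissible for the space $\mathrm{Sub}_\varphi(\Omega)$, with associated constant $u_0\ge0$, and let the integral $$C_Z^2=\int_{-\infty}^{\infty}\int_{-\infty}^{\infty}\Big(Z\Big(\tfrac{|\lambda|}{2}+u_0\Big)+Z\Big(\tfrac12\Big|\sum_{k=1}^{N}a_k\lambda^{2k+1}(-1)^k\Big|+u_0\Big)\Big)\Big(Z\Big(\tfrac{|\mu|}{2}+u_0\Big)+Z\Big(\tfrac12\Big|\sum_{k=1}^{N}a_k\mu^{2k+1}(-1)^k\Big|+u_0\Big)\Big)\,d|\Gamma_y(\lambda,\mu)|$$ converge (with $C_Z\ge0$ its square root). Suppose that the following conditions hold. 1. $\{[b_k,b_{k+1}],\ k=0,1,\dots\}$ is a family of segments such that $b_0=0$, $0<b_k<b_{k+1}<+\infty$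 for $k=1,2,\dots$, and $b_{k+1}-b_k\ge 2A$ for all $k$; put $V_k=[-A,A]\times[b_k,b_{k+1}]$. 2. $c(t)$, $t\ge0$, is a continuous function with $c(t)>0$ for $t\ge 0$; put $c_k=\min_{t\in[b_k,b_{k+1}]}c(t)$. 3. With $\varepsilon_k=C_y\sup_{(x,t)\in V_k}\big(\mathsf{E}|U(t,x)|^2\big)^{1/2}$, $k=0,1,2,\dots$, one has $\sup_{k\ge0}\varepsilon_k/c_k<\infty$. 4. For $\delta>0$ let $$\hat I_{\varphi,k}(\delta)=\int_0^{\delta}\Psi\Big(\ln\Big(A\Big(Z^{(-1)}\Big(\frac{2C_ZC_y}{s}\Big)-u_0\Big)+1\Big)+\ln\Big(\frac{b_{k+1}-b_k}{2}\Big(Z^{(-1)}\Big(\frac{2C_ZC_y}{s}\Big)-u_0\Big)+1\Big)\Big)\,ds,$$ where $\Psi(v)=v/\varphi^{(-1)}(v)$; for some $\theta$, $0<\theta<1$, one has $\sup_{k\ge0}\hat I_{\varphi,k}(\theta\varepsilon_k)/c_k<\infty$. 5. The series $\sum_{k=0}^{\infty}\exp\Big\{-\varphi^*\Big(\frac{s\,c_k(1-\theta)}{2\varepsilon_k}\Big)\Big\}$ converges for some $s$ such that $\sup_{k\ge0}\frac{4\varepsilon_k}{c_k(1-\theta)}<s<\frac u2$. Then for $$u>\sup_{k\ge0}\frac{\hat I_{\varphi,k}(\theta\varepsilon_k)}{c_k}\cdot\frac{4}{\theta(1-\theta)}$$ (with $s$ as in condition 5, in particular $u>2s$) the following estimate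 holds: $$P\Big\{\sup_{(x,t)\in V}\frac{|U(t,x)|}{c(t)}>u\Big\}\le 2\exp\Big\{-\varphi^*\Big(\frac us\Big)\Big\}\sum_{k=0}^{\infty}\exp\Big\{-\varphi^*\Big(\frac{s\,c_k(1-\theta)}{2\varepsilon_k}\Big)\Big\}.$$
   Context: All random variables live on a standard probability space $(\Omega,L,P)$. Orlicz N-function: a continuous even convex function $\varphi:\mathbb{R}\to\mathbb{R}$ with $\varphi(0)=0$, $\varphi(x)>0$ for $x\ne0$, $\lim_{x\to0}\varphi(x)/x=0$, $\lim_{x\to\infty}\varphi(x)/x=\infty$. Its Young-Fenchel transform is $\varphi^*(x)=\sup_{y\in\mathbb{R}}(xy-\varphi(y))$. Condition Q: $\liminf_{x\to0}\varphi(x)/x^2>0$ (possibly $+\infty$). For a function $f$ strictly increasing on $[0,\infty)$, $f^{(-1)}$ denotes its inverse; $\varphi^{(-1)}$ is the inverse of $\varphi$ restricted to $[0,\infty)$. Space $\mathrm{Sub}_\varphi(\Omega)$: the random variables $\zeta$ with $\mathsf{E}\zeta=0$ such that $\mathsf{E}\exp\{\lambda\zeta\}$ exists for all $\lambda\in\mathbb{R}$ and, for some $a>0$, $\mathsf{E}\exp\{\lambda\zeta\}\le\exp\{\varphi(a\lambda)\}$ for all $\lambda\in\mathbb{R}$. It is a Banach space with the norm $\tau_\varphi(\zeta)=\inf\{a>0:\ \mathsf{E}\exp\{\lambda\zeta\}\le\exp\{\varphi(a\lambda)\}\ \text{for all }\lambda\in\mathbb{R}\}$. A family $\Delta\subset\mathrm{Sub}_\varphi(\Omega)$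 is strictly $\varphi$-sub-Gaussian with determining constant $C_\Delta$ if for every countable set of variables $\zeta_i\in\Delta$, $i\in I$, and real coefficients $\lambda_i$, one has $\tau_\varphi(\sum_{i\in I}\lambda_i\zeta_i)\le C_\Delta\big(\mathsf{E}(\sum_{i\in I}\lambda_i\zeta_i)^2\big)^{1/2}$. A random process is strictly $\varphi$-sub-Gaussian with a given determining constant if the family of its values is. Admissible function for $\mathrm{Sub}_\varphi(\Omega)$: a continuous increasing function $Z(u)$, $u\ge0$, with $Z(u)>0$ for $u>0$ (examples include $Z(u)=u^\alpha$ and $Z(u)=\ln^\alpha(u+1)$), such that for some constant $u_0\ge0$ the function $u/Z(u)$ is non-decreasing for $u>u_0$, and such that for some $\varepsilon>0$ the integral $\int_0^\varepsilon\Psi\big(\ln\big(Z^{(-1)}(1/s)-u_0\big)\big)\,ds$ converges, where $\Psi(v)=v/\varphi^{(-1)}(v)$, $v>0$. Integrals $\int\int f\,d|\Gamma_y|$ are Lebesgue-Stieltjes integrals with respect to the total variation of $\Gamma_y$, i.e. limits of sums $\sum\sum f(t,s)\,|\Delta_i\Delta_j\Gamma_y(t,s)|$. *)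

theory Defs
  imports "HOL-Probability.Probability"
begin

subsection \<open>Orlicz N-functions\<close>

definition N_function :: "(real \<Rightarrow> real) \<Rightarrow> bool" where
  "N_function \<phi> \<longleftrightarrow>
     continuous_on UNIV \<phi> \<and> convex_on UNIV \<phi> \<and> (\<forall>x. \<phi> (- x) = \<phi> x) \<and>
     \<phi> 0 = 0 \<and> (\<forall>x. x \<noteq> 0 \<longrightarrow> \<phi> x > 0) \<and>
     ((\<lambda>x. \<phi> x / x) \<longlongrightarrow> 0) (at 0) \<and>
     filterlim (\<lambda>x. \<phi> x / x) at_top at_top"

text \<open>The supremum is finite for every N-function, so it can be taken in the reals.\<close>

definition young_fenchel :: "(real \<Rightarrow> real) \<Rightarrow> real \<Rightarrow> real" where
  "young_fenchel \<phi> x = (SUP y. x * y - \<phi> y)"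

definition condition_Q :: "(real \<Rightarrow> real) \<Rightarrow> bool" where
  "condition_Q \<phi> \<longleftrightarrow> Liminf (at 0) (\<lambda>x. ereal (\<phi> x / x\<^sup>2)) > 0"

text \<open>The inverse of the restriction of a function to the half-line. It is only meaningful on the
  image of the half-line.\<close>

definition inv_pos :: "(real \<Rightarrow> real) \<Rightarrow> real \<Rightarrow> real" where
  "inv_pos f = inv_into {0..} f"

definition Psi :: "(real \<Rightarrow> real) \<Rightarrow> real \<Rightarrow> real" where
  "Psi \<phi> v = v / inv_pos \<phi> v"

subsection \<open>Sub-Gaussian spaces\<close>

definition square_integrable :: "'a measure \<Rightarrow> ('a \<Rightarrow> real) \<Rightarrow> bool" where
  "square_integrable M X \<longleftrightarrow> X \<in> borel_measurable M \<and> integrable M (\<lambda>\<omega>. (X \<omega>)\<^sup>2)"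

definition ms_tendsto ::
    "'a measure \<Rightarrow> ('i \<Rightarrow> 'a \<Rightarrow> real) \<Rightarrow> ('a \<Rightarrow> real) \<Rightarrow> 'i filter \<Rightarrow> bool" where
  "ms_tendsto M S X F \<longleftrightarrow>
     square_integrable M X \<and> (\<forall>\<^sub>F i in F. square_integrable M (S i)) \<and>
     ((\<lambda>i. LINT \<omega>|M. (S i \<omega> - X \<omega>)\<^sup>2) \<longlongrightarrow> 0) F"

definition Sub :: "'a measure \<Rightarrow> (real \<Rightarrow> real) \<Rightarrow> ('a \<Rightarrow> real) set" where
  "Sub M \<phi> = {\<zeta>. integrable M \<zeta> \<and> (LINT \<omega>|M. \<zeta> \<omega>) = 0 \<and>
     (\<forall>l. integrable M (\<lambda>\<omega>. exp (l * \<zeta> \<omega>))) \<and>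
     (\<exists>a>0. \<forall>l. (LINT \<omega>|M. exp (l * \<zeta> \<omega>)) \<le> exp (\<phi> (a * l)))}"

definition sub_norm :: "'a measure \<Rightarrow> (real \<Rightarrow> real) \<Rightarrow> ('a \<Rightarrow> real) \<Rightarrow> real" where
  "sub_norm M \<phi> \<zeta> = Inf {a. a > 0 \<and> (\<forall>l. (LINT \<omega>|M. exp (l * \<zeta> \<omega>)) \<le> exp (\<phi> (a * l)))}"

text \<open>Countable linear combinations are mean-square convergent series; coefficients that vanish
  from some index on give the finite ones. Membership of the sum in the space is required
  explicitly because the infimum defining the norm is meaningless for other variables.\<close>

definition strictly_sub_gaussian ::
    "'a measure \<Rightarrow> (real \<Rightarrow> real) \<Rightarrow> ('a \<Rightarrow> real) set \<Rightarrow> real \<Rightarrow> bool" where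
  "strictly_sub_gaussian M \<phi> D C \<longleftrightarrow> D \<subseteq> Sub M \<phi> \<and>
     (\<forall>(\<zeta> :: nat \<Rightarrow> 'a \<Rightarrow> real) (l :: nat \<Rightarrow> real) S.
        (\<forall>i. \<zeta> i \<in> D) \<and> ms_tendsto M (\<lambda>n \<omega>. \<Sum>i<n. l i * \<zeta> i \<omega>) S sequentially \<longrightarrow>
        S \<in> Sub M \<phi> \<and> sub_norm M \<phi> S \<le> C * sqrt (LINT \<omega>|M. (S \<omega>)\<^sup>2))"

text \<open>Unboundedness of \<open>Z\<close> is what makes the inverse in the integral defined for all small \<open>s\<close>.
  The (junk) values of the integrand for larger \<open>s\<close> are harmless, since \<open>\<epsilon>\<close> can be decreased.\<close>

definition admissible :: "(real \<Rightarrow> real) \<Rightarrow> (real \<Rightarrow> real) \<Rightarrow> real \<Rightarrow> bool" where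
  "admissible \<phi> Z u0 \<longleftrightarrow>
     continuous_on {0..} Z \<and> strict_mono_on {0..} Z \<and> (\<forall>u>0. Z u > 0) \<and>
     filterlim Z at_top at_top \<and>
     u0 \<ge> 0 \<and> mono_on {u0<..} (\<lambda>u. u / Z u) \<and>
     (\<exists>\<epsilon>>0. set_integrable lborel {0<..\<epsilon>} (\<lambda>s. Psi \<phi> (ln (inv_pos Z (1 / s) - u0))))"

subsection \<open>Stieltjes integrals\<close>

text \<open>A finite set of reals is read as the set of division points of a partition. Each cell
  \<open>[l, r]\<close> carries a tag \<open>\<xi> l\<close>. Limits are taken along successive refinement.\<close>

definition cells :: "real set \<Rightarrow> (real \<times> real) set" where
  "cells P = {(l, r). l \<in> P \<and> r \<in> P \<and> l < r \<and> {l<..<r} \<inter> P = {}}"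

definition tagged_partitions :: "real \<Rightarrow> real \<Rightarrow> (real set \<times> (real \<Rightarrow> real)) filter" where
  "tagged_partitions a b =
     inf (filtercomap fst (finite_subsets_at_top {a..b}))
         (principal {(P, \<xi>). \<forall>(l, r)\<in>cells P. \<xi> l \<in> {l..r}})"

definition ms_stieltjes_sum ::
    "(real \<Rightarrow> 'a \<Rightarrow> real) \<Rightarrow> (real \<Rightarrow> real) \<Rightarrow> real set \<times> (real \<Rightarrow> real) \<Rightarrow> 'a \<Rightarrow> real" where
  "ms_stieltjes_sum y f = (\<lambda>(P, \<xi>) \<omega>. \<Sum>(l, r)\<in>cells P. f (\<xi> l) * (y r \<omega> - y l \<omega>))"

text \<open>\<open>X\<close> is a version of the mean-square integral of \<open>f\<close> with respect to \<open>y\<close> over the real line.\<close>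

definition has_ms_integral ::
    "'a measure \<Rightarrow> (real \<Rightarrow> 'a \<Rightarrow> real) \<Rightarrow> (real \<Rightarrow> real) \<Rightarrow> ('a \<Rightarrow> real) \<Rightarrow> bool" where
  "has_ms_integral M y f X \<longleftrightarrow>
     (\<exists>J. (\<forall>a b. a \<le> b \<longrightarrow> ms_tendsto M (ms_stieltjes_sum y f) (J a b) (tagged_partitions a b)) \<and>
          ms_tendsto M (\<lambda>(a, b). J a b) X (at_bot \<times>\<^sub>F at_top))"

definition rect_increment :: "(real \<Rightarrow> real \<Rightarrow> real) \<Rightarrow> real \<times> real \<Rightarrow> real \<times> real \<Rightarrow> real" where
  "rect_increment G = (\<lambda>(l, r) (l', r'). G r r' - G r l' - G l r' + G l l')"

definition finite_variation :: "(real \<Rightarrow> real \<Rightarrow> real) \<Rightarrow> bool" where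
  "finite_variation G \<longleftrightarrow>
     (\<forall>a b c d. \<exists>K. \<forall>P Q. finite P \<and> P \<subseteq> {a..b} \<and> finite Q \<and> Q \<subseteq> {c..d} \<longrightarrow>
        (\<Sum>p\<in>cells P. \<Sum>q\<in>cells Q. \<bar>rect_increment G p q\<bar>) \<le> K)"

definition variation_sum ::
    "(real \<Rightarrow> real \<Rightarrow> real) \<Rightarrow> (real \<Rightarrow> real \<Rightarrow> real) \<Rightarrow>
     (real set \<times> (real \<Rightarrow> real)) \<times> (real set \<times> (real \<Rightarrow> real)) \<Rightarrow> real" where
  "variation_sum G f = (\<lambda>((P, \<xi>), (Q, \<eta>)).
     \<Sum>p\<in>cells P. \<Sum>q\<in>cells Q. f (\<xi> (fst p)) (\<eta> (fst q)) * \<bar>rect_increment G p q\<bar>)"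

text \<open>The integral of \<open>f\<close> with respect to the total variation of \<open>G\<close> over the plane (the limit of the
  integrals over bounded rectangles) converges and has value \<open>J\<close>.\<close>

definition has_variation_integral ::
    "(real \<Rightarrow> real \<Rightarrow> real) \<Rightarrow> (real \<Rightarrow> real \<Rightarrow> real) \<Rightarrow> real \<Rightarrow> bool" where
  "has_variation_integral G f J \<longleftrightarrow>
     (\<exists>H. (\<forall>a b c d. a \<le> b \<and> c \<le> d \<longrightarrow>
             (variation_sum G f \<longlongrightarrow> H a b c d) (tagged_partitions a b \<times>\<^sub>F tagged_partitions c d)) \<and>
          ((\<lambda>((a, b), (c, d)). H a b c d) \<longlongrightarrow> J)
             ((at_bot \<times>\<^sub>F at_top) \<times>\<^sub>F (at_bot \<times>\<^sub>F at_top)))"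

subsection \<open>The random field and the quantities in the estimate\<close>

definition covariance_fun :: "'a measure \<Rightarrow> (real \<Rightarrow> 'a \<Rightarrow> real) \<Rightarrow> real \<Rightarrow> real \<Rightarrow> real" where
  "covariance_fun M y t s = (LINT \<omega>|M. y t \<omega> * y s \<omega>)"

definition odd_symbol :: "nat \<Rightarrow> (nat \<Rightarrow> real) \<Rightarrow> real \<Rightarrow> real" where
  "odd_symbol N a l = (\<Sum>k=1..N. a k * l ^ (2 * k + 1) * (- 1) ^ k)"

definition kernel_I ::
    "(real \<Rightarrow> real) \<Rightarrow> nat \<Rightarrow> (nat \<Rightarrow> real) \<Rightarrow> real \<Rightarrow> real \<Rightarrow> real \<Rightarrow> real" where
  "kernel_I \<kappa> N a t x l = \<kappa> (l * x + t * odd_symbol N a l)"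

definition Z_weight :: "(real \<Rightarrow> real) \<Rightarrow> real \<Rightarrow> nat \<Rightarrow> (nat \<Rightarrow> real) \<Rightarrow> real \<Rightarrow> real" where
  "Z_weight Z u0 N a l = Z (\<bar>l\<bar> / 2 + u0) + Z (1 / 2 * \<bar>odd_symbol N a l\<bar> + u0)"

definition c_min :: "(real \<Rightarrow> real) \<Rightarrow> (nat \<Rightarrow> real) \<Rightarrow> nat \<Rightarrow> real" where
  "c_min c b k = (INF t\<in>{b k..b (Suc k)}. c t)"

definition eps_sup ::
    "'a measure \<Rightarrow> (real \<Rightarrow> real \<Rightarrow> 'a \<Rightarrow> real) \<Rightarrow> real \<Rightarrow> real \<Rightarrow> (nat \<Rightarrow> real) \<Rightarrow> nat \<Rightarrow> real" where
  "eps_sup M U Cy A b k =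
     Cy * (SUP (x, t)\<in>{-A..A} \<times> {b k..b (Suc k)}. sqrt (LINT \<omega>|M. \<bar>U t x \<omega>\<bar>\<^sup>2))"

definition entropy_integrand ::
    "(real \<Rightarrow> real) \<Rightarrow> (real \<Rightarrow> real) \<Rightarrow> real \<Rightarrow> real \<Rightarrow> real \<Rightarrow> real \<Rightarrow> (nat \<Rightarrow> real) \<Rightarrow> nat \<Rightarrow> real \<Rightarrow> real"
  where
  "entropy_integrand \<phi> Z u0 CZ Cy A b k s =
     Psi \<phi> (ln (A * (inv_pos Z (2 * CZ * Cy / s) - u0) + 1)
          + ln ((b (Suc k) - b k) / 2 * (inv_pos Z (2 * CZ * Cy / s) - u0) + 1))"

definition entropy_integral ::
    "(real \<Rightarrow> real) \<Rightarrow> (real \<Rightarrow> real) \<Rightarrow> real \<Rightarrow> real \<Rightarrow> real \<Rightarrow> real \<Rightarrow> (nat \<Rightarrow> real) \<Rightarrow> nat \<Rightarrow> real \<Rightarrow> real"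
  where
  "entropy_integral \<phi> Z u0 CZ Cy A b k \<delta> =
     (LINT s:{0<..\<delta>}|lborel. entropy_integrand \<phi> Z u0 CZ Cy A b k s)"

text \<open>\<open>exp (- \<phi>\<^sup>*(p / q))\<close> for \<open>p > 0\<close>, \<open>q \<ge> 0\<close>. For \<open>q = 0\<close> the argument is \<open>+\<infinity>\<close>, where the transform is
  infinite, so the value is \<open>0\<close> (division by zero in HOL would give \<open>1\<close>).\<close>

definition exp_neg_conj :: "(real \<Rightarrow> real) \<Rightarrow> real \<Rightarrow> real \<Rightarrow> real" where
  "exp_neg_conj \<phi> p q = (if q = 0 then 0 else exp (- young_fenchel \<phi> (p / q)))"

end

theory Submission
  imports Defs
begin

text \<open>The half-strip is cut into the rectangles \<open>V\<^sub>k = [-A, A] \<times> [b\<^sub>k, b\<^sub>k\<^sub>+\<^sub>1]\<close>. Since \<open>c \<ge> c\<^sub>k\<close> on \<open>V\<^sub>k\<close>, the event that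
  \<open>\<bar>U\<bar> / c\<close> exceeds \<open>u\<close> is contained in the union of the events \<open>sup \<bar>U\<bar> > u c\<^sub>k\<close> over \<open>V\<^sub>k\<close>, and it suffices
  to bound the probability of each of these and to add.

  On one rectangle the bound is obtained by chaining. Strict sub-Gaussianity turns second moments into
  bounds for moment generating functions: for a variable \<open>X\<close> in the mean-square closure of the linear
  span of \<open>y\<close>, \<open>E exp (l X) \<le> exp (\<phi> (l Cy \<parallel>X\<parallel>))\<close> with the \<open>L\<^sup>2\<close>-norm of \<open>X\<close>
  (\<open>has_ms_integral_dominated_by_variance\<close>). The second moment of an increment of \<open>U\<close> is at most the
  integral of the product of the absolute kernel increments against \<open>\<bar>\<Gamma>\<bar>\<close>
  (\<open>has_ms_integral_second_moment_le\<close>), and \<open>\<bar>sin (m d)\<bar> \<le> Z (\<bar>m\<bar> + u0) / Z (1 / h + u0)\<close> for \<open>\<bar>d\<bar> \<le> h\<close>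
  separates the frequency from the distance \<open>h\<close>. Hence points at distance \<open>h\<close> have an increment of norm
  at most \<open>2 CZ Cy / Z (1 / h + u0)\<close>; inverting this relation gives the radius of a net for a
  prescribed norm \<open>s\<close>, and the cardinality of the net is at most the exponential of the entropy in
  the integrand.

  With nets for the norms \<open>\<theta> \<epsilon>, \<theta>\<^sup>2 \<epsilon>, \<dots>\<close> the value of the field at a point is a sum of increments between
  successive nets. Hoelder's inequality with weights adapted to the entropy
  (\<open>chaining_weights\<close>) bounds the exponential moment of the supremum by
  \<open>2 exp (\<phi> (lam \<epsilon> / (1 - \<theta>)) + 2 lam J)\<close>, where \<open>J\<close> is the entropy integral divided by \<open>\<theta> (1 - \<theta>)\<close>. The
  exponential Chebyshev inequality, optimised over \<open>lam\<close>, produces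
  \<open>2 exp (- \<phi>\<^sup>*((r - 2 J) (1 - \<theta>) / \<epsilon>))\<close> for the level \<open>r\<close> (\<open>chaining_tail_bound\<close>). The lower bound on \<open>u\<close>
  says that \<open>4 J \<le> r\<close> for \<open>r = u c\<^sub>k\<close>, so that half of the level survives.

  Finally \<open>\<phi>\<^sup>*(p q) \<ge> \<phi>\<^sup>*(p) + \<phi>\<^sup>*(q)\<close> for \<open>p, q \<ge> 2\<close>, by convexity. With \<open>p = u / s\<close> and
  \<open>q = s c\<^sub>k (1 - \<theta>) / (2 \<epsilon>\<^sub>k)\<close> this splits off the factor that does not depend on \<open>k\<close>, and the remaining
  series converges by assumption.

  Two degenerate cases need separate treatment: \<open>\<epsilon>\<^sub>k = 0\<close>, where the field vanishes almost surely, and \<open>CZ = 0\<close>,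
  where it is almost surely constant on the rectangle but may be different from zero.\<close>

section \<open>N-functions and their Young-Fenchel transforms\<close>

lemma N_function_nonneg: "N_function \<phi> \<Longrightarrow> 0 \<le> \<phi> x"
  unfolding N_function_def by (metis less_eq_real_def)

lemma N_function_scale_le:
  assumes "N_function \<phi>" and "0 \<le> t" and "t \<le> 1"
  shows "\<phi> (t * x) \<le> t * \<phi> x"
proof -
  have "\<phi> ((1 - t) *\<^sub>R 0 + t *\<^sub>R x) \<le> (1 - t) * \<phi> 0 + t * \<phi> x"
    using assms unfolding N_function_def by (intro convex_onD[of UNIV \<phi>]) auto
  then show ?thesis
    using assms unfolding N_function_def by simp
qed

lemma N_function_even_abs:
  assumes "N_function \<phi>"
  shows "\<phi> \<bar>x\<bar> = \<phi> x"
  using assms unfolding N_function_def by (cases "x \<ge> 0") auto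

text \<open>The quotient \<open>\<phi>(x) / x\<close> is a slope of the convex \<open>\<phi>\<close> at the origin.\<close>

lemma N_function_slope_mono:
  assumes "N_function \<phi>" and "0 < x" and "x \<le> y"
  shows "\<phi> x / x \<le> \<phi> y / y"
  using N_function_scale_le[OF assms(1), of "x / y" y] assms by (simp add: field_simps)

lemma N_function_strict_mono:
  assumes "N_function \<phi>"
  shows "strict_mono_on {0..} \<phi>"
proof (rule strict_mono_onI)
  fix x y :: real
  assume "x \<in> {0..}" and "y \<in> {0..}" and xy: "x < y"
  then have "0 \<le> x" by simp
  have pos: "0 < \<phi> y"
    using assms xy \<open>0 \<le> x\<close> unfolding N_function_def by auto
  have "\<phi> x \<le> (x / y) * \<phi> y"
    using N_function_scale_le[OF assms, of "x / y" y] xy \<open>0 \<le> x\<close> by simp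
  also have "\<dots> < 1 * \<phi> y"
    using pos xy \<open>0 \<le> x\<close> by (intro mult_strict_right_mono) auto
  finally show "\<phi> x < \<phi> y" by simp
qed

lemma N_function_mono_abs:
  assumes "N_function \<phi>" and "\<bar>x\<bar> \<le> \<bar>y\<bar>"
  shows "\<phi> x \<le> \<phi> y"
  using strict_mono_on_leD[OF N_function_strict_mono[OF assms(1)], of "\<bar>x\<bar>" "\<bar>y\<bar>"] assms
  by (simp add: N_function_even_abs)

lemma N_function_at_top:
  assumes "N_function \<phi>"
  shows "filterlim \<phi> at_top at_top"
proof -
  have "filterlim (\<lambda>x. \<phi> x / x * x) at_top at_top"
    using assms unfolding N_function_def
    by (intro filterlim_at_top_mult_at_top filterlim_ident) auto
  then show ?thesis
    by (rule filterlim_mono_eventually[OF _ order_refl order_refl])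
      (rule eventually_mono[OF eventually_gt_at_top[of 0]], simp)
qed

lemma inv_pos_works:
  assumes "continuous_on {0..} f" and "filterlim f at_top at_top" and "f 0 \<le> v"
  shows "0 \<le> inv_pos f v" and "f (inv_pos f v) = v"
proof -
  obtain w where w: "0 \<le> w" "v \<le> f w"
    using assms(2) by (metis eventually_at_top_linorder filterlim_at_top max.cobounded1 max.cobounded2)
  have "\<exists>x\<ge>0. x \<le> w \<and> f x = v"
    using assms w by (intro IVT') (auto intro: continuous_on_subset)
  then have "v \<in> f ` {0..}" by auto
  from inv_into_into[OF this] f_inv_into_f[OF this]
  show "0 \<le> inv_pos f v" and "f (inv_pos f v) = v"
    unfolding inv_pos_def by auto
qed

lemma N_function_inv_pos:
  assumes "N_function \<phi>" and "0 < v"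
  shows "0 < inv_pos \<phi> v" and "\<phi> (inv_pos \<phi> v) = v"
proof -
  have *: "0 \<le> inv_pos \<phi> v" "\<phi> (inv_pos \<phi> v) = v"
    using assms N_function_at_top[OF assms(1)]
    by (auto intro!: inv_pos_works simp: N_function_def intro: continuous_on_subset)
  moreover have "inv_pos \<phi> v \<noteq> 0"
    using *(2) assms unfolding N_function_def by auto
  ultimately show "0 < inv_pos \<phi> v" and "\<phi> (inv_pos \<phi> v) = v" by auto
qed

text \<open>With \<open>w = \<phi>\<inverse>(v)\<close> the function \<open>\<Psi>(v)\<close> is the slope \<open>\<phi>(w) / w\<close>, and \<open>\<phi>\<inverse>\<close> is increasing.\<close>

lemma Psi_mono:
  assumes "N_function \<phi>" and "0 < v" and "v \<le> v'"
  shows "Psi \<phi> v \<le> Psi \<phi> v'"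
proof -
  note inv = N_function_inv_pos[OF assms(1)]
  have v': "0 < v'" using assms by simp
  have "inv_pos \<phi> v \<le> inv_pos \<phi> v'"
    using strict_mono_on_less[OF N_function_strict_mono[OF assms(1)], of "inv_pos \<phi> v'" "inv_pos \<phi> v"]
      inv[OF assms(2)] inv[OF v'] assms(3) by force
  from N_function_slope_mono[OF assms(1) inv(1)[OF assms(2)] this] show ?thesis
    using inv[OF assms(2)] inv[OF v'] by (simp add: Psi_def)
qed

lemma Psi_nonneg: "N_function \<phi> \<Longrightarrow> 0 < v \<Longrightarrow> 0 \<le> Psi \<phi> v"
  using N_function_inv_pos(1)[of \<phi> v] by (simp add: Psi_def)

lemma young_fenchel_bdd_above:
  assumes "N_function \<phi>"
  shows "bdd_above (range (\<lambda>y. x * y - \<phi> y))"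
proof -
  obtain w where w: "\<And>y. w \<le> y \<Longrightarrow> \<bar>x\<bar> \<le> \<phi> y / y"
    using assms unfolding N_function_def filterlim_at_top eventually_at_top_linorder by meson
  have "x * y - \<phi> y \<le> \<bar>x\<bar> * \<bar>w\<bar>" for y
  proof (cases "\<bar>y\<bar> \<le> \<bar>w\<bar>")
    case True
    have "x * y \<le> \<bar>x\<bar> * \<bar>y\<bar>" by (metis abs_ge_self abs_mult)
    also have "\<dots> \<le> \<bar>x\<bar> * \<bar>w\<bar>" using True by (intro mult_left_mono) auto
    finally show ?thesis using N_function_nonneg[OF assms, of y] by simp
  next
    case False
    then have "\<bar>x\<bar> * \<bar>y\<bar> \<le> \<phi> \<bar>y\<bar>"
      using w[of "\<bar>y\<bar>"] by (simp add: field_simps)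
    moreover have "x * y \<le> \<bar>x\<bar> * \<bar>y\<bar>" by (metis abs_ge_self abs_mult)
    ultimately have "x * y - \<phi> y \<le> 0" by (simp add: N_function_even_abs[OF assms])
    also have "0 \<le> \<bar>x\<bar> * \<bar>w\<bar>" by simp
    finally show ?thesis .
  qed
  then show ?thesis by (auto intro!: bdd_aboveI)
qed

lemma young_fenchel_ge:
  "N_function \<phi> \<Longrightarrow> x * y - \<phi> y \<le> young_fenchel \<phi> x"
  unfolding young_fenchel_def by (rule cSUP_upper[OF UNIV_I young_fenchel_bdd_above])

lemma young_fenchel_nonneg: "N_function \<phi> \<Longrightarrow> 0 \<le> young_fenchel \<phi> x"
  using young_fenchel_ge[of \<phi> x 0] by (simp add: N_function_def)

text \<open>Every convex function that vanishes at the origin satisfies this; for \<open>\<phi>\<^sup>*\<close> it is read off from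
  \<open>t \<phi> \<le> \<phi>\<close> inside the supremum.\<close>

lemma young_fenchel_scale_le:
  assumes "N_function \<phi>" and t: "0 < t" "t \<le> 1"
  shows "young_fenchel \<phi> v \<le> t * young_fenchel \<phi> (v / t)"
  unfolding young_fenchel_def[of \<phi> v]
proof (rule cSUP_least)
  fix y
  have "v * y - \<phi> y \<le> t * (v / t * y - \<phi> y)"
    using t mult_right_mono[of t 1 "\<phi> y"] N_function_nonneg[OF assms(1), of y]
    by (simp add: field_simps)
  also have "\<dots> \<le> t * young_fenchel \<phi> (v / t)"
    using t by (intro mult_left_mono young_fenchel_ge[OF assms(1)]) simp
  finally show "v * y - \<phi> y \<le> t * young_fenchel \<phi> (v / t)" .
qed simp

lemma young_fenchel_mono:
  assumes "N_function \<phi>" and "0 \<le> x" and "x \<le> x'"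
  shows "young_fenchel \<phi> x \<le> young_fenchel \<phi> x'"
proof (cases "x = 0")
  case True
  have "young_fenchel \<phi> 0 \<le> 0"
    unfolding young_fenchel_def by (rule cSUP_least) (simp_all add: N_function_nonneg[OF assms(1)])
  then show ?thesis using True young_fenchel_nonneg[OF assms(1), of x'] by simp
next
  case False
  then have "young_fenchel \<phi> x \<le> (x / x') * young_fenchel \<phi> (x / (x / x'))"
    using assms by (intro young_fenchel_scale_le) auto
  also have "x / (x / x') = x'" using False by simp
  also have "(x / x') * young_fenchel \<phi> x' \<le> 1 * young_fenchel \<phi> x'"
    using assms False by (intro mult_right_mono young_fenchel_nonneg) (auto simp: divide_le_eq_1)
  finally show ?thesis by simp
qed

text \<open>By convexity, \<open>\<phi>\<^sup>*(p) \<le> \<phi>\<^sup>*(p q) / q\<close> and \<open>\<phi>\<^sup>*(q) \<le> \<phi>\<^sup>*(p q) / p\<close>, and \<open>1/p + 1/q \<le> 1\<close>. This is where the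
  bounds on the parameter \<open>s\<close> of the main estimate come from.\<close>

lemma young_fenchel_mult_ge_add:
  assumes "N_function \<phi>" and "2 \<le> p" and "2 \<le> q"
  shows "young_fenchel \<phi> p + young_fenchel \<phi> q \<le> young_fenchel \<phi> (p * q)"
proof -
  have "young_fenchel \<phi> p + young_fenchel \<phi> q
      \<le> (1 / q) * young_fenchel \<phi> (p * q) + (1 / p) * young_fenchel \<phi> (p * q)"
    using young_fenchel_scale_le[OF assms(1), of "1 / q" p]
      young_fenchel_scale_le[OF assms(1), of "1 / p" q] assms by (simp add: mult.commute)
  also have "\<dots> = (1 / q + 1 / p) * young_fenchel \<phi> (p * q)" by (simp add: algebra_simps)
  also have "\<dots> \<le> 1 * young_fenchel \<phi> (p * q)"
  proof (rule mult_right_mono)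
    have "1 / p \<le> 1 / 2" and "1 / q \<le> 1 / 2" using assms by (auto simp: field_simps)
    then show "1 / q + 1 / p \<le> 1" by linarith
  qed (rule young_fenchel_nonneg[OF assms(1)])
  finally show ?thesis by simp
qed

section \<open>The kernel\<close>

lemma abs_cos_diff_le: "\<bar>cos p - cos q\<bar> \<le> 2 * \<bar>sin ((p - q) / 2)\<bar>" for p q :: real
proof -
  have sin_swap: "\<bar>sin ((q - p) / 2)\<bar> = \<bar>sin ((p - q) / 2)\<bar>"
  proof -
    have "(q - p) / 2 = - ((p - q) / 2)" by (simp add: field_simps)
    then show ?thesis by (simp only: sin_minus abs_minus_cancel)
  qed
  have "\<bar>cos p - cos q\<bar> = 2 * \<bar>sin ((p + q) / 2)\<bar> * \<bar>sin ((p - q) / 2)\<bar>"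
    by (subst cos_diff_cos) (simp add: abs_mult sin_swap)
  also have "\<dots> \<le> 2 * 1 * \<bar>sin ((p - q) / 2)\<bar>"
    by (intro mult_right_mono mult_left_mono) auto
  finally show ?thesis by simp
qed

lemma abs_sin_diff_le: "\<bar>sin p - sin q\<bar> \<le> 2 * \<bar>sin ((p - q) / 2)\<bar>" for p q :: real
proof -
  have "\<bar>sin p - sin q\<bar> = 2 * \<bar>sin ((p - q) / 2)\<bar> * \<bar>cos ((p + q) / 2)\<bar>"
    by (subst sin_diff_sin) (simp add: abs_mult)
  also have "\<dots> \<le> 2 * \<bar>sin ((p - q) / 2)\<bar> * 1"
    by (intro mult_left_mono) auto
  finally show ?thesis by simp
qed

lemma abs_sin_add_le: "\<bar>sin (p + q)\<bar> \<le> \<bar>sin p\<bar> + \<bar>sin q\<bar>" for p q :: real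
proof -
  have "\<bar>sin (p + q)\<bar> \<le> \<bar>sin p\<bar> * \<bar>cos q\<bar> + \<bar>cos p\<bar> * \<bar>sin q\<bar>"
    unfolding sin_add by (metis abs_mult abs_triangle_ineq)
  also have "\<dots> \<le> \<bar>sin p\<bar> * 1 + 1 * \<bar>sin q\<bar>"
    by (intro add_mono mult_left_mono mult_right_mono) auto
  finally show ?thesis by simp
qed

lemma admissible_nonneg:
  assumes "admissible \<phi> Z u0" and "0 \<le> v"
  shows "0 \<le> Z v"
proof (cases "v = 0")
  case True
  have "continuous_on {0..} Z" using assms unfolding admissible_def by auto
  then have "(Z \<longlongrightarrow> Z 0) (at_right 0)"
    unfolding continuous_on_def by (auto intro: tendsto_within_subset)
  moreover have "\<forall>\<^sub>F v in at_right 0. 0 \<le> Z v"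
    unfolding eventually_at_right_field using assms unfolding admissible_def
    by (meson less_eq_real_def gt_ex)
  ultimately have "0 \<le> Z 0"
    by (intro tendsto_lowerbound) auto
  then show ?thesis using True by simp
next
  case False
  then show ?thesis using assms unfolding admissible_def by (simp add: less_eq_real_def)
qed

lemma admissible_mono:
  assumes "admissible \<phi> Z u0" and "0 \<le> v" and "v \<le> w"
  shows "Z v \<le> Z w"
  using assms strict_mono_on_leD[of "{0..}" Z v w] unfolding admissible_def by auto

lemma admissible_offset_nonneg: "admissible \<phi> Z u0 \<Longrightarrow> 0 \<le> u0"
  unfolding admissible_def by auto

text \<open>If \<open>\<bar>m\<bar> h \<ge> 1\<close>, the right-hand side is at least \<open>1\<close>. Otherwise the sine is at most
  \<open>\<bar>m\<bar> h \<le> (\<bar>m\<bar> + u0) / (1/h + u0)\<close>, and \<open>v / Z v\<close> is non-decreasing beyond \<open>u0\<close>.\<close>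

lemma abs_sin_le_admissible_ratio:
  assumes adm: "admissible \<phi> Z u0" and "0 < h" and "\<bar>d\<bar> \<le> h"
  shows "\<bar>sin (m * d)\<bar> \<le> Z (\<bar>m\<bar> + u0) / Z (1 / h + u0)"
proof -
  have u0: "0 \<le> u0" by (rule admissible_offset_nonneg[OF adm])
  have pos: "0 < Z (1 / h + u0)"
    using adm assms u0 unfolding admissible_def by (simp add: add_pos_nonneg)
  consider "m = 0" | "1 \<le> \<bar>m\<bar> * h" | "m \<noteq> 0" "\<bar>m\<bar> * h < 1" by linarith
  then show ?thesis
  proof cases
    case 1
    then show ?thesis using admissible_nonneg[OF adm u0] pos by simp
  next
    case 2
    then have "Z (1 / h + u0) \<le> Z (\<bar>m\<bar> + u0)"
      using assms u0 by (intro admissible_mono[OF adm]) (auto simp: field_simps)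
    then have "1 \<le> Z (\<bar>m\<bar> + u0) / Z (1 / h + u0)" using pos by simp
    then show ?thesis using abs_sin_le_one[of "m * d"] by linarith
  next
    case 3
    let ?v = "\<bar>m\<bar> + u0" and ?w = "1 / h + u0"
    have vw: "u0 < ?v" "?v \<le> ?w" using 3 assms by (auto simp: field_simps)
    have "mono_on {u0<..} (\<lambda>v. v / Z v)"
      using adm unfolding admissible_def by blast
    from mono_onD[OF this, of ?v ?w] have "?v / Z ?v \<le> ?w / Z ?w"
      using vw by (simp only: greaterThan_iff less_le_trans[OF vw])
    moreover have "0 < Z ?v" using adm vw u0 unfolding admissible_def by auto
    moreover have w: "0 < ?w" using vw u0 by linarith
    ultimately have ratio: "?v / ?w \<le> Z ?v / Z ?w" using pos by (simp add: field_simps)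
    have "\<bar>m\<bar> * (h * u0) \<le> u0" using 3 u0 mult_right_mono[of "\<bar>m\<bar> * h" 1 u0] by (simp add: ac_simps)
    then have "\<bar>m\<bar> * h * ?w \<le> ?v" using assms by (simp add: field_simps)
    then have "\<bar>m\<bar> * h \<le> ?v / ?w" using w by (simp add: field_simps)
    moreover have "\<bar>sin (m * d)\<bar> \<le> \<bar>m\<bar> * h"
      using abs_sin_x_le_abs_x[of "m * d"] mult_left_mono[OF assms(3), of "\<bar>m\<bar>"]
      by (simp add: abs_mult)
    ultimately show ?thesis using ratio by linarith
  qed
qed

lemma kernel_I_increment_le:
  assumes "\<kappa> = cos \<or> \<kappa> = sin" and adm: "admissible \<phi> Z u0"
    and "0 < h" and "\<bar>x - x'\<bar> \<le> h" and "\<bar>t - t'\<bar> \<le> h"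
  shows "\<bar>kernel_I \<kappa> N a t x l - kernel_I \<kappa> N a t' x' l\<bar>
    \<le> 2 / Z (1 / h + u0) * Z_weight Z u0 N a l"
proof -
  let ?S = "odd_symbol N a l"
  have "\<bar>kernel_I \<kappa> N a t x l - kernel_I \<kappa> N a t' x' l\<bar>
      \<le> 2 * \<bar>sin ((l * x + t * ?S - (l * x' + t' * ?S)) / 2)\<bar>"
    using assms(1) abs_cos_diff_le abs_sin_diff_le unfolding kernel_I_def by blast
  also have "(l * x + t * ?S - (l * x' + t' * ?S)) / 2 = (l / 2) * (x - x') + (?S / 2) * (t - t')"
    by (simp add: field_simps)
  also have "\<bar>sin \<dots>\<bar> \<le> \<bar>sin ((l / 2) * (x - x'))\<bar> + \<bar>sin ((?S / 2) * (t - t'))\<bar>"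
    by (rule abs_sin_add_le)
  also have "\<dots> \<le> Z (\<bar>l / 2\<bar> + u0) / Z (1 / h + u0) + Z (\<bar>?S / 2\<bar> + u0) / Z (1 / h + u0)"
    by (intro add_mono abs_sin_le_admissible_ratio[OF adm] assms)
  finally show ?thesis by (simp add: Z_weight_def add_divide_distrib distrib_left)
qed

lemma Z_weight_ge:
  assumes "admissible \<phi> Z u0"
  shows "2 * Z u0 \<le> Z_weight Z u0 N a l"
  using admissible_mono[OF assms admissible_offset_nonneg[OF assms], of "\<bar>l\<bar> / 2 + u0"]
    admissible_mono[OF assms admissible_offset_nonneg[OF assms], of "1 / 2 * \<bar>odd_symbol N a l\<bar> + u0"]
  by (simp add: Z_weight_def)

section \<open>Mean-square convergence\<close>

lemma square_integrable_integrable_mult: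
  assumes "square_integrable M X" and "square_integrable M Y"
  shows "integrable M (\<lambda>\<omega>. X \<omega> * Y \<omega>)"
proof (rule Bochner_Integration.integrable_bound)
  show "integrable M (\<lambda>\<omega>. (X \<omega>)\<^sup>2 + (Y \<omega>)\<^sup>2)"
    using assms unfolding square_integrable_def by auto
  show "(\<lambda>\<omega>. X \<omega> * Y \<omega>) \<in> borel_measurable M"
    using assms unfolding square_integrable_def by auto
  have "\<bar>x * y\<bar> \<le> x\<^sup>2 + y\<^sup>2" for x y :: real
  proof -
    have "2 * (\<bar>x\<bar> * \<bar>y\<bar>) \<le> x\<^sup>2 + y\<^sup>2"
      using sum_squares_bound[of "\<bar>x\<bar>" "\<bar>y\<bar>"] by (simp add: ac_simps)
    moreover have "0 \<le> \<bar>x\<bar> * \<bar>y\<bar>" by simp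
    ultimately show ?thesis unfolding abs_mult by linarith
  qed
  then show "AE \<omega> in M. norm (X \<omega> * Y \<omega>) \<le> norm ((X \<omega>)\<^sup>2 + (Y \<omega>)\<^sup>2)" by simp
qed

lemma square_integrable_add [intro]:
  assumes "square_integrable M X" and "square_integrable M Y"
  shows "square_integrable M (\<lambda>\<omega>. X \<omega> + Y \<omega>)"
  using assms square_integrable_integrable_mult[OF assms]
  unfolding square_integrable_def power2_sum by (auto simp: mult.assoc)

lemma square_integrable_cmult [intro]:
  "square_integrable M X \<Longrightarrow> square_integrable M (\<lambda>\<omega>. c * X \<omega>)"
  unfolding square_integrable_def by (auto simp: power_mult_distrib)

lemma square_integrable_diff [intro]:
  assumes "square_integrable M X" and "square_integrable M Y"
  shows "square_integrable M (\<lambda>\<omega>. X \<omega> - Y \<omega>)"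
  using square_integrable_add[OF assms(1) square_integrable_cmult[OF assms(2), of "-1"]] by simp

lemma ms_tendsto_diff:
  assumes X: "ms_tendsto M S X F" and Y: "ms_tendsto M T Y F"
  shows "ms_tendsto M (\<lambda>i \<omega>. S i \<omega> - T i \<omega>) (\<lambda>\<omega>. X \<omega> - Y \<omega>) F"
proof -
  let ?dX = "\<lambda>i. LINT \<omega>|M. (S i \<omega> - X \<omega>)\<^sup>2" and ?dY = "\<lambda>i. LINT \<omega>|M. (T i \<omega> - Y \<omega>)\<^sup>2"
  have XY: "square_integrable M X" "square_integrable M Y"
    using assms unfolding ms_tendsto_def by auto
  have ev: "\<forall>\<^sub>F i in F. square_integrable M (S i) \<and> square_integrable M (T i)"
    using assms unfolding ms_tendsto_def by (auto intro: eventually_conj)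
  have "((\<lambda>i. 2 * ?dX i + 2 * ?dY i) \<longlongrightarrow> 2 * 0 + 2 * 0) F"
    using assms unfolding ms_tendsto_def by (intro tendsto_intros) auto
  then have lim: "((\<lambda>i. 2 * ?dX i + 2 * ?dY i) \<longlongrightarrow> 0) F" by simp
  have "((\<lambda>i. LINT \<omega>|M. (S i \<omega> - T i \<omega> - (X \<omega> - Y \<omega>))\<^sup>2) \<longlongrightarrow> 0) F"
  proof (rule tendsto_sandwich[OF _ _ tendsto_const lim])
    show "\<forall>\<^sub>F i in F. (LINT \<omega>|M. (S i \<omega> - T i \<omega> - (X \<omega> - Y \<omega>))\<^sup>2) \<le> 2 * ?dX i + 2 * ?dY i"
      using ev
    proof eventually_elim
      case (elim i)
      have int: "integrable M (\<lambda>\<omega>. (S i \<omega> - X \<omega>)\<^sup>2)" "integrable M (\<lambda>\<omega>. (T i \<omega> - Y \<omega>)\<^sup>2)"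
        "integrable M (\<lambda>\<omega>. (S i \<omega> - T i \<omega> - (X \<omega> - Y \<omega>))\<^sup>2)"
        using square_integrable_diff[OF _ XY(1), of "S i"] square_integrable_diff[OF _ XY(2), of "T i"]
          square_integrable_diff[OF square_integrable_diff square_integrable_diff, of M "S i" "T i" X Y]
          elim XY unfolding square_integrable_def by auto
      have "(LINT \<omega>|M. (S i \<omega> - T i \<omega> - (X \<omega> - Y \<omega>))\<^sup>2)
          \<le> (LINT \<omega>|M. 2 * (S i \<omega> - X \<omega>)\<^sup>2 + 2 * (T i \<omega> - Y \<omega>)\<^sup>2)"
      proof (rule integral_mono)
        fix \<omega>
        have "(p - q)\<^sup>2 \<le> 2 * p\<^sup>2 + 2 * q\<^sup>2" for p q :: real
          using zero_le_power2[of "p + q"] by (simp add: power2_eq_square algebra_simps)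
        from this[of "S i \<omega> - X \<omega>" "T i \<omega> - Y \<omega>"]
        show "(S i \<omega> - T i \<omega> - (X \<omega> - Y \<omega>))\<^sup>2 \<le> 2 * (S i \<omega> - X \<omega>)\<^sup>2 + 2 * (T i \<omega> - Y \<omega>)\<^sup>2"
          by (simp add: algebra_simps)
      qed (use int in auto)
      then show ?case using int by simp
    qed
  qed simp
  moreover have "\<forall>\<^sub>F i in F. square_integrable M (\<lambda>\<omega>. S i \<omega> - T i \<omega>)"
    using ev by (auto elim: eventually_mono)
  ultimately show ?thesis
    using XY unfolding ms_tendsto_def by auto
qed

definition second_moment :: "'a measure \<Rightarrow> ('a \<Rightarrow> real) \<Rightarrow> real" where
  "second_moment M X = (LINT \<omega>|M. (X \<omega>)\<^sup>2)"

lemma second_moment_nonneg: "0 \<le> second_moment M X"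
  unfolding second_moment_def by simp

lemma ms_tendsto_second_moment:
  assumes "ms_tendsto M S X F"
  shows "((\<lambda>i. second_moment M (S i)) \<longlongrightarrow> second_moment M X) F"
proof (rule tendstoI)
  fix e :: real
  assume "0 < e"
  \<comment> \<open>\<open>\<bar>2 x d\<bar> \<le> \<eta> x\<^sup>2 + d\<^sup>2 / \<eta>\<close> replaces the Cauchy-Schwarz inequality.\<close>
  define \<eta> where "\<eta> = e / (2 * (second_moment M X + 1))"
  have \<eta>: "0 < \<eta>" using \<open>0 < e\<close> second_moment_nonneg[of M X] unfolding \<eta>_def by simp
  have \<eta>X: "\<eta> * second_moment M X < e / 2"
    using \<open>0 < e\<close> second_moment_nonneg[of M X] unfolding \<eta>_def by (simp add: field_simps)
  have X: "square_integrable M X" using assms unfolding ms_tendsto_def by auto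
  have "((\<lambda>i. (1 + 1 / \<eta>) * (LINT \<omega>|M. (S i \<omega> - X \<omega>)\<^sup>2)) \<longlongrightarrow> (1 + 1 / \<eta>) * 0) F"
    using assms unfolding ms_tendsto_def by (intro tendsto_intros) auto
  then have "\<forall>\<^sub>F i in F. (1 + 1 / \<eta>) * (LINT \<omega>|M. (S i \<omega> - X \<omega>)\<^sup>2) < e / 2"
    using \<open>0 < e\<close> by (intro order_tendstoD(2)) auto
  moreover have "\<forall>\<^sub>F i in F. square_integrable M (S i)" using assms unfolding ms_tendsto_def by auto
  ultimately show "\<forall>\<^sub>F i in F. dist (second_moment M (S i)) (second_moment M X) < e"
  proof eventually_elim
    case (elim i)
    have int: "integrable M (\<lambda>\<omega>. (S i \<omega> - X \<omega>)\<^sup>2)" "integrable M (\<lambda>\<omega>. (X \<omega>)\<^sup>2)"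
      "integrable M (\<lambda>\<omega>. (S i \<omega>)\<^sup>2)"
      using square_integrable_diff[of M "S i" X] elim X unfolding square_integrable_def by auto
    have "\<bar>second_moment M (S i) - second_moment M X\<bar> = \<bar>LINT \<omega>|M. (S i \<omega>)\<^sup>2 - (X \<omega>)\<^sup>2\<bar>"
      using int unfolding second_moment_def by simp
    also have "\<dots> \<le> (LINT \<omega>|M. \<bar>(S i \<omega>)\<^sup>2 - (X \<omega>)\<^sup>2\<bar>)" by (rule integral_abs_bound)
    also have "\<dots> \<le> (LINT \<omega>|M. \<eta> * (X \<omega>)\<^sup>2 + (1 + 1 / \<eta>) * (S i \<omega> - X \<omega>)\<^sup>2)"
    proof (rule integral_mono)
      fix \<omega>
      have "\<bar>(x + d)\<^sup>2 - x\<^sup>2\<bar> \<le> \<eta> * x\<^sup>2 + (1 + 1 / \<eta>) * d\<^sup>2" for x d :: real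
      proof -
        have "0 \<le> (\<eta> * \<bar>x\<bar> - \<bar>d\<bar>)\<^sup>2 / \<eta>" using \<eta> by simp
        also have "\<dots> = \<eta> * x\<^sup>2 + d\<^sup>2 / \<eta> - 2 * (\<bar>x\<bar> * \<bar>d\<bar>)"
          using \<eta> by (simp add: power2_diff field_simps) (simp add: power2_eq_square)
        finally have "2 * (\<bar>x\<bar> * \<bar>d\<bar>) \<le> \<eta> * x\<^sup>2 + d\<^sup>2 / \<eta>" by simp
        moreover have "\<bar>(x + d)\<^sup>2 - x\<^sup>2\<bar> \<le> 2 * (\<bar>x\<bar> * \<bar>d\<bar>) + d\<^sup>2"
          using abs_triangle_ineq[of "2 * (x * d)" "d\<^sup>2"] by (simp add: power2_sum abs_mult ac_simps)
        moreover have "(1 + 1 / \<eta>) * d\<^sup>2 = d\<^sup>2 + d\<^sup>2 / \<eta>" by (simp add: distrib_right)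
        ultimately show ?thesis by linarith
      qed
      from this[of "X \<omega>" "S i \<omega> - X \<omega>"]
      show "\<bar>(S i \<omega>)\<^sup>2 - (X \<omega>)\<^sup>2\<bar> \<le> \<eta> * (X \<omega>)\<^sup>2 + (1 + 1 / \<eta>) * (S i \<omega> - X \<omega>)\<^sup>2" by simp
    qed (use int in auto)
    also have "\<dots> = \<eta> * second_moment M X + (1 + 1 / \<eta>) * (LINT \<omega>|M. (S i \<omega> - X \<omega>)\<^sup>2)"
      using int unfolding second_moment_def by simp
    also have "\<dots> < e" using elim \<eta>X by linarith
    finally show ?case by (simp add: dist_real_def)
  qed
qed

section \<open>Bounds for the moment generating function\<close>

text \<open>With the integral of a non-negative function no integrability has to be carried along; the bound
  implies it.\<close>

definition mgf_le :: "'a measure \<Rightarrow> (real \<Rightarrow> real) \<Rightarrow> ('a \<Rightarrow> real) \<Rightarrow> real \<Rightarrow> bool" where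
  "mgf_le M \<phi> X \<sigma> \<longleftrightarrow> (\<forall>l. (\<integral>\<^sup>+ \<omega>. ennreal (exp (l * X \<omega>)) \<partial>M) \<le> ennreal (exp (\<phi> (\<sigma> * l))))"

lemma mgf_leD: "mgf_le M \<phi> X \<sigma> \<Longrightarrow> (\<integral>\<^sup>+ \<omega>. ennreal (exp (l * X \<omega>)) \<partial>M) \<le> ennreal (exp (\<phi> (\<sigma> * l)))"
  unfolding mgf_le_def by auto

lemma mgf_le_mono:
  assumes "N_function \<phi>" and "mgf_le M \<phi> X \<sigma>" and "0 \<le> \<sigma>" and "\<sigma> \<le> \<sigma>'"
  shows "mgf_le M \<phi> X \<sigma>'"
  unfolding mgf_le_def
proof
  fix l
  have "\<bar>\<sigma> * l\<bar> \<le> \<bar>\<sigma>' * l\<bar>"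
    unfolding abs_mult using assms(3,4) by (intro mult_right_mono) auto
  from N_function_mono_abs[OF assms(1) this] have "\<phi> (\<sigma> * l) \<le> \<phi> (\<sigma>' * l)" .
  then have "ennreal (exp (\<phi> (\<sigma> * l))) \<le> ennreal (exp (\<phi> (\<sigma>' * l)))"
    by (intro ennreal_leI) simp
  then show "(\<integral>\<^sup>+ \<omega>. ennreal (exp (l * X \<omega>)) \<partial>M) \<le> ennreal (exp (\<phi> (\<sigma>' * l)))"
    using mgf_leD[OF assms(2), of l] order_trans by blast
qed

text \<open>Since \<open>\<phi>(0) = 0\<close>, \<open>E (e\<^sup>X + e\<^sup>-\<^sup>X) \<le> 2\<close>, while \<open>e\<^sup>x + e\<^sup>-\<^sup>x\<close> exceeds \<open>2\<close> by a square that
  is zero only for \<open>x = 0\<close>.\<close>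

lemma mgf_le_zero_imp_AE_zero:
  assumes "prob_space M" and "N_function \<phi>" and [measurable]: "X \<in> borel_measurable M"
    and "mgf_le M \<phi> X 0"
  shows "AE \<omega> in M. X \<omega> = 0"
proof -
  interpret prob_space M by fact
  let ?q = "\<lambda>\<omega>. (exp (X \<omega> / 2) - exp (- X \<omega> / 2))\<^sup>2"
  have eq: "exp x + exp (- x) = 2 + (exp (x / 2) - exp (- x / 2))\<^sup>2" for x :: real
  proof -
    have "(exp (x / 2))\<^sup>2 = exp x" "(exp (- x / 2))\<^sup>2 = exp (- x)" "exp (x / 2) * exp (- x / 2) = 1"
      by (simp_all add: power2_eq_square flip: exp_add)
    then show ?thesis by (simp add: power2_diff)
  qed
  have "ennreal 2 + (\<integral>\<^sup>+ \<omega>. ennreal (?q \<omega>) \<partial>M) = (\<integral>\<^sup>+ \<omega>. ennreal 2 + ennreal (?q \<omega>) \<partial>M)"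
    by (subst nn_integral_add) (simp_all add: emeasure_space_1)
  also have "\<dots> = (\<integral>\<^sup>+ \<omega>. ennreal (exp (1 * X \<omega>)) + ennreal (exp ((-1) * X \<omega>)) \<partial>M)"
  proof (rule nn_integral_cong)
    fix \<omega>
    have "ennreal (exp (1 * X \<omega>)) + ennreal (exp ((-1) * X \<omega>)) = ennreal (exp (X \<omega>) + exp (- X \<omega>))"
      by (simp flip: ennreal_plus)
    also have "\<dots> = ennreal (2 + ?q \<omega>)" by (simp only: eq)
    also have "\<dots> = ennreal 2 + ennreal (?q \<omega>)" by (rule ennreal_plus) auto
    finally show "ennreal 2 + ennreal (?q \<omega>) = ennreal (exp (1 * X \<omega>)) + ennreal (exp ((-1) * X \<omega>))" ..
  qed
  also have "\<dots> = (\<integral>\<^sup>+ \<omega>. ennreal (exp (1 * X \<omega>)) \<partial>M) + (\<integral>\<^sup>+ \<omega>. ennreal (exp ((-1) * X \<omega>)) \<partial>M)"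
    by (rule nn_integral_add) simp_all
  also have "\<dots> \<le> ennreal (exp (\<phi> (0 * 1))) + ennreal (exp (\<phi> (0 * (-1))))"
    by (intro add_mono mgf_leD assms)
  also have "\<dots> = ennreal 2"
    using assms(2) unfolding N_function_def by (simp flip: ennreal_plus)
  finally have "ennreal 2 + (\<integral>\<^sup>+ \<omega>. ennreal (?q \<omega>) \<partial>M) \<le> ennreal 2 + 0" by simp
  then have "(\<integral>\<^sup>+ \<omega>. ennreal (?q \<omega>) \<partial>M) \<le> 0"
    by (subst (asm) ennreal_add_left_cancel_le) simp
  then have "(\<integral>\<^sup>+ \<omega>. ennreal (?q \<omega>) \<partial>M) = 0" by simp
  then have "AE \<omega> in M. ennreal (?q \<omega>) = 0"
    by (subst (asm) nn_integral_0_iff_AE) simp_all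
  then show ?thesis
    by eventually_elim simp
qed

text \<open>Non-negativity of \<open>C \<parallel>X\<parallel>\<close> is recorded because a negative determining constant is compatible
  with strict sub-Gaussianity, but only when all the variables vanish almost surely.\<close>

definition dominated_by_variance ::
    "'a measure \<Rightarrow> (real \<Rightarrow> real) \<Rightarrow> real \<Rightarrow> ('a \<Rightarrow> real) \<Rightarrow> bool" where
  "dominated_by_variance M \<phi> C X \<longleftrightarrow>
     0 \<le> C * sqrt (second_moment M X) \<and> mgf_le M \<phi> X (C * sqrt (second_moment M X))"

text \<open>The bound passes to mean-square limits: along a sequence that converges almost everywhere it
  follows from Fatou's lemma.\<close>

lemma dominated_by_variance_ms_limit:
  assumes "N_function \<phi>" and lim: "ms_tendsto M S X F" and "F \<noteq> bot"
    and dom: "\<forall>\<^sub>F i in F. dominated_by_variance M \<phi> C (S i)"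
  shows "dominated_by_variance M \<phi> C X"
proof -
  have X: "square_integrable M X" and ev: "\<forall>\<^sub>F i in F. square_integrable M (S i)"
    and lim0: "((\<lambda>i. LINT \<omega>|M. (S i \<omega> - X \<omega>)\<^sup>2) \<longlongrightarrow> 0) F"
    using lim unfolding ms_tendsto_def by auto
  have "\<exists>i. square_integrable M (S i) \<and> dominated_by_variance M \<phi> C (S i) \<and>
      (LINT \<omega>|M. (S i \<omega> - X \<omega>)\<^sup>2) < 1 / real (Suc n)" for n
  proof (rule eventually_happens'[OF \<open>F \<noteq> bot\<close>])
    have "\<forall>\<^sub>F i in F. (LINT \<omega>|M. (S i \<omega> - X \<omega>)\<^sup>2) < 1 / real (Suc n)"
      by (intro order_tendstoD(2)[OF lim0]) simp
    with ev dom show "\<forall>\<^sub>F i in F. square_integrable M (S i) \<and> dominated_by_variance M \<phi> C (S i) \<and>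
      (LINT \<omega>|M. (S i \<omega> - X \<omega>)\<^sup>2) < 1 / real (Suc n)"
      by eventually_elim auto
  qed
  then obtain i where i: "\<And>n. square_integrable M (S (i n))"
      "\<And>n. dominated_by_variance M \<phi> C (S (i n))"
      "\<And>n. (LINT \<omega>|M. (S (i n) \<omega> - X \<omega>)\<^sup>2) < 1 / real (Suc n)"
    by metis
  have d0: "(\<lambda>n. LINT \<omega>|M. (S (i n) \<omega> - X \<omega>)\<^sup>2) \<longlonglongrightarrow> 0"
    by (rule tendsto_sandwich[OF _ _ tendsto_const LIMSEQ_inverse_real_of_nat])
      (use i(3) in \<open>auto simp: inverse_eq_divide intro!: always_eventually less_imp_le\<close>)
  then have seq: "ms_tendsto M (\<lambda>n. S (i n)) X sequentially"
    using X i(1) unfolding ms_tendsto_def by simp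
  have "(\<lambda>n. LINT \<omega>|M. norm ((S (i n) \<omega> - X \<omega>)\<^sup>2)) \<longlonglongrightarrow> 0" using d0 by simp
  moreover have "integrable M (\<lambda>\<omega>. (S (i n) \<omega> - X \<omega>)\<^sup>2)" for n
    using square_integrable_diff[OF i(1) X] unfolding square_integrable_def by auto
  ultimately obtain r :: "nat \<Rightarrow> nat" where r: "strict_mono r"
      "AE \<omega> in M. (\<lambda>n. (S (i (r n)) \<omega> - X \<omega>)\<^sup>2) \<longlonglongrightarrow> 0"
    using tendsto_L1_AE_subseq[of M "\<lambda>n \<omega>. (S (i n) \<omega> - X \<omega>)\<^sup>2"] by auto
  let ?T = "\<lambda>n. S (i (r n))"
  have [measurable]: "?T n \<in> borel_measurable M" for n
    using i(1) unfolding square_integrable_def by auto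
  have ptw: "AE \<omega> in M. (\<lambda>n. ?T n \<omega>) \<longlonglongrightarrow> X \<omega>"
    using r(2)
  proof eventually_elim
    case (elim \<omega>)
    from tendsto_real_sqrt[OF this] have "(\<lambda>n. \<bar>?T n \<omega> - X \<omega>\<bar>) \<longlonglongrightarrow> 0" by simp
    then show ?case by (simp add: tendsto_rabs_zero_iff LIM_zero_iff)
  qed
  have norms: "(\<lambda>n. C * sqrt (second_moment M (?T n))) \<longlonglongrightarrow> C * sqrt (second_moment M X)"
    by (intro tendsto_intros LIMSEQ_subseq_LIMSEQ[OF ms_tendsto_second_moment[OF seq] r(1), unfolded comp_def])
  have "0 \<le> C * sqrt (second_moment M X)"
    by (rule LIMSEQ_le_const[OF norms]) (use i(2) in \<open>auto simp: dominated_by_variance_def\<close>)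
  moreover have "mgf_le M \<phi> X (C * sqrt (second_moment M X))"
    unfolding mgf_le_def
  proof
    fix l
    have lim_exp: "(\<lambda>n. ennreal (exp (\<phi> (C * sqrt (second_moment M (?T n)) * l))))
        \<longlonglongrightarrow> ennreal (exp (\<phi> (C * sqrt (second_moment M X) * l)))"
    proof -
      have "isCont \<phi> z" for z
        using assms(1) continuous_on_eq_continuous_at[of UNIV \<phi>] unfolding N_function_def by simp
      then show ?thesis
        by (intro tendsto_ennrealI tendsto_exp isCont_tendsto_compose[of _ \<phi>] tendsto_mult_right norms)
    qed
    have "(\<integral>\<^sup>+ \<omega>. ennreal (exp (l * X \<omega>)) \<partial>M)
        = (\<integral>\<^sup>+ \<omega>. liminf (\<lambda>n. ennreal (exp (l * ?T n \<omega>))) \<partial>M)"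
    proof (rule nn_integral_cong_AE)
      show "AE \<omega> in M. ennreal (exp (l * X \<omega>)) = liminf (\<lambda>n. ennreal (exp (l * ?T n \<omega>)))"
        using ptw
      proof eventually_elim
        case (elim \<omega>)
        then have "(\<lambda>n. ennreal (exp (l * ?T n \<omega>))) \<longlonglongrightarrow> ennreal (exp (l * X \<omega>))"
          by (intro tendsto_ennrealI tendsto_intros)
        then show ?case by (intro lim_imp_Liminf[OF sequentially_bot, symmetric])
      qed
    qed
    also have "\<dots> \<le> liminf (\<lambda>n. \<integral>\<^sup>+ \<omega>. ennreal (exp (l * ?T n \<omega>)) \<partial>M)"
      by (rule nn_integral_liminf) simp
    also have "\<dots> \<le> liminf (\<lambda>n. ennreal (exp (\<phi> (C * sqrt (second_moment M (?T n)) * l))))"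
      using i(2) by (intro Liminf_mono always_eventually allI mgf_leD) (auto simp: dominated_by_variance_def)
    also have "\<dots> = ennreal (exp (\<phi> (C * sqrt (second_moment M X) * l)))"
      by (rule lim_imp_Liminf[OF sequentially_bot lim_exp])
    finally show "(\<integral>\<^sup>+ \<omega>. ennreal (exp (l * X \<omega>)) \<partial>M)
        \<le> ennreal (exp (\<phi> (C * sqrt (second_moment M X) * l)))" .
  qed
  ultimately show ?thesis unfolding dominated_by_variance_def by simp
qed

lemma Sub_square_integrable:
  assumes "X \<in> Sub M \<phi>"
  shows "square_integrable M X"
proof -
  have [measurable]: "X \<in> borel_measurable M" using assms unfolding Sub_def by auto
  have "integrable M (\<lambda>\<omega>. (X \<omega>)\<^sup>2)"
  proof (rule Bochner_Integration.integrable_bound)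
    show "integrable M (\<lambda>\<omega>. 2 * exp (1 * X \<omega>) + 2 * exp ((-1) * X \<omega>))"
      using assms unfolding Sub_def by (intro Bochner_Integration.integrable_add integrable_mult_right) blast+
    have "x\<^sup>2 \<le> 2 * exp x + 2 * exp (- x)" for x :: real
    proof -
      have "x\<^sup>2 \<le> 2 * exp \<bar>x\<bar>" using exp_lower_Taylor_quadratic[of "\<bar>x\<bar>"] by simp
      also have "\<dots> \<le> 2 * exp x + 2 * exp (- x)" by (cases "0 \<le> x") auto
      finally show ?thesis .
    qed
    then show "AE \<omega> in M. norm ((X \<omega>)\<^sup>2) \<le> norm (2 * exp (1 * X \<omega>) + 2 * exp ((-1) * X \<omega>))"
      by (intro AE_I2) simp
  qed simp
  then show ?thesis unfolding square_integrable_def by simp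
qed

text \<open>By continuity of \<open>\<phi>\<close> the infimum in the definition of the norm can be used as if it were
  attained.\<close>

lemma Sub_mgf_le:
  assumes "N_function \<phi>" and X: "X \<in> Sub M \<phi>" and "sub_norm M \<phi> X \<le> \<sigma>"
  shows "0 \<le> \<sigma>" and "mgf_le M \<phi> X \<sigma>"
proof -
  let ?B = "{a. a > 0 \<and> (\<forall>l. (LINT \<omega>|M. exp (l * X \<omega>)) \<le> exp (\<phi> (a * l)))}"
  have ne: "?B \<noteq> {}" using X unfolding Sub_def by auto
  have "0 \<le> Inf ?B" by (rule cInf_greatest[OF ne]) auto
  then show \<sigma>: "0 \<le> \<sigma>" using assms(3) unfolding sub_norm_def by simp
  have le: "(\<integral>\<^sup>+ \<omega>. ennreal (exp (l * X \<omega>)) \<partial>M) \<le> ennreal (exp (\<phi> ((\<sigma> + e) * l)))" if "0 < e" for e l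
  proof -
    have "Inf ?B < \<sigma> + e" using assms(3) that unfolding sub_norm_def by simp
    from cInf_lessD[OF ne this] obtain a where a: "a \<in> ?B" "a < \<sigma> + e" by auto
    have "\<phi> (a * l) \<le> \<phi> ((\<sigma> + e) * l)"
      using a \<sigma> that by (intro N_function_mono_abs[OF assms(1)]) (simp_all add: abs_mult mult_right_mono)
    moreover have "(LINT \<omega>|M. exp (l * X \<omega>)) \<le> exp (\<phi> (a * l))" using a by auto
    ultimately have "(LINT \<omega>|M. exp (l * X \<omega>)) \<le> exp (\<phi> ((\<sigma> + e) * l))"
      by (meson exp_le_cancel_iff order_trans)
    moreover have "integrable M (\<lambda>\<omega>. exp (l * X \<omega>))" using X unfolding Sub_def by auto
    ultimately show ?thesis by (simp add: nn_integral_eq_integral ennreal_leI)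
  qed
  show "mgf_le M \<phi> X \<sigma>"
    unfolding mgf_le_def
  proof
    fix l
    have "(\<lambda>n. ennreal (exp (\<phi> ((\<sigma> + inverse (real (Suc n))) * l)))) \<longlonglongrightarrow> ennreal (exp (\<phi> ((\<sigma> + 0) * l)))"
    proof -
      have "isCont \<phi> z" for z
        using assms(1) continuous_on_eq_continuous_at[of UNIV \<phi>] unfolding N_function_def by simp
      then show ?thesis
        by (intro tendsto_ennrealI tendsto_exp isCont_tendsto_compose[of _ \<phi>] tendsto_mult_right
            tendsto_add tendsto_const LIMSEQ_inverse_real_of_nat)
    qed
    then show "(\<integral>\<^sup>+ \<omega>. ennreal (exp (l * X \<omega>)) \<partial>M) \<le> ennreal (exp (\<phi> (\<sigma> * l)))"
      by (rule LIMSEQ_le_const[THEN order_trans]) (auto intro!: le)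
  qed
qed

section \<open>Mean-square Stieltjes integrals\<close>

lemma strictly_sub_gaussian_square_integrable:
  "strictly_sub_gaussian M \<phi> (range y) C \<Longrightarrow> square_integrable M (y t)"
  unfolding strictly_sub_gaussian_def using Sub_square_integrable by blast

lemma square_integrable_zero: "square_integrable M (\<lambda>_. 0)"
  unfolding square_integrable_def by simp

lemma square_integrable_sum:
  "finite A \<Longrightarrow> (\<And>i. i \<in> A \<Longrightarrow> square_integrable M (X i)) \<Longrightarrow> square_integrable M (\<lambda>\<omega>. \<Sum>i\<in>A. X i \<omega>)"
  by (induction A rule: finite_induct) (auto intro: square_integrable_zero)

text \<open>A finite linear combination is a series whose coefficients vanish from some index on.\<close>

lemma strictly_sub_gaussian_combination:
  assumes "N_function \<phi>" and y: "strictly_sub_gaussian M \<phi> (range y) C"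
  shows "dominated_by_variance M \<phi> C (\<lambda>\<omega>. \<Sum>(c, t)\<leftarrow>xs. c * y t \<omega>)"
proof -
  let ?n = "length xs"
  let ?S = "\<lambda>\<omega>. \<Sum>(c, t)\<leftarrow>xs. c * y t \<omega>"
  define \<zeta> where "\<zeta> i = (if i < ?n then y (snd (xs ! i)) else y undefined)" for i
  define l where "l i = (if i < ?n then fst (xs ! i) else 0)" for i
  have S_eq: "(\<lambda>\<omega>. \<Sum>i<n. l i * \<zeta> i \<omega>) = ?S" if "?n \<le> n" for n
  proof
    fix \<omega>
    have "(\<Sum>i<n. l i * \<zeta> i \<omega>) = (\<Sum>i<?n. l i * \<zeta> i \<omega>)"
      using that by (intro sum.mono_neutral_right) (auto simp: l_def)
    also have "\<dots> = (\<Sum>i<?n. case xs ! i of (c, t) \<Rightarrow> c * y t \<omega>)"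
      by (intro sum.cong) (auto simp: l_def \<zeta>_def case_prod_unfold)
    also have "\<dots> = ?S \<omega>" by (simp add: sum_list_sum_nth atLeast0LessThan)
    finally show "(\<Sum>i<n. l i * \<zeta> i \<omega>) = ?S \<omega>" .
  qed
  have "square_integrable M (\<lambda>\<omega>. \<Sum>i<n. l i * \<zeta> i \<omega>)" for n
    using strictly_sub_gaussian_square_integrable[OF y]
    by (intro square_integrable_sum square_integrable_cmult) (auto simp: \<zeta>_def)
  moreover from this[of ?n] have "square_integrable M ?S" by (simp only: S_eq order_refl)
  moreover have "((\<lambda>n. LINT \<omega>|M. ((\<Sum>i<n. l i * \<zeta> i \<omega>) - ?S \<omega>)\<^sup>2) \<longlongrightarrow> 0) sequentially"
  proof (rule tendsto_eventually, rule eventually_sequentiallyI)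
    fix n
    assume "?n \<le> n"
    then show "(LINT \<omega>|M. ((\<Sum>i<n. l i * \<zeta> i \<omega>) - ?S \<omega>)\<^sup>2) = 0"
      using fun_cong[OF S_eq, of n] by simp
  qed
  ultimately have "ms_tendsto M (\<lambda>n \<omega>. \<Sum>i<n. l i * \<zeta> i \<omega>) ?S sequentially"
    unfolding ms_tendsto_def by simp
  moreover have "\<forall>i. \<zeta> i \<in> range y" by (simp add: \<zeta>_def)
  ultimately have "?S \<in> Sub M \<phi>" "sub_norm M \<phi> ?S \<le> C * sqrt (LINT \<omega>|M. (?S \<omega>)\<^sup>2)"
    using y unfolding strictly_sub_gaussian_def by blast+
  from Sub_mgf_le[OF assms(1) this] show ?thesis
    unfolding dominated_by_variance_def second_moment_def by auto
qed

lemma finite_cells: "finite P \<Longrightarrow> finite (cells P)"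
  by (rule finite_subset[of _ "P \<times> P"]) (auto simp: cells_def)

lemma ms_stieltjes_sum_eq_combination:
  assumes "finite P"
  obtains xs where "ms_stieltjes_sum y f (P, \<xi>) = (\<lambda>\<omega>. \<Sum>(c, t)\<leftarrow>xs. c * y t \<omega>)"
proof -
  have "\<exists>xs. (\<lambda>\<omega>. \<Sum>(l, r)\<in>D. f (\<xi> l) * (y r \<omega> - y l \<omega>)) = (\<lambda>\<omega>. \<Sum>(c, t)\<leftarrow>xs. c * y t \<omega>)"
    if "finite D" for D
    using that
  proof (induction D rule: finite_induct)
    case empty
    show ?case by (rule exI[of _ "[]"]) simp
  next
    case (insert p D)
    then obtain xs where
      xs: "(\<lambda>\<omega>. \<Sum>(l, r)\<in>D. f (\<xi> l) * (y r \<omega> - y l \<omega>)) = (\<lambda>\<omega>. \<Sum>(c, t)\<leftarrow>xs. c * y t \<omega>)"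
      by blast
    obtain l r where p: "p = (l, r)" by fastforce
    show ?case
      by (rule exI[of _ "(f (\<xi> l), r) # (- f (\<xi> l), l) # xs"])
        (use insert.hyps fun_cong[OF xs] in \<open>simp add: p algebra_simps\<close>)
  qed
  from this[OF finite_cells[OF assms]] show ?thesis
    using that unfolding ms_stieltjes_sum_def by auto
qed

lemma ms_stieltjes_sum_diff:
  "ms_stieltjes_sum y (\<lambda>l. f l - g l) = (\<lambda>i \<omega>. ms_stieltjes_sum y f i \<omega> - ms_stieltjes_sum y g i \<omega>)"
  unfolding ms_stieltjes_sum_def
  by (auto simp: fun_eq_iff sum_subtractf[symmetric] left_diff_distrib intro!: sum.cong)

lemma has_ms_integral_diff:
  assumes "has_ms_integral M y f X" and "has_ms_integral M y g Y"
  shows "has_ms_integral M y (\<lambda>l. f l - g l) (\<lambda>\<omega>. X \<omega> - Y \<omega>)"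
proof -
  obtain J where J: "\<And>a b. a \<le> b \<Longrightarrow> ms_tendsto M (ms_stieltjes_sum y f) (J a b) (tagged_partitions a b)"
      "ms_tendsto M (\<lambda>(a, b). J a b) X (at_bot \<times>\<^sub>F at_top)"
    using assms(1) unfolding has_ms_integral_def by blast
  obtain K where K: "\<And>a b. a \<le> b \<Longrightarrow> ms_tendsto M (ms_stieltjes_sum y g) (K a b) (tagged_partitions a b)"
      "ms_tendsto M (\<lambda>(a, b). K a b) Y (at_bot \<times>\<^sub>F at_top)"
    using assms(2) unfolding has_ms_integral_def by blast
  have "(\<lambda>(a, b). (\<lambda>\<omega>. J a b \<omega> - K a b \<omega>)) = (\<lambda>i \<omega>. (\<lambda>(a, b). J a b) i \<omega> - (\<lambda>(a, b). K a b) i \<omega>)"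
    by auto
  with ms_tendsto_diff[OF J(2) K(2)]
  have "ms_tendsto M (\<lambda>(a, b). (\<lambda>\<omega>. J a b \<omega> - K a b \<omega>)) (\<lambda>\<omega>. X \<omega> - Y \<omega>) (at_bot \<times>\<^sub>F at_top)"
    by simp
  then show ?thesis
    unfolding has_ms_integral_def ms_stieltjes_sum_diff
    using ms_tendsto_diff[OF J(1) K(1)] by (intro exI[of _ "\<lambda>a b \<omega>. J a b \<omega> - K a b \<omega>"]) simp
qed

lemma tagged_partitions_neq_bot: "tagged_partitions a b \<noteq> bot"
proof -
  have "\<not> eventually (\<lambda>_. False) (tagged_partitions a b)"
  proof
    assume "eventually (\<lambda>_. False) (tagged_partitions a b)"
    then obtain R where R: "eventually R (finite_subsets_at_top {a..b})"
      and none: "\<And>i. R (fst i) \<Longrightarrow> i \<in> {(P, \<xi>). \<forall>(l, r)\<in>cells P. \<xi> l \<in> {l..r}} \<Longrightarrow> False"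
      unfolding tagged_partitions_def eventually_inf_principal eventually_filtercomap by blast
    from eventually_happens[OF R] obtain P where "R P" by auto
    then show False by (intro none[of "(P, \<lambda>l. l)"]) (auto simp: cells_def)
  qed
  then show ?thesis by (simp add: trivial_limit_def)
qed

lemma eventually_tagged_partitions_finite:
  "\<forall>\<^sub>F i in tagged_partitions a b. finite (fst i)"
  unfolding tagged_partitions_def
  by (rule filter_leD[OF inf_le1]) (intro eventually_filtercomapI eventually_finite_subsets_at_top_weakI)

lemma eventually_proper_interval:
  "\<forall>\<^sub>F (a, b) in at_bot \<times>\<^sub>F at_top. (a :: real) \<le> (b :: real)"
  unfolding eventually_prod_filter
  by (intro exI[of _ "\<lambda>a. a \<le> 0"] exI[of _ "\<lambda>b. 0 \<le> b"]) (auto intro: eventually_le_at_bot eventually_ge_at_top)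

lemma at_bot_prod_at_top_neq_bot: "(at_bot :: real filter) \<times>\<^sub>F (at_top :: real filter) \<noteq> bot"
  by (simp add: prod_filter_eq_bot)

lemma has_ms_integral_dominated_by_variance:
  assumes "N_function \<phi>" and "strictly_sub_gaussian M \<phi> (range y) C" and "has_ms_integral M y f X"
  shows "dominated_by_variance M \<phi> C X"
proof -
  obtain J where J: "\<And>a b. a \<le> b \<Longrightarrow> ms_tendsto M (ms_stieltjes_sum y f) (J a b) (tagged_partitions a b)"
      "ms_tendsto M (\<lambda>(a, b). J a b) X (at_bot \<times>\<^sub>F at_top)"
    using assms(3) unfolding has_ms_integral_def by blast
  have sums: "dominated_by_variance M \<phi> C (ms_stieltjes_sum y f i)" if "finite (fst i)" for i
  proof -
    have "finite (fst i)" by fact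
    then obtain xs where "ms_stieltjes_sum y f (fst i, snd i) = (\<lambda>\<omega>. \<Sum>(c, t)\<leftarrow>xs. c * y t \<omega>)"
      by (rule ms_stieltjes_sum_eq_combination)
    then show ?thesis using strictly_sub_gaussian_combination[OF assms(1,2), of xs] by simp
  qed
  have "dominated_by_variance M \<phi> C (J a b)" if "a \<le> b" for a b
    by (rule dominated_by_variance_ms_limit[OF assms(1) J(1)[OF that] tagged_partitions_neq_bot])
      (rule eventually_mono[OF eventually_tagged_partitions_finite sums])
  then show ?thesis
    by (intro dominated_by_variance_ms_limit[OF assms(1) J(2) at_bot_prod_at_top_neq_bot]
        eventually_mono[OF eventually_proper_interval]) auto
qed

lemma second_moment_stieltjes_sum:
  assumes y: "\<And>t. square_integrable M (y t)" and "finite P"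
  shows "second_moment M (ms_stieltjes_sum y f (P, \<xi>))
    = (\<Sum>p\<in>cells P. \<Sum>q\<in>cells P. f (\<xi> (fst p)) * f (\<xi> (fst q)) * rect_increment (covariance_fun M y) p q)"
proof -
  let ?d = "\<lambda>p \<omega>. y (snd p) \<omega> - y (fst p) \<omega>"
  let ?f = "\<lambda>p. f (\<xi> (fst p))"
  have d: "square_integrable M (?d p)" for p using y by auto
  have incr: "(LINT \<omega>|M. ?d p \<omega> * ?d q \<omega>) = rect_increment (covariance_fun M y) p q" for p q
  proof -
    note int = square_integrable_integrable_mult[OF y y]
    have "(LINT \<omega>|M. ?d p \<omega> * ?d q \<omega>) = (LINT \<omega>|M. y (snd p) \<omega> * y (snd q) \<omega>
        - y (snd p) \<omega> * y (fst q) \<omega> - y (fst p) \<omega> * y (snd q) \<omega> + y (fst p) \<omega> * y (fst q) \<omega>)"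
      by (simp add: algebra_simps)
    also have "\<dots> = rect_increment (covariance_fun M y) p q"
      using int by (simp add: rect_increment_def covariance_fun_def case_prod_unfold)
    finally show ?thesis .
  qed
  have "second_moment M (ms_stieltjes_sum y f (P, \<xi>)) = (LINT \<omega>|M. (\<Sum>p\<in>cells P. ?f p * ?d p \<omega>)\<^sup>2)"
    by (simp add: second_moment_def ms_stieltjes_sum_def case_prod_unfold)
  also have "\<dots> = (LINT \<omega>|M. (\<Sum>p\<in>cells P. \<Sum>q\<in>cells P. ?f p * ?f q * (?d p \<omega> * ?d q \<omega>)))"
    by (simp add: power2_eq_square sum_product ac_simps)
  also have "\<dots> = (\<Sum>p\<in>cells P. \<Sum>q\<in>cells P. ?f p * ?f q * (LINT \<omega>|M. ?d p \<omega> * ?d q \<omega>))"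
    using square_integrable_integrable_mult[OF d d] by (simp add: Bochner_Integration.integral_sum)
  finally show ?thesis by (simp add: incr)
qed

text \<open>The second moment of a Stieltjes sum is a double sum over increments of the covariance function,
  which the corresponding sum of absolute values dominates; the latter is a variation sum on the
  diagonal, where the partitions of the two axes coincide, and both sides pass to the limit.\<close>

lemma has_ms_integral_second_moment_le:
  assumes y: "\<And>t. square_integrable M (y t)" and "has_ms_integral M y f X"
    and "has_variation_integral (covariance_fun M y) (\<lambda>l m. w l * w m) J"
    and bound: "\<And>l. \<bar>f l\<bar> \<le> K * w l"
  shows "second_moment M X \<le> K\<^sup>2 * J"
proof -
  let ?G = "covariance_fun M y"
  let ?ww = "\<lambda>l m. w l * w m"
  obtain I where I: "\<And>a b. a \<le> b \<Longrightarrow> ms_tendsto M (ms_stieltjes_sum y f) (I a b) (tagged_partitions a b)"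
      "ms_tendsto M (\<lambda>(a, b). I a b) X (at_bot \<times>\<^sub>F at_top)"
    using assms(2) unfolding has_ms_integral_def by blast
  obtain H where H: "\<And>a b c d. a \<le> b \<Longrightarrow> c \<le> d \<Longrightarrow>
        (variation_sum ?G ?ww \<longlongrightarrow> H a b c d) (tagged_partitions a b \<times>\<^sub>F tagged_partitions c d)"
      "((\<lambda>((a, b), (c, d)). H a b c d) \<longlongrightarrow> J) ((at_bot \<times>\<^sub>F at_top) \<times>\<^sub>F (at_bot \<times>\<^sub>F at_top))"
    using assms(3) unfolding has_variation_integral_def by blast
  have diag: "filterlim (\<lambda>i. (i, i)) (F \<times>\<^sub>F F) F" for F :: "'i filter"
    by (intro filterlim_Pair filterlim_ident)
  have sums: "second_moment M (ms_stieltjes_sum y f i) \<le> K\<^sup>2 * variation_sum ?G ?ww (i, i)"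
    if "finite (fst i)" for i
  proof -
    obtain P \<xi> where i: "i = (P, \<xi>)" by fastforce
    have "second_moment M (ms_stieltjes_sum y f i)
        = (\<Sum>p\<in>cells P. \<Sum>q\<in>cells P. f (\<xi> (fst p)) * f (\<xi> (fst q)) * rect_increment ?G p q)"
      using that unfolding i by (intro second_moment_stieltjes_sum y) simp
    also have "\<dots> \<le> (\<Sum>p\<in>cells P. \<Sum>q\<in>cells P. K\<^sup>2 * (w (\<xi> (fst p)) * w (\<xi> (fst q)) * \<bar>rect_increment ?G p q\<bar>))"
    proof (intro sum_mono)
      fix p q
      have "f (\<xi> (fst p)) * f (\<xi> (fst q)) * rect_increment ?G p q
          \<le> \<bar>f (\<xi> (fst p))\<bar> * \<bar>f (\<xi> (fst q))\<bar> * \<bar>rect_increment ?G p q\<bar>"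
        by (metis abs_ge_self abs_mult)
      also have "\<dots> \<le> (K * w (\<xi> (fst p))) * (K * w (\<xi> (fst q))) * \<bar>rect_increment ?G p q\<bar>"
        using bound by (intro mult_right_mono mult_mono) (auto intro: order_trans[OF abs_ge_zero])
      finally show "f (\<xi> (fst p)) * f (\<xi> (fst q)) * rect_increment ?G p q
          \<le> K\<^sup>2 * (w (\<xi> (fst p)) * w (\<xi> (fst q)) * \<bar>rect_increment ?G p q\<bar>)"
        by (simp add: power2_eq_square ac_simps)
    qed
    also have "\<dots> = K\<^sup>2 * variation_sum ?G ?ww (i, i)"
      unfolding i variation_sum_def by (simp add: sum_distrib_left)
    finally show ?thesis .
  qed
  have pieces: "second_moment M (I a b) \<le> K\<^sup>2 * H a b a b" if "a \<le> b" for a b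
  proof (rule tendsto_le[OF tagged_partitions_neq_bot])
    show "((\<lambda>i. second_moment M (ms_stieltjes_sum y f i)) \<longlongrightarrow> second_moment M (I a b)) (tagged_partitions a b)"
      by (rule ms_tendsto_second_moment[OF I(1)[OF that]])
    show "((\<lambda>i. K\<^sup>2 * variation_sum ?G ?ww (i, i)) \<longlongrightarrow> K\<^sup>2 * H a b a b) (tagged_partitions a b)"
      by (intro tendsto_mult_left filterlim_compose[OF H(1)[OF that that] diag])
    show "\<forall>\<^sub>F i in tagged_partitions a b.
        second_moment M (ms_stieltjes_sum y f i) \<le> K\<^sup>2 * variation_sum ?G ?ww (i, i)"
      by (rule eventually_mono[OF eventually_tagged_partitions_finite sums])
  qed
  show ?thesis
  proof (rule tendsto_le[OF at_bot_prod_at_top_neq_bot])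
    show "((\<lambda>i. second_moment M ((\<lambda>(a, b). I a b) i)) \<longlongrightarrow> second_moment M X) (at_bot \<times>\<^sub>F at_top)"
      by (rule ms_tendsto_second_moment[OF I(2)])
    show "((\<lambda>i. K\<^sup>2 * (\<lambda>((a, b), (c, d)). H a b c d) (i, i)) \<longlongrightarrow> K\<^sup>2 * J) (at_bot \<times>\<^sub>F at_top)"
      by (intro tendsto_mult_left filterlim_compose[OF H(2) diag])
    show "\<forall>\<^sub>F i in at_bot \<times>\<^sub>F at_top.
        second_moment M ((\<lambda>(a, b). I a b) i) \<le> K\<^sup>2 * (\<lambda>((a, b), (c, d)). H a b c d) (i, i)"
      by (rule eventually_mono[OF eventually_proper_interval]) (auto intro: pieces)
  qed
qed

lemma has_ms_integral_square_integrable: "has_ms_integral M y f X \<Longrightarrow> square_integrable M X"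
  unfolding has_ms_integral_def ms_tendsto_def by auto

section \<open>Chaining\<close>

text \<open>Hoelder's inequality in the guise of the weighted inequality between the arithmetic and the
  geometric mean: after normalisation of the exponents by \<open>c l\<close> every factor has mean at most \<open>1\<close>. The
  weight missing to \<open>1\<close> is given to a constant.\<close>

lemma nn_integral_exp_sum_le:
  fixes Y :: "nat \<Rightarrow> 'a \<Rightarrow> real"
  assumes "prob_space M" and [measurable]: "\<And>l. Y l \<in> borel_measurable M"
    and r: "\<And>l. 0 < r l" and "(\<Sum>l<L. r l) \<le> 1"
    and Y: "\<And>l. l < L \<Longrightarrow> (\<integral>\<^sup>+ \<omega>. ennreal (exp (lam / r l * Y l \<omega>)) \<partial>M) \<le> ennreal (exp (c l))"
  shows "(\<integral>\<^sup>+ \<omega>. ennreal (exp (lam * (\<Sum>l<L. Y l \<omega>))) \<partial>M) \<le> ennreal (exp (\<Sum>l<L. r l * c l))"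
proof -
  interpret prob_space M by fact
  define \<rho> where "\<rho> = 1 - (\<Sum>l<L. r l)"
  let ?C = "exp (\<Sum>l<L. r l * c l)"
  have "0 \<le> \<rho>" using assms(4) unfolding \<rho>_def by simp
  have mean: "exp (\<Sum>l<L. r l * z l) \<le> (\<Sum>l<L. r l * exp (z l)) + \<rho>" for z
  proof -
    define a where "a l = (if l < L then r l else \<rho>)" for l
    define x where "x l = (if l < L then z l else 0)" for l
    have ax: "(\<Sum>l\<le>L. a l * f (x l)) = (\<Sum>l<L. r l * f (z l)) + \<rho> * f 0" for f :: "real \<Rightarrow> real"
      by (simp add: a_def x_def flip: lessThan_Suc_atMost)
    have "exp (\<Sum>l\<le>L. a l *\<^sub>R x l) \<le> (\<Sum>l\<le>L. a l * exp (x l))"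
    proof (rule convex_on_sum[OF _ _ exp_convex])
      show "sum a {..L} = 1" using ax[of "\<lambda>_. 1"] by (simp add: \<rho>_def)
      show "0 \<le> a l" for l using r[of l] \<open>0 \<le> \<rho>\<close> by (simp add: a_def)
    qed auto
    then show ?thesis using ax[of exp] ax[of "\<lambda>v. v"] by simp
  qed
  have ptw: "exp (lam * (\<Sum>l<L. Y l \<omega>))
      \<le> (\<Sum>l<L. ?C * r l * exp (- c l) * exp (lam / r l * Y l \<omega>)) + ?C * \<rho>" for \<omega>
  proof -
    have "lam * (\<Sum>l<L. Y l \<omega>) = (\<Sum>l<L. r l * c l) + (\<Sum>l<L. r l * (lam / r l * Y l \<omega> - c l))"
      unfolding sum.distrib[symmetric] sum_distrib_left
      by (intro sum.cong refl) (use r in \<open>simp add: right_diff_distrib less_imp_neq[symmetric]\<close>)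
    then have "exp (lam * (\<Sum>l<L. Y l \<omega>)) = ?C * exp (\<Sum>l<L. r l * (lam / r l * Y l \<omega> - c l))"
      by (simp add: exp_add)
    also have "\<dots> \<le> ?C * ((\<Sum>l<L. r l * exp (lam / r l * Y l \<omega> - c l)) + \<rho>)"
      by (intro mult_left_mono mean) simp
    also have "\<dots> = (\<Sum>l<L. ?C * r l * exp (- c l) * exp (lam / r l * Y l \<omega>)) + ?C * \<rho>"
      by (simp add: distrib_left sum_distrib_left exp_diff exp_minus field_simps)
    finally show ?thesis .
  qed
  have "(\<integral>\<^sup>+ \<omega>. ennreal (exp (lam * (\<Sum>l<L. Y l \<omega>))) \<partial>M)
      \<le> (\<integral>\<^sup>+ \<omega>. (\<Sum>l<L. ennreal (?C * r l * exp (- c l)) * ennreal (exp (lam / r l * Y l \<omega>)))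
          + ennreal (?C * \<rho>) \<partial>M)"
  proof (rule nn_integral_mono)
    fix \<omega>
    have "ennreal (exp (lam * (\<Sum>l<L. Y l \<omega>)))
        \<le> ennreal ((\<Sum>l<L. ?C * r l * exp (- c l) * exp (lam / r l * Y l \<omega>)) + ?C * \<rho>)"
      by (rule ennreal_leI[OF ptw])
    also have "\<dots> = ennreal (\<Sum>l<L. ?C * r l * exp (- c l) * exp (lam / r l * Y l \<omega>)) + ennreal (?C * \<rho>)"
      using \<open>0 \<le> \<rho>\<close> r by (intro ennreal_plus sum_nonneg) (simp_all add: less_imp_le)
    also have "ennreal (\<Sum>l<L. ?C * r l * exp (- c l) * exp (lam / r l * Y l \<omega>))
        = (\<Sum>l<L. ennreal (?C * r l * exp (- c l)) * ennreal (exp (lam / r l * Y l \<omega>)))"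
      using r by (subst sum_ennreal[symmetric]) (auto simp: ennreal_mult less_imp_le)
    finally show "ennreal (exp (lam * (\<Sum>l<L. Y l \<omega>)))
        \<le> (\<Sum>l<L. ennreal (?C * r l * exp (- c l)) * ennreal (exp (lam / r l * Y l \<omega>))) + ennreal (?C * \<rho>)" .
  qed
  also have "\<dots> = (\<Sum>l<L. ennreal (?C * r l * exp (- c l)) * (\<integral>\<^sup>+ \<omega>. ennreal (exp (lam / r l * Y l \<omega>)) \<partial>M))
      + ennreal (?C * \<rho>)"
    by (subst nn_integral_add, simp, simp, subst nn_integral_sum, simp, subst nn_integral_cmult)
      (simp_all add: emeasure_space_1)
  also have "\<dots> \<le> (\<Sum>l<L. ennreal (?C * r l * exp (- c l)) * ennreal (exp (c l))) + ennreal (?C * \<rho>)"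
    using Y by (intro add_right_mono sum_mono mult_left_mono) auto
  also have "(\<Sum>l<L. ennreal (?C * r l * exp (- c l)) * ennreal (exp (c l))) = (\<Sum>l<L. ennreal (?C * r l))"
  proof (rule sum.cong[OF refl])
    fix l
    have "ennreal (?C * r l * exp (- c l)) * ennreal (exp (c l)) = ennreal (?C * r l * exp (- c l) * exp (c l))"
      using r[of l] by (intro ennreal_mult[symmetric]) simp_all
    also have "?C * r l * exp (- c l) * exp (c l) = ?C * r l" by (simp add: exp_minus)
    finally show "ennreal (?C * r l * exp (- c l)) * ennreal (exp (c l)) = ennreal (?C * r l)" .
  qed
  also have "\<dots> + ennreal (?C * \<rho>) = ennreal ((\<Sum>l<L. ?C * r l) + ?C * \<rho>)"
    using \<open>0 \<le> \<rho>\<close> r by (subst sum_ennreal) (auto simp: less_imp_le sum_nonneg simp flip: ennreal_plus)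
  also have "(\<Sum>l<L. ?C * r l) + ?C * \<rho> = ?C"
    unfolding sum_distrib_left[symmetric] \<rho>_def by (simp add: algebra_simps)
  finally show ?thesis .
qed

lemma nn_integral_exp_Max_le:
  assumes "finite S" and "S \<noteq> {}" and D: "\<And>s. s \<in> S \<Longrightarrow> D s \<in> borel_measurable M"
    and mgf: "\<And>s. s \<in> S \<Longrightarrow> mgf_le M \<phi> (D s) \<sigma>" and "N_function \<phi>"
    and card: "real (card S) \<le> exp H" and "0 \<le> \<mu>"
  shows "(\<integral>\<^sup>+ \<omega>. ennreal (exp (\<mu> * (MAX s\<in>S. \<bar>D s \<omega>\<bar>))) \<partial>M) \<le> ennreal (exp (ln 2 + H + \<phi> (\<sigma> * \<mu>)))"
proof -
  have "(\<integral>\<^sup>+ \<omega>. ennreal (exp (\<mu> * (MAX s\<in>S. \<bar>D s \<omega>\<bar>))) \<partial>M)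
      \<le> (\<integral>\<^sup>+ \<omega>. (\<Sum>s\<in>S. ennreal (exp (\<mu> * D s \<omega>)) + ennreal (exp ((- \<mu>) * D s \<omega>))) \<partial>M)"
  proof (rule nn_integral_mono)
    fix \<omega>
    have "(MAX s\<in>S. \<bar>D s \<omega>\<bar>) \<in> (\<lambda>s. \<bar>D s \<omega>\<bar>) ` S" using assms by (intro Max_in) auto
    then obtain s where s: "s \<in> S" "(MAX s\<in>S. \<bar>D s \<omega>\<bar>) = \<bar>D s \<omega>\<bar>" by auto
    have "ennreal (exp (\<mu> * \<bar>D s \<omega>\<bar>)) \<le> ennreal (exp (\<mu> * D s \<omega>)) + ennreal (exp ((- \<mu>) * D s \<omega>))"
      by (cases "0 \<le> D s \<omega>") auto
    also have "\<dots> \<le> (\<Sum>s\<in>S. ennreal (exp (\<mu> * D s \<omega>)) + ennreal (exp ((- \<mu>) * D s \<omega>)))"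
      by (rule member_le_sum[OF s(1)]) (use assms in auto)
    finally show "ennreal (exp (\<mu> * (MAX s\<in>S. \<bar>D s \<omega>\<bar>)))
        \<le> (\<Sum>s\<in>S. ennreal (exp (\<mu> * D s \<omega>)) + ennreal (exp ((- \<mu>) * D s \<omega>)))"
      unfolding s(2) .
  qed
  also have "\<dots> = (\<Sum>s\<in>S. \<integral>\<^sup>+ \<omega>. ennreal (exp (\<mu> * D s \<omega>)) + ennreal (exp ((- \<mu>) * D s \<omega>)) \<partial>M)"
    using D by (intro nn_integral_sum) simp
  also have "\<dots> = (\<Sum>s\<in>S. (\<integral>\<^sup>+ \<omega>. ennreal (exp (\<mu> * D s \<omega>)) \<partial>M) + (\<integral>\<^sup>+ \<omega>. ennreal (exp ((- \<mu>) * D s \<omega>)) \<partial>M))"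
    using D by (intro sum.cong refl nn_integral_add) simp_all
  also have "\<dots> \<le> (\<Sum>s\<in>S. ennreal (exp (\<phi> (\<sigma> * \<mu>))) + ennreal (exp (\<phi> (\<sigma> * (- \<mu>)))))"
    using mgf by (intro sum_mono add_mono mgf_leD) auto
  also have "\<dots> = (\<Sum>s\<in>S. ennreal (2 * exp (\<phi> (\<sigma> * \<mu>))))"
    using assms(5) unfolding N_function_def by (simp flip: ennreal_plus)
  also have "\<dots> = ennreal (real (card S) * (2 * exp (\<phi> (\<sigma> * \<mu>))))"
    by (subst sum_ennreal) auto
  also have "\<dots> \<le> ennreal (exp H * (2 * exp (\<phi> (\<sigma> * \<mu>))))"
    using card by (intro ennreal_leI mult_right_mono) auto
  also have "exp H * (2 * exp (\<phi> (\<sigma> * \<mu>))) = exp (ln 2 + H + \<phi> (\<sigma> * \<mu>))"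
    by (simp add: exp_add)
  finally show ?thesis .
qed

text \<open>Minimising the exponential Chebyshev bound over \<open>lam\<close> produces the Young-Fenchel transform;
  the shift \<open>d\<close> of the variable only moves the level.\<close>

lemma exp_chebyshev_young_fenchel:
  assumes "prob_space M" and \<phi>: "N_function \<phi>" and "0 < \<sigma>" and "d \<le> r" and E: "E \<in> sets M"
    and Y: "\<And>\<omega>. \<omega> \<in> E \<Longrightarrow> r \<le> Y \<omega>"
    and moment: "\<And>lam. 0 < lam \<Longrightarrow>
      (\<integral>\<^sup>+ \<omega>. ennreal (exp (lam * Y \<omega>)) \<partial>M) \<le> ennreal (exp (ln 2 + \<phi> (\<sigma> * lam) + lam * d))"
  shows "measure M E \<le> 2 * exp (- young_fenchel \<phi> ((r - d) / \<sigma>))"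
proof -
  interpret prob_space M by fact
  have tail: "measure M E \<le> 2 * exp (- ((r - d) / \<sigma> * \<mu> - \<phi> \<mu>))" if "0 < \<mu>" for \<mu>
  proof -
    define lam where "lam = \<mu> / \<sigma>"
    have lam: "0 < lam" and \<mu>: "\<sigma> * lam = \<mu>" using that \<open>0 < \<sigma>\<close> by (simp_all add: lam_def)
    have "ennreal (exp (lam * r)) * emeasure M E = (\<integral>\<^sup>+ \<omega>. ennreal (exp (lam * r)) * indicator E \<omega> \<partial>M)"
      by (rule nn_integral_cmult_indicator[OF E, symmetric])
    also have "\<dots> \<le> (\<integral>\<^sup>+ \<omega>. ennreal (exp (lam * Y \<omega>)) \<partial>M)"
      using Y lam by (intro nn_integral_mono) (auto split: split_indicator intro!: ennreal_leI)
    also note moment[OF lam]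
    finally have "ennreal (exp (lam * r) * measure M E) \<le> ennreal (exp (ln 2 + \<phi> \<mu> + lam * d))"
      by (simp add: emeasure_eq_measure ennreal_mult \<mu>)
    then have "exp (lam * r) * measure M E \<le> exp (ln 2 + \<phi> \<mu> + lam * d)"
      by (subst (asm) ennreal_le_iff) simp_all
    then have "measure M E \<le> exp (ln 2 + \<phi> \<mu> + lam * d) * exp (- (lam * r))"
      by (simp add: exp_minus field_simps)
    also have "\<dots> = 2 * exp (- (lam * (r - d) - \<phi> \<mu>))"
      by (simp add: exp_add exp_diff exp_minus right_diff_distrib divide_inverse ac_simps)
    also have "lam * (r - d) = (r - d) / \<sigma> * \<mu>"
      by (simp add: lam_def)
    finally show ?thesis .
  qed
  show ?thesis
  proof (cases "measure M E = 0")
    case False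
    let ?x = "(r - d) / \<sigma>" and ?p = "measure M E"
    have p: "0 < ?p" using False by (simp add: measure_nonneg order_less_le)
    have "?p / 2 \<le> 1" using prob_le_1[of E] by linarith
    then have ln_p: "ln (?p / 2) \<le> 0" using p by simp
    have x: "0 \<le> ?x" using \<open>d \<le> r\<close> \<open>0 < \<sigma>\<close> by simp
    have "young_fenchel \<phi> ?x \<le> - ln (?p / 2)"
      unfolding young_fenchel_def
    proof (rule cSUP_least)
      fix \<mu>
      show "?x * \<mu> - \<phi> \<mu> \<le> - ln (?p / 2)"
      proof (cases "0 < \<mu>")
        case True
        have "?p / 2 \<le> exp (- (?x * \<mu> - \<phi> \<mu>))" using tail[OF True] by simp
        then have "ln (?p / 2) \<le> ln (exp (- (?x * \<mu> - \<phi> \<mu>)))" using p by (subst ln_le_cancel_iff) auto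
        then show ?thesis by simp
      next
        case False
        then have "?x * \<mu> \<le> 0" using x by (simp add: mult_nonneg_nonpos del: times_divide_eq_left)
        then show ?thesis using ln_p N_function_nonneg[OF \<phi>, of \<mu>] by linarith
      qed
    qed simp
    then have "exp (ln (?p / 2)) \<le> exp (- young_fenchel \<phi> ?x)" by simp
    then show ?thesis using p by simp
  qed simp
qed

lemma mgf_le_tail_bound:
  assumes "prob_space M" and \<phi>: "N_function \<phi>" and [measurable]: "X \<in> borel_measurable M"
    and "mgf_le M \<phi> X \<sigma>" and "0 < \<sigma>" and "0 \<le> r"
  shows "measure M {\<omega> \<in> space M. r < \<bar>X \<omega>\<bar>} \<le> 2 * exp (- young_fenchel \<phi> (r / \<sigma>))"
proof -
  have "measure M {\<omega> \<in> space M. r < \<bar>X \<omega>\<bar>} \<le> 2 * exp (- young_fenchel \<phi> ((r - 0) / \<sigma>))"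
  proof (rule exp_chebyshev_young_fenchel[OF assms(1) \<phi>])
    fix lam :: real
    assume "0 < lam"
    then show "(\<integral>\<^sup>+ \<omega>. ennreal (exp (lam * \<bar>X \<omega>\<bar>)) \<partial>M) \<le> ennreal (exp (ln 2 + \<phi> (\<sigma> * lam) + lam * 0))"
      using nn_integral_exp_Max_le[of "{()}" "\<lambda>_. X" M \<phi> \<sigma> 0 lam] assms by simp
  qed (use assms in auto)
  then show ?thesis by simp
qed

text \<open>The exponent \<open>lam d\<^sub>l / r\<^sub>l\<close> is kept at the value \<open>a\<close> that a purely geometric choice of the weights
  gives, unless the entropy is so large that \<open>\<phi>\<inverse>(H\<^sub>l)\<close> exceeds it. Either way the cost of the \<open>l\<close>-th
  level over the geometric share of \<open>\<phi>(a)\<close> is at most \<open>2 lam d\<^sub>l \<Psi>(H\<^sub>l)\<close>.\<close>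

lemma chaining_weights:
  fixes d :: "nat \<Rightarrow> real"
  assumes \<phi>: "N_function \<phi>" and "0 < \<epsilon>" and \<theta>: "0 < \<theta>" "\<theta> < 1" and "0 < lam" and H: "\<And>l. 0 < H l"
    and d: "\<And>l. d l = \<theta> ^ l * \<epsilon>" and J: "(\<Sum>l<L. d l * Psi \<phi> (H l)) \<le> J"
    and a: "a = lam * \<epsilon> / (1 - \<theta>)"
    and m: "\<And>l. m l = max (inv_pos \<phi> (H l)) a" and r: "\<And>l. r l = lam * d l / m l"
  shows "(\<Sum>l<L. r l) \<le> 1" and "(\<Sum>l<L. r l * (ln 2 + H l + \<phi> (m l))) \<le> ln 2 + \<phi> a + 2 * lam * J"
proof -
  note inv = N_function_inv_pos[OF \<phi> H]
  have a_pos: "0 < a" using assms by simp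
  have d_pos: "0 < d l" for l using d \<theta> \<open>0 < \<epsilon>\<close> by simp
  have r_le: "r l \<le> \<theta> ^ l * (1 - \<theta>)" for l
  proof -
    have "r l \<le> lam * d l / a"
      unfolding r using a_pos d_pos[of l] \<open>0 < lam\<close> by (intro divide_left_mono) (auto simp: m)
    also have "\<dots> = \<theta> ^ l * (1 - \<theta>)"
      unfolding a d using \<open>0 < lam\<close> \<open>0 < \<epsilon>\<close> \<theta> by (simp add: field_simps)
    finally show ?thesis .
  qed
  have geo: "(\<Sum>l<L. \<theta> ^ l * (1 - \<theta>)) = 1 - \<theta> ^ L"
    by (induction L) (simp_all add: algebra_simps)
  have "(\<Sum>l<L. r l) \<le> (\<Sum>l<L. \<theta> ^ l * (1 - \<theta>))" by (intro sum_mono r_le)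
  also have "\<dots> \<le> 1" unfolding geo using \<theta> by simp
  finally show sum_r: "(\<Sum>l<L. r l) \<le> 1" .
  have level: "r l * (H l + \<phi> (m l)) \<le> \<theta> ^ l * (1 - \<theta>) * \<phi> a + 2 * lam * (d l * Psi \<phi> (H l))" for l
  proof (cases "inv_pos \<phi> (H l) \<le> a")
    case True
    then have m_eq: "m l = a" by (simp add: m)
    have "r l * H l \<le> lam * d l * Psi \<phi> (H l)"
      unfolding r m_eq Psi_def using True inv[of l] H[of l] d_pos[of l] \<open>0 < lam\<close> a_pos
      by (simp add: divide_left_mono)
    moreover have "0 \<le> lam * d l * Psi \<phi> (H l)"
      using Psi_nonneg[OF \<phi> H] d_pos[of l] \<open>0 < lam\<close> by simp
    moreover have "r l * \<phi> a \<le> \<theta> ^ l * (1 - \<theta>) * \<phi> a"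
      by (intro mult_right_mono r_le N_function_nonneg[OF \<phi>])
    ultimately show ?thesis by (simp add: m_eq distrib_left)
  next
    case False
    then have "m l = inv_pos \<phi> (H l)" by (simp add: m)
    then have "r l * (H l + \<phi> (m l)) = 2 * lam * (d l * Psi \<phi> (H l))"
      unfolding r using inv[of l] by (simp add: Psi_def)
    moreover have "0 \<le> \<theta> ^ l * (1 - \<theta>) * \<phi> a" using \<theta> N_function_nonneg[OF \<phi>, of a] by simp
    ultimately show ?thesis by linarith
  qed
  have "(\<Sum>l<L. r l * (ln 2 + H l + \<phi> (m l)))
      = ln 2 * (\<Sum>l<L. r l) + (\<Sum>l<L. r l * (H l + \<phi> (m l)))"
    by (simp add: sum_distrib_right distrib_left sum.distrib mult.commute)
  also have "\<dots> \<le> ln 2 * 1 + (\<Sum>l<L. \<theta> ^ l * (1 - \<theta>) * \<phi> a + 2 * lam * (d l * Psi \<phi> (H l)))"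
    by (intro add_mono mult_left_mono sum_r sum_mono level) simp
  also have "(\<Sum>l<L. \<theta> ^ l * (1 - \<theta>) * \<phi> a + 2 * lam * (d l * Psi \<phi> (H l)))
      = (1 - \<theta> ^ L) * \<phi> a + 2 * lam * (\<Sum>l<L. d l * Psi \<phi> (H l))"
    by (simp add: sum.distrib sum_distrib_left sum_distrib_right flip: geo)
  also have "\<dots> \<le> 1 * \<phi> a + 2 * lam * J"
    using \<theta> J \<open>0 < lam\<close> by (intro add_mono mult_right_mono mult_left_mono N_function_nonneg[OF \<phi>]) auto
  finally show "(\<Sum>l<L. r l * (ln 2 + H l + \<phi> (m l))) \<le> ln 2 + \<phi> a + 2 * lam * J" by simp
qed

text \<open>The maps \<open>\<pi> l\<close> send \<open>T\<close> onto finite nets. A net point of level \<open>L\<close> is joined to level \<open>0\<close> by projecting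
  it successively to the coarser nets, so \<open>\<bar>X\<bar>\<close> on the net is at most the sum of the maximal increments
  between neighbouring levels.\<close>

lemma chaining_net_tail:
  fixes X :: "'b \<Rightarrow> 'a \<Rightarrow> real" and \<pi> :: "nat \<Rightarrow> 'b \<Rightarrow> 'b"
  assumes "prob_space M" and \<phi>: "N_function \<phi>" and "0 < \<epsilon>" and \<theta>: "0 < \<theta>" "\<theta> < 1"
    and X: "\<And>t. t \<in> T \<Longrightarrow> X t \<in> borel_measurable M" and "T \<noteq> {}"
    and \<pi>: "\<And>l t. t \<in> T \<Longrightarrow> \<pi> l t \<in> T" and fin: "\<And>l. finite (\<pi> l ` T)"
    and card: "\<And>l. real (card (\<pi> l ` T)) \<le> exp (H l)" and H: "\<And>l. 0 < H l"
    and level0: "\<And>t. t \<in> T \<Longrightarrow> mgf_le M \<phi> (X t) \<epsilon>"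
    and incr: "\<And>l t. t \<in> T \<Longrightarrow> mgf_le M \<phi> (\<lambda>\<omega>. X t \<omega> - X (\<pi> l t) \<omega>) (\<theta> ^ Suc l * \<epsilon>)"
    and J: "\<And>L. (\<Sum>l<L. \<theta> ^ l * \<epsilon> * Psi \<phi> (H l)) \<le> J" and "2 * J \<le> r"
  shows "measure M {\<omega> \<in> space M. \<exists>t\<in>\<pi> L ` T. r < \<bar>X t \<omega>\<bar>}
    \<le> 2 * exp (- young_fenchel \<phi> ((r - 2 * J) * (1 - \<theta>) / \<epsilon>))" (is "measure M ?E \<le> _")
proof -
  interpret prob_space M by fact
  define D where "D l t \<omega> = (if l = 0 then X t \<omega> else X t \<omega> - X (\<pi> (l - 1) t) \<omega>)" for l t \<omega>
  define Y where "Y l \<omega> = (MAX t\<in>\<pi> l ` T. \<bar>D l t \<omega>\<bar>)" for l \<omega>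
  have net: "\<pi> l ` T \<subseteq> T" for l using \<pi> by auto
  have D_meas: "D l t \<in> borel_measurable M" if "t \<in> T" for l t
    unfolding D_def using X[OF that] X[OF \<pi>[OF that]] by (cases "l = 0") auto
  have Y_meas [measurable]: "Y l \<in> borel_measurable M" for l
    unfolding Y_def by (intro borel_measurable_Max borel_measurable_abs fin D_meas subsetD[OF net])
  have D_mgf: "mgf_le M \<phi> (D l t) (\<theta> ^ l * \<epsilon>)" if "t \<in> T" for l t
    unfolding D_def using level0[OF that] incr[OF that, of "l - 1"] by (cases l) auto
  have D_le: "\<bar>D l t \<omega>\<bar> \<le> Y l \<omega>" if "t \<in> \<pi> l ` T" for l t \<omega>
    unfolding Y_def using fin that by (intro Max_ge) auto
  have chain: "\<bar>X t \<omega>\<bar> \<le> (\<Sum>l<Suc L. Y l \<omega>)" if "t \<in> \<pi> L ` T" for t \<omega> L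
    using that
  proof (induction L arbitrary: t)
    case 0
    then show ?case using D_le[of t 0 \<omega>] by (simp add: D_def)
  next
    case (Suc L)
    have "\<pi> L t \<in> \<pi> L ` T" using Suc.prems net by auto
    from Suc.IH[OF this] D_le[OF Suc.prems, of \<omega>] show ?case by (simp add: D_def)
  qed
  have Eset [measurable]: "?E \<in> sets M"
  proof -
    have "?E = (\<Union>t\<in>\<pi> L ` T. {\<omega> \<in> space M. r < \<bar>X t \<omega>\<bar>})" by auto
    also have "\<dots> \<in> sets M"
    proof (rule sets.finite_UN[OF fin])
      fix t assume "t \<in> \<pi> L ` T"
      then have [measurable]: "X t \<in> borel_measurable M" using net X by blast
      show "{\<omega> \<in> space M. r < \<bar>X t \<omega>\<bar>} \<in> sets M" by measurable
    qed
    finally show ?thesis .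
  qed
  define scale where "scale = \<epsilon> / (1 - \<theta>)"
  have scale: "0 < scale" using \<theta> \<open>0 < \<epsilon>\<close> by (simp add: scale_def)
  have "measure M ?E \<le> 2 * exp (- young_fenchel \<phi> ((r - 2 * J) / scale))"
  proof (rule exp_chebyshev_young_fenchel[OF assms(1) \<phi> scale \<open>2 * J \<le> r\<close> Eset])
    show "r \<le> (\<Sum>l<Suc L. Y l \<omega>)" if "\<omega> \<in> ?E" for \<omega>
      using chain[of _ L \<omega>] that by fastforce
  next
    fix lam :: real
    assume lam: "0 < lam"
    define a where "a = lam * \<epsilon> / (1 - \<theta>)"
    define m where "m l = max (inv_pos \<phi> (H l)) a" for l
    define w where "w l = lam * (\<theta> ^ l * \<epsilon>) / m l" for l
    have "0 < a" using lam \<theta> \<open>0 < \<epsilon>\<close> by (simp add: a_def)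
    then have m_pos: "0 < m l" for l by (simp add: m_def)
    have w_pos: "0 < w l" for l using m_pos lam \<theta> \<open>0 < \<epsilon>\<close> by (simp add: w_def)
    note weights = chaining_weights[OF \<phi> \<open>0 < \<epsilon>\<close> \<theta> lam H refl J a_def m_def w_def, of "Suc L"]
    have "(\<integral>\<^sup>+ \<omega>. ennreal (exp (lam * (\<Sum>l<Suc L. Y l \<omega>))) \<partial>M)
        \<le> ennreal (exp (\<Sum>l<Suc L. w l * (ln 2 + H l + \<phi> (m l))))"
    proof (rule nn_integral_exp_sum_le[OF assms(1) Y_meas w_pos weights(1)])
      fix l
      have "\<theta> ^ l * \<epsilon> * (lam / w l) = m l"
        using m_pos[of l] lam \<theta> \<open>0 < \<epsilon>\<close> by (simp add: w_def)
      moreover have "(\<integral>\<^sup>+ \<omega>. ennreal (exp (lam / w l * (MAX t\<in>\<pi> l ` T. \<bar>D l t \<omega>\<bar>))) \<partial>M)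
          \<le> ennreal (exp (ln 2 + H l + \<phi> (\<theta> ^ l * \<epsilon> * (lam / w l))))"
        by (intro nn_integral_exp_Max_le D_meas D_mgf subsetD[OF net] fin \<phi> card)
          (use \<open>T \<noteq> {}\<close> lam w_pos[of l] in auto)
      ultimately show "(\<integral>\<^sup>+ \<omega>. ennreal (exp (lam / w l * Y l \<omega>)) \<partial>M) \<le> ennreal (exp (ln 2 + H l + \<phi> (m l)))"
        by (simp add: Y_def)
    qed
    also have "\<dots> \<le> ennreal (exp (ln 2 + \<phi> (scale * lam) + lam * (2 * J)))"
      using weights(2) by (intro ennreal_leI) (simp add: a_def scale_def ac_simps)
    finally show "(\<integral>\<^sup>+ \<omega>. ennreal (exp (lam * (\<Sum>l<Suc L. Y l \<omega>))) \<partial>M)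
        \<le> ennreal (exp (ln 2 + \<phi> (scale * lam) + lam * (2 * J)))" .
  qed
  then show ?thesis by (simp add: scale_def)
qed

text \<open>A continuous path that exceeds \<open>r\<close> somewhere exceeds it on all sufficiently fine nets.\<close>

lemma chaining_tail_bound:
  fixes X :: "'b :: topological_space \<Rightarrow> 'a \<Rightarrow> real" and \<pi> :: "nat \<Rightarrow> 'b \<Rightarrow> 'b"
  assumes "prob_space M" and \<phi>: "N_function \<phi>" and "0 < \<epsilon>" and \<theta>: "0 < \<theta>" "\<theta> < 1"
    and X: "\<And>t. t \<in> T \<Longrightarrow> X t \<in> borel_measurable M" and "T \<noteq> {}"
    and \<pi>: "\<And>l t. t \<in> T \<Longrightarrow> \<pi> l t \<in> T" and fin: "\<And>l. finite (\<pi> l ` T)"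
    and card: "\<And>l. real (card (\<pi> l ` T)) \<le> exp (H l)" and H: "\<And>l. 0 < H l"
    and conv: "\<And>t. t \<in> T \<Longrightarrow> (\<lambda>l. \<pi> l t) \<longlonglongrightarrow> t"
    and level0: "\<And>t. t \<in> T \<Longrightarrow> mgf_le M \<phi> (X t) \<epsilon>"
    and incr: "\<And>l t. t \<in> T \<Longrightarrow> mgf_le M \<phi> (\<lambda>\<omega>. X t \<omega> - X (\<pi> l t) \<omega>) (\<theta> ^ Suc l * \<epsilon>)"
    and J: "\<And>L. (\<Sum>l<L. \<theta> ^ l * \<epsilon> * Psi \<phi> (H l)) \<le> J" and "2 * J \<le> r"
  obtains B where "B \<in> sets M"
    and "measure M B \<le> 2 * exp (- young_fenchel \<phi> ((r - 2 * J) * (1 - \<theta>) / \<epsilon>))"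
    and "\<And>\<omega> t. \<omega> \<in> space M \<Longrightarrow> continuous_on T (\<lambda>t. X t \<omega>) \<Longrightarrow> t \<in> T \<Longrightarrow> r < \<bar>X t \<omega>\<bar> \<Longrightarrow> \<omega> \<in> B"
proof -
  interpret prob_space M by fact
  define E where "E L = {\<omega> \<in> space M. \<exists>t\<in>\<pi> L ` T. r < \<bar>X t \<omega>\<bar>}" for L
  define F where "F n = (\<Inter>L\<in>{n..}. E L)" for n
  have E_sets: "E L \<in> sets M" for L
  proof -
    have "E L = (\<Union>t\<in>\<pi> L ` T. {\<omega> \<in> space M. r < \<bar>X t \<omega>\<bar>})" unfolding E_def by auto
    also have "\<dots> \<in> sets M"
    proof (rule sets.finite_UN[OF fin])
      fix t assume "t \<in> \<pi> L ` T"
      then have [measurable]: "X t \<in> borel_measurable M" using \<pi> X by blast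
      show "{\<omega> \<in> space M. r < \<bar>X t \<omega>\<bar>} \<in> sets M" by measurable
    qed
    finally show ?thesis .
  qed
  have F_sets: "range F \<subseteq> sets M"
    unfolding F_def using E_sets by (auto intro!: sets.countable_INT')
  have "(\<lambda>n. measure M (F n)) \<longlonglongrightarrow> measure M (\<Union>n. F n)"
    by (rule finite_Lim_measure_incseq[OF F_sets]) (auto simp: incseq_def F_def)
  moreover have "measure M (F n) \<le> 2 * exp (- young_fenchel \<phi> ((r - 2 * J) * (1 - \<theta>) / \<epsilon>))" for n
  proof -
    have "measure M (F n) \<le> measure M (E n)"
      by (intro finite_measure_mono E_sets) (auto simp: F_def)
    also have "\<dots> \<le> 2 * exp (- young_fenchel \<phi> ((r - 2 * J) * (1 - \<theta>) / \<epsilon>))"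
      unfolding E_def by (rule chaining_net_tail[where X = X and \<pi> = \<pi> and H = H]) (use assms in auto)
    finally show ?thesis .
  qed
  ultimately have "measure M (\<Union>n. F n) \<le> 2 * exp (- young_fenchel \<phi> ((r - 2 * J) * (1 - \<theta>) / \<epsilon>))"
    by (intro LIMSEQ_le_const2) auto
  moreover have "(\<Union>n. F n) \<in> sets M" using F_sets by auto
  moreover have "\<omega> \<in> (\<Union>n. F n)"
    if \<omega>: "\<omega> \<in> space M" and cont: "continuous_on T (\<lambda>t. X t \<omega>)" and t: "t \<in> T" "r < \<bar>X t \<omega>\<bar>" for \<omega> t
  proof -
    have "(\<lambda>l. X (\<pi> l t) \<omega>) \<longlonglongrightarrow> X t \<omega>"
      by (rule continuous_on_tendsto_compose[OF cont conv]) (use t \<pi> in auto)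
    then have "(\<lambda>l. \<bar>X (\<pi> l t) \<omega>\<bar>) \<longlonglongrightarrow> \<bar>X t \<omega>\<bar>" by (rule tendsto_rabs)
    from order_tendstoD(1)[OF this t(2)] obtain n where "\<And>l. n \<le> l \<Longrightarrow> r < \<bar>X (\<pi> l t) \<omega>\<bar>"
      unfolding eventually_sequentially by blast
    then have "\<omega> \<in> F n" using \<omega> t by (auto simp: F_def E_def)
    then show ?thesis by blast
  qed
  ultimately show ?thesis using that by blast
qed

section \<open>Nets and entropy\<close>

lemma interval_net:
  fixes p q h :: real
  assumes "p < q" and "0 < h"
  obtains \<rho> where "\<And>x. x \<in> {p..q} \<Longrightarrow> \<rho> x \<in> {p..q}" and "\<And>x. x \<in> {p..q} \<Longrightarrow> \<bar>x - \<rho> x\<bar> \<le> h"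
    and "finite (\<rho> ` {p..q})" and "real (card (\<rho> ` {p..q})) \<le> (q - p) / (2 * h) + 1"
proof -
  define n where "n = nat \<lceil>(q - p) / (2 * h)\<rceil>"
  have ratio: "0 < (q - p) / (2 * h)" using assms by simp
  then have n: "0 < n" "(q - p) / (2 * h) \<le> real n" "real n \<le> (q - p) / (2 * h) + 1"
    unfolding n_def by linarith+
  define \<delta> where "\<delta> = (q - p) / real n"
  have \<delta>: "0 < \<delta>" "\<delta> \<le> 2 * h" "real n * \<delta> = q - p"
    using n assms by (auto simp: \<delta>_def field_simps)
  \<comment> \<open>Centres of \<open>n\<close> equal cells. The minimum in \<open>index\<close> assigns the end point \<open>q\<close> to the last cell.\<close>
  define centre where "centre i = p + (real i + 1 / 2) * \<delta>" for i :: nat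
  define index where "index x = min (nat \<lfloor>(x - p) / \<delta>\<rfloor>) (n - 1)" for x
  define \<rho> where "\<rho> x = centre (index x)" for x
  have index: "index x < n" for x using n by (auto simp: index_def)
  have centre: "centre i \<in> {p..q}" if "i < n" for i
  proof -
    have "(real i + 1 / 2) * \<delta> \<le> real n * \<delta>"
      using that \<delta> by (intro mult_right_mono) auto
    then show ?thesis using \<delta> by (auto simp: centre_def)
  qed
  have near: "\<bar>x - \<rho> x\<bar> \<le> h" if x: "x \<in> {p..q}" for x
  proof -
    let ?v = "(x - p) / \<delta>"
    have v: "0 \<le> ?v" "?v \<le> real n" using x \<delta> n by (auto simp: field_simps)
    have "real (index x) \<le> ?v" and "?v \<le> real (index x) + 1"
      using v n unfolding index_def by linarith+
    then have "\<bar>?v - (real (index x) + 1 / 2)\<bar> \<le> 1 / 2" by linarith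
    then have "\<bar>?v - (real (index x) + 1 / 2)\<bar> * \<delta> \<le> 1 / 2 * \<delta>"
      using \<delta> by (intro mult_right_mono) auto
    also have "\<bar>?v - (real (index x) + 1 / 2)\<bar> * \<delta> = \<bar>(?v - (real (index x) + 1 / 2)) * \<delta>\<bar>"
      using \<delta> by (simp add: abs_mult)
    also have "(?v - (real (index x) + 1 / 2)) * \<delta> = x - \<rho> x"
      using \<delta>(1) by (simp add: \<rho>_def centre_def left_diff_distrib diff_divide_distrib)
    finally show ?thesis using \<delta> by linarith
  qed
  have image: "\<rho> ` {p..q} \<subseteq> centre ` {..<n}" using index by (auto simp: \<rho>_def)
  then have "finite (\<rho> ` {p..q})" by (rule finite_subset) simp
  moreover have "card (\<rho> ` {p..q}) \<le> n"
    using card_mono[OF _ image] card_image_le[of "{..<n}" centre] by simp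
  ultimately show ?thesis
    using that[of \<rho>] near centre index n(3) by (auto simp: \<rho>_def)
qed

lemma rectangle_net:
  fixes p q p' q' h :: real
  assumes "p < q" and "p' < q'" and "0 < h"
  obtains \<pi> where "\<And>z. z \<in> {p..q} \<times> {p'..q'} \<Longrightarrow> \<pi> z \<in> {p..q} \<times> {p'..q'}"
    and "\<And>z. z \<in> {p..q} \<times> {p'..q'} \<Longrightarrow> \<bar>fst z - fst (\<pi> z)\<bar> \<le> h \<and> \<bar>snd z - snd (\<pi> z)\<bar> \<le> h"
    and "finite (\<pi> ` ({p..q} \<times> {p'..q'}))"
    and "real (card (\<pi> ` ({p..q} \<times> {p'..q'}))) \<le> ((q - p) / (2 * h) + 1) * ((q' - p') / (2 * h) + 1)"
proof -
  obtain \<rho> where \<rho>: "\<And>x. x \<in> {p..q} \<Longrightarrow> \<rho> x \<in> {p..q}" "\<And>x. x \<in> {p..q} \<Longrightarrow> \<bar>x - \<rho> x\<bar> \<le> h"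
    "finite (\<rho> ` {p..q})" "real (card (\<rho> ` {p..q})) \<le> (q - p) / (2 * h) + 1"
    using interval_net[OF assms(1,3)] by blast
  obtain \<rho>' where \<rho>': "\<And>x. x \<in> {p'..q'} \<Longrightarrow> \<rho>' x \<in> {p'..q'}" "\<And>x. x \<in> {p'..q'} \<Longrightarrow> \<bar>x - \<rho>' x\<bar> \<le> h"
    "finite (\<rho>' ` {p'..q'})" "real (card (\<rho>' ` {p'..q'})) \<le> (q' - p') / (2 * h) + 1"
    using interval_net[OF assms(2,3)] by blast
  have image: "map_prod \<rho> \<rho>' ` ({p..q} \<times> {p'..q'}) = (\<rho> ` {p..q}) \<times> (\<rho>' ` {p'..q'})"
    by (simp add: map_prod_surj_on)
  have "real (card (map_prod \<rho> \<rho>' ` ({p..q} \<times> {p'..q'})))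
      = real (card (\<rho> ` {p..q})) * real (card (\<rho>' ` {p'..q'}))"
    unfolding image by (simp add: card_cartesian_product)
  also have "\<dots> \<le> ((q - p) / (2 * h) + 1) * ((q' - p') / (2 * h) + 1)"
    using \<rho>(4) \<rho>'(4) assms by (intro mult_mono) auto
  finally have card: "real (card (map_prod \<rho> \<rho>' ` ({p..q} \<times> {p'..q'})))
      \<le> ((q - p) / (2 * h) + 1) * ((q' - p') / (2 * h) + 1)" .
  have "finite (map_prod \<rho> \<rho>' ` ({p..q} \<times> {p'..q'}))"
    unfolding image using \<rho>(3) \<rho>'(3) by simp
  from that[OF _ _ this card] show ?thesis using \<rho>(1,2) \<rho>'(1,2) by fastforce
qed

lemma admissible_inv_pos:
  assumes adm: "admissible \<phi> Z u0" and "Z u0 < v"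
  shows "u0 < inv_pos Z v" and "Z (inv_pos Z v) = v"
proof -
  have "Z 0 \<le> Z u0" using admissible_offset_nonneg[OF adm] by (intro admissible_mono[OF adm]) auto
  then have *: "0 \<le> inv_pos Z v" "Z (inv_pos Z v) = v"
    using adm assms(2) inv_pos_works[of Z v] unfolding admissible_def by auto
  then show "Z (inv_pos Z v) = v" by simp
  have "\<not> inv_pos Z v \<le> u0"
    using admissible_mono[OF adm *(1), of u0] *(2) assms(2) by linarith
  then show "u0 < inv_pos Z v" by simp
qed

lemma admissible_inv_pos_mono:
  assumes adm: "admissible \<phi> Z u0" and "Z u0 < v" and "v \<le> v'"
  shows "inv_pos Z v \<le> inv_pos Z v'"
proof (rule ccontr)
  assume "\<not> ?thesis"
  then have "inv_pos Z v' < inv_pos Z v" by simp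
  moreover have v': "Z u0 < v'" using assms by simp
  moreover have "0 \<le> inv_pos Z v'" and "0 \<le> inv_pos Z v"
    using admissible_inv_pos(1)[OF adm v'] admissible_inv_pos(1)[OF adm assms(2)]
      admissible_offset_nonneg[OF adm] by linarith+
  moreover have "strict_mono_on {0..} Z" using adm unfolding admissible_def by auto
  ultimately have "Z (inv_pos Z v') < Z (inv_pos Z v)"
    by (simp add: strict_mono_on_def)
  then show False using admissible_inv_pos(2)[OF adm] v' assms by simp
qed

lemma admissible_inv_pos_at_top:
  assumes adm: "admissible \<phi> Z u0"
  shows "filterlim (inv_pos Z) at_top at_top"
  unfolding filterlim_at_top
proof
  fix w
  let ?w = "max w (u0 + 1)"
  show "\<forall>\<^sub>F v in at_top. w \<le> inv_pos Z v"
    using eventually_gt_at_top[of "Z ?w"]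
  proof eventually_elim
    case (elim v)
    have "Z u0 \<le> Z ?w" using admissible_offset_nonneg[OF adm] by (intro admissible_mono[OF adm]) auto
    then have v: "Z u0 < v" using elim by simp
    have "\<not> inv_pos Z v \<le> ?w"
      using admissible_mono[OF adm, of "inv_pos Z v" ?w] admissible_inv_pos[OF adm v]
        admissible_offset_nonneg[OF adm] elim by linarith
    then show ?case by simp
  qed
qed

text \<open>On \<open>(\<theta>\<^sup>l\<^sup>+\<^sup>2 \<epsilon>, \<theta>\<^sup>l\<^sup>+\<^sup>1 \<epsilon>]\<close>, an interval of length \<open>\<theta> (1 - \<theta>) \<theta>\<^sup>l \<epsilon>\<close>, a decreasing function is at least its
  value at the right end.\<close>

lemma geometric_sum_le_integral:
  fixes f :: "real \<Rightarrow> real"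
  assumes "0 < \<epsilon>" and \<theta>: "0 < \<theta>" "\<theta> < 1" and int: "set_integrable lborel {0<..\<theta> * \<epsilon>} f"
    and anti: "\<And>s s'. 0 < s \<Longrightarrow> s \<le> s' \<Longrightarrow> s' \<le> \<theta> * \<epsilon> \<Longrightarrow> f s' \<le> f s"
    and nonneg: "\<And>s. 0 < s \<Longrightarrow> s \<le> \<theta> * \<epsilon> \<Longrightarrow> 0 \<le> f s"
  shows "(\<Sum>l<L. \<theta> ^ l * \<epsilon> * f (\<theta> ^ Suc l * \<epsilon>)) \<le> (LINT s:{0<..\<theta> * \<epsilon>}|lborel. f s) / (\<theta> * (1 - \<theta>))"
proof -
  define c where "c l = \<theta> ^ Suc l * \<epsilon>" for l
  have c_pos: "0 < c l" for l using assms by (simp add: c_def)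
  have c_Suc: "c (Suc l) \<le> c l" for l
    using assms by (simp add: c_def mult_left_le_one_le)
  have c_le: "c l \<le> \<theta> * \<epsilon>" for l
  proof -
    have "\<theta> ^ l \<le> 1" using \<theta> by (simp add: power_le_one)
    then show ?thesis using assms by (simp add: c_def mult_left_le_one_le)
  qed
  have int': "set_integrable lborel {s<..s'} f" if "0 \<le> s" "s' \<le> \<theta> * \<epsilon>" for s s'
    by (rule set_integrable_subset[OF int]) (use that in auto)
  have "(\<Sum>l<L. (c l - c (Suc l)) * f (c l)) \<le> (LINT s:{c L<..c 0}|lborel. f s)"
  proof (induction L)
    case 0
    show ?case by (simp add: set_lebesgue_integral_def)
  next
    case (Suc L)
    have c_0: "c L \<le> c 0" using c_le[of L] by (simp add: c_def)
    have "(c L - c (Suc L)) * f (c L) = (LINT s:{c (Suc L)<..c L}|lborel. f (c L))"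
      using c_Suc[of L] by (simp add: set_lebesgue_integral_def)
    also have "\<dots> \<le> (LINT s:{c (Suc L)<..c L}|lborel. f s)"
    proof (rule set_integral_mono)
      show "set_integrable lborel {c (Suc L)<..c L} (\<lambda>_. f (c L))"
        using c_Suc[of L] unfolding set_integrable_def
        by (intro integrable_scaleR_left integrable_real_indicator) auto
      show "set_integrable lborel {c (Suc L)<..c L} f"
        by (rule int'[OF less_imp_le[OF c_pos] c_le])
      show "f (c L) \<le> f s" if "s \<in> {c (Suc L)<..c L}" for s
        using that c_pos[of "Suc L"] c_le[of L] by (intro anti) auto
    qed
    finally have "(\<Sum>l<Suc L. (c l - c (Suc l)) * f (c l))
        \<le> (LINT s:{c L<..c 0}|lborel. f s) + (LINT s:{c (Suc L)<..c L}|lborel. f s)"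
      using Suc.IH by simp
    also have "\<dots> = (LINT s:{c L<..c 0} \<union> {c (Suc L)<..c L}|lborel. f s)"
      by (rule set_integral_Un[symmetric, OF _ int'[OF less_imp_le[OF c_pos] c_le] int'[OF less_imp_le[OF c_pos] c_le]])
        auto
    also have "{c L<..c 0} \<union> {c (Suc L)<..c L} = {c (Suc L)<..c 0}"
      using c_Suc[of L] c_0 by auto
    finally show ?case .
  qed
  also have "\<dots> \<le> (LINT s:{0<..\<theta> * \<epsilon>}|lborel. f s)"
    unfolding set_lebesgue_integral_def
  proof (rule integral_mono)
    show "integrable lborel (\<lambda>s. indicator {c L<..c 0} s *\<^sub>R f s)"
      using int'[OF less_imp_le[OF c_pos] c_le] unfolding set_integrable_def .
    show "integrable lborel (\<lambda>s. indicator {0<..\<theta> * \<epsilon>} s *\<^sub>R f s)"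
      using int unfolding set_integrable_def .
    show "indicator {c L<..c 0} s *\<^sub>R f s \<le> indicator {0<..\<theta> * \<epsilon>} s *\<^sub>R f s" for s
      using nonneg[of s] c_le[of 0] c_pos[of L] by (auto split: split_indicator)
  qed
  finally have sum_le: "(\<Sum>l<L. (c l - c (Suc l)) * f (c l)) \<le> (LINT s:{0<..\<theta> * \<epsilon>}|lborel. f s)" .
  have "(\<Sum>l<L. \<theta> ^ l * \<epsilon> * f (\<theta> ^ Suc l * \<epsilon>)) * (\<theta> * (1 - \<theta>)) = (\<Sum>l<L. (c l - c (Suc l)) * f (c l))"
    unfolding sum_distrib_right by (intro sum.cong refl) (simp add: c_def algebra_simps)
  then show ?thesis using sum_le \<theta> by (simp add: pos_le_divide_eq)
qed

lemma exceeds_on_dense_subset: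
  fixes f :: "'b :: metric_space \<Rightarrow> real"
  assumes "continuous_on S f" and "D \<subseteq> S" and "S \<subseteq> closure D" and "z \<in> S" and "r < f z"
  shows "\<exists>d\<in>D. r < f d"
proof -
  obtain d where d: "\<And>n. d n \<in> D" "d \<longlonglongrightarrow> z"
    using assms unfolding closure_sequential by (meson subsetD closure_sequential)
  have "(\<lambda>n. f (d n)) \<longlonglongrightarrow> f z"
    by (rule continuous_on_tendsto_compose[OF assms(1) d(2)]) (use d(1) assms(2,4) in \<open>auto intro!: always_eventually\<close>)
  from order_tendstoD(1)[OF this assms(5)] have "\<exists>n. r < f (d n)"
    by (rule eventually_happens'[OF sequentially_bot])
  then show ?thesis using d(1) by blast
qed

section \<open>The random field\<close>

locale dispersive_field =
  fixes M :: "'a measure" and \<phi> \<kappa> Z :: "real \<Rightarrow> real" and y :: "real \<Rightarrow> 'a \<Rightarrow> real"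
    and U :: "real \<Rightarrow> real \<Rightarrow> 'a \<Rightarrow> real" and N :: nat and a :: "nat \<Rightarrow> real" and A Cy CZ u0 :: real
  assumes prob: "prob_space M" and \<phi>: "N_function \<phi>"
    and y: "strictly_sub_gaussian M \<phi> (range y) Cy" and A: "0 < A" and \<kappa>: "\<kappa> = cos \<or> \<kappa> = sin"
    and U: "\<And>x t. x \<in> {-A..A} \<Longrightarrow> t \<ge> 0 \<Longrightarrow> has_ms_integral M y (kernel_I \<kappa> N a t x) (U t x)"
    and adm: "admissible \<phi> Z u0" and CZ: "0 \<le> CZ"
    and variation: "has_variation_integral (covariance_fun M y)
      (\<lambda>l m. Z_weight Z u0 N a l * Z_weight Z u0 N a m) (CZ\<^sup>2)"
begin

sublocale prob_space M by (rule prob)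

lemma U_square_integrable: "x \<in> {-A..A} \<Longrightarrow> 0 \<le> t \<Longrightarrow> square_integrable M (U t x)"
  by (rule has_ms_integral_square_integrable[OF U])

lemma U_measurable: "x \<in> {-A..A} \<Longrightarrow> 0 \<le> t \<Longrightarrow> U t x \<in> borel_measurable M"
  using U_square_integrable unfolding square_integrable_def by blast

lemma U_dominated: "x \<in> {-A..A} \<Longrightarrow> 0 \<le> t \<Longrightarrow> dominated_by_variance M \<phi> Cy (U t x)"
  by (rule has_ms_integral_dominated_by_variance[OF \<phi> y U])

lemma increment_dominated:
  assumes "x \<in> {-A..A}" "0 \<le> t" "x' \<in> {-A..A}" "0 \<le> t'"
  shows "dominated_by_variance M \<phi> Cy (\<lambda>\<omega>. U t x \<omega> - U t' x' \<omega>)"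
  using assms by (intro has_ms_integral_dominated_by_variance[OF \<phi> y has_ms_integral_diff[OF U U]])

lemma second_moment_le_of_kernel_bound:
  assumes "has_ms_integral M y f X" and "\<And>l. \<bar>f l\<bar> \<le> K * Z_weight Z u0 N a l" and "0 \<le> K"
  shows "sqrt (second_moment M X) \<le> K * CZ"
proof -
  have "second_moment M X \<le> K\<^sup>2 * CZ\<^sup>2"
    by (rule has_ms_integral_second_moment_le[OF strictly_sub_gaussian_square_integrable[OF y] assms(1) variation assms(2)])
  then have "sqrt (second_moment M X) \<le> sqrt ((K * CZ)\<^sup>2)"
    by (simp add: power_mult_distrib)
  then show ?thesis using assms(3) CZ by simp
qed

lemma increment_second_moment_le:
  assumes "x \<in> {-A..A}" "0 \<le> t" "x' \<in> {-A..A}" "0 \<le> t'"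
    and "0 < h" "\<bar>x - x'\<bar> \<le> h" "\<bar>t - t'\<bar> \<le> h"
  shows "sqrt (second_moment M (\<lambda>\<omega>. U t x \<omega> - U t' x' \<omega>)) \<le> 2 / Z (1 / h + u0) * CZ"
proof (rule second_moment_le_of_kernel_bound)
  show "has_ms_integral M y (\<lambda>l. kernel_I \<kappa> N a t x l - kernel_I \<kappa> N a t' x' l) (\<lambda>\<omega>. U t x \<omega> - U t' x' \<omega>)"
    using assms by (intro has_ms_integral_diff U)
  show "\<bar>kernel_I \<kappa> N a t x l - kernel_I \<kappa> N a t' x' l\<bar> \<le> 2 / Z (1 / h + u0) * Z_weight Z u0 N a l" for l
    by (rule kernel_I_increment_le[OF \<kappa> adm]) fact+
  show "0 \<le> 2 / Z (1 / h + u0)"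
    using admissible_nonneg[OF adm, of "1 / h + u0"] admissible_offset_nonneg[OF adm] \<open>0 < h\<close> by simp
qed

lemma U_second_moment_le:
  assumes "x \<in> {-A..A}" "0 \<le> t" and "0 < Z u0"
  shows "sqrt (second_moment M (U t x)) \<le> 1 / (2 * Z u0) * CZ"
proof (rule second_moment_le_of_kernel_bound[OF U[OF assms(1,2)]])
  fix l
  have "\<bar>kernel_I \<kappa> N a t x l\<bar> \<le> 1" using \<kappa> unfolding kernel_I_def by auto
  also have "1 \<le> 1 / (2 * Z u0) * Z_weight Z u0 N a l"
    using Z_weight_ge[OF adm, of N a l] assms(3) by simp
  finally show "\<bar>kernel_I \<kappa> N a t x l\<bar> \<le> 1 / (2 * Z u0) * Z_weight Z u0 N a l" .
qed (use assms in simp)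

lemma sqrt_second_moment_bdd_above:
  assumes "0 \<le> p"
  shows "bdd_above ((\<lambda>(x, t). sqrt (second_moment M (U t x))) ` ({-A..A} \<times> {p..q}))"
proof (rule bdd_aboveI2)
  \<comment> \<open>The whole rectangle is within distance \<open>?h\<close> of the reference point \<open>(0, p)\<close>.\<close>
  let ?h = "max (2 * A) (q - p)"
  let ?B = "(2 / Z (1 / ?h + u0) * CZ)\<^sup>2"
  fix z
  assume z: "z \<in> {-A..A} \<times> {p..q}"
  obtain x t where xt: "z = (x, t)" by fastforce
  have pq: "p \<le> t" "t \<le> q" and x: "x \<in> {-A..A}" "0 \<in> {-A..A}" and t: "0 \<le> t"
    using z xt A assms by auto
  let ?X = "U t x" and ?Y = "U p 0"
  have "sqrt (second_moment M (\<lambda>\<omega>. ?X \<omega> - ?Y \<omega>)) \<le> 2 / Z (1 / ?h + u0) * CZ"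
    using x t assms A pq by (intro increment_second_moment_le) auto
  then have diff: "second_moment M (\<lambda>\<omega>. ?X \<omega> - ?Y \<omega>) \<le> ?B" by (rule sqrt_le_D)
  note sq = U_square_integrable[OF x(1) t] U_square_integrable[OF x(2) assms]
  note int = sq[unfolded square_integrable_def] square_integrable_diff[OF sq, unfolded square_integrable_def]
  have "second_moment M ?X \<le> (LINT \<omega>|M. 2 * (?X \<omega> - ?Y \<omega>)\<^sup>2 + 2 * (?Y \<omega>)\<^sup>2)"
    unfolding second_moment_def
  proof (rule integral_mono)
    fix \<omega>
    have "(v + w)\<^sup>2 \<le> 2 * v\<^sup>2 + 2 * w\<^sup>2" for v w :: real
      using zero_le_power2[of "v - w"] by (simp add: power2_eq_square algebra_simps)
    from this[of "?X \<omega> - ?Y \<omega>" "?Y \<omega>"] show "(?X \<omega>)\<^sup>2 \<le> 2 * (?X \<omega> - ?Y \<omega>)\<^sup>2 + 2 * (?Y \<omega>)\<^sup>2" by simp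
  qed (use int in auto)
  also have "\<dots> = 2 * second_moment M (\<lambda>\<omega>. ?X \<omega> - ?Y \<omega>) + 2 * second_moment M ?Y"
    using int unfolding second_moment_def by simp
  also have "\<dots> \<le> 2 * ?B + 2 * second_moment M ?Y" using diff by simp
  finally show "(case z of (x, t) \<Rightarrow> sqrt (second_moment M (U t x))) \<le> sqrt (2 * ?B + 2 * second_moment M ?Y)"
    by (simp add: xt)
qed

lemma eps_sup_eq:
  "eps_sup M U Cy A b k = Cy * (SUP (x, t)\<in>{-A..A} \<times> {b k..b (Suc k)}. sqrt (second_moment M (U t x)))"
  unfolding eps_sup_def second_moment_def by simp

text \<open>The case \<open>Cy < 0\<close>, which the hypotheses allow, forces all second moments to vanish, so that \<open>eps_sup\<close> is still an upper
  bound.\<close>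

lemma norm_le_eps_sup:
  assumes "0 \<le> b k" and xt: "x \<in> {-A..A}" "t \<in> {b k..b (Suc k)}"
  shows "0 \<le> Cy * sqrt (second_moment M (U t x))"
    and "Cy * sqrt (second_moment M (U t x)) \<le> eps_sup M U Cy A b k"
proof -
  let ?R = "{-A..A} \<times> {b k..b (Suc k)}"
  have nn: "0 \<le> Cy * sqrt (second_moment M (U t x))" if "(x, t) \<in> ?R" for x t
    using U_dominated[of x t] that assms(1) unfolding dominated_by_variance_def by auto
  then show "0 \<le> Cy * sqrt (second_moment M (U t x))" using xt by auto
  show "Cy * sqrt (second_moment M (U t x)) \<le> eps_sup M U Cy A b k"
  proof (cases "0 \<le> Cy")
    case True
    have "sqrt (second_moment M (U t x)) \<le> (SUP (x, t)\<in>?R. sqrt (second_moment M (U t x)))"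
      using cSUP_upper[OF _ sqrt_second_moment_bdd_above[OF assms(1), of "b (Suc k)"], of "(x, t)"] xt by auto
    then show ?thesis unfolding eps_sup_eq using True by (intro mult_left_mono)
  next
    case False
    have zero: "sqrt (second_moment M (U t x)) = 0" if "(x, t) \<in> ?R" for x t
      using nn[OF that] False second_moment_nonneg[of M "U t x"]
      by (simp add: zero_le_mult_iff)
    have "(\<lambda>(x, t). sqrt (second_moment M (U t x))) ` ?R = {0}"
      using zero xt by (auto simp: image_iff)
    then show ?thesis unfolding eps_sup_eq using zero[of x t] xt by simp
  qed
qed

lemma U_mgf_le_eps_sup:
  assumes "0 \<le> b k" and "x \<in> {-A..A}" "t \<in> {b k..b (Suc k)}"
  shows "mgf_le M \<phi> (U t x) (eps_sup M U Cy A b k)"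
proof (rule mgf_le_mono[OF \<phi>])
  show "mgf_le M \<phi> (U t x) (Cy * sqrt (second_moment M (U t x)))"
    using U_dominated[of x t] assms by (auto simp: dominated_by_variance_def)
qed (use norm_le_eps_sup[OF assms] in auto)

lemma eps_sup_nonneg:
  assumes "0 \<le> b k" and "b k \<le> b (Suc k)"
  shows "0 \<le> eps_sup M U Cy A b k"
  using norm_le_eps_sup[of b k 0 "b k"] assms A by auto

section \<open>Tail bounds on a rectangle\<close>

text \<open>If the variables of the field on a rectangle coincide almost surely with one variable \<open>Y\<close>, continuity
  transfers the identity from a countable dense set to the whole path.\<close>

lemma constant_field_tail:
  assumes "0 \<le> p" and [measurable]: "Y \<in> borel_measurable M"
    and eq: "\<And>x t. x \<in> {-A..A} \<Longrightarrow> t \<in> {p..q} \<Longrightarrow> AE \<omega> in M. U t x \<omega> = Y \<omega>"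
  obtains B where "B \<in> sets M" and "measure M B \<le> measure M {\<omega> \<in> space M. r < \<bar>Y \<omega>\<bar>}"
    and "\<And>\<omega> x t. \<omega> \<in> space M \<Longrightarrow> continuous_on ({-A..A} \<times> {p..q}) (\<lambda>(x, t). U t x \<omega>) \<Longrightarrow>
      x \<in> {-A..A} \<Longrightarrow> t \<in> {p..q} \<Longrightarrow> r < \<bar>U t x \<omega>\<bar> \<Longrightarrow> \<omega> \<in> B"
proof -
  let ?R = "{-A..A} \<times> {p..q}"
  obtain D where D: "countable D" "D \<subseteq> ?R" "?R \<subseteq> closure D" using separable by blast
  define B where "B = {\<omega> \<in> space M. \<exists>d\<in>D. r < \<bar>U (snd d) (fst d) \<omega>\<bar>}"
  have [measurable]: "U (snd d) (fst d) \<in> borel_measurable M" if "d \<in> D" for d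
    using that D(2) assms(1) by (intro U_measurable) auto
  have "{\<omega> \<in> space M. r < \<bar>U (snd d) (fst d) \<omega>\<bar>} \<in> sets M" if "d \<in> D" for d
    using that by measurable
  then have "(\<Union>d\<in>D. {\<omega> \<in> space M. r < \<bar>U (snd d) (fst d) \<omega>\<bar>}) \<in> sets M"
    by (intro sets.countable_UN'[OF D(1)]) blast
  also have "(\<Union>d\<in>D. {\<omega> \<in> space M. r < \<bar>U (snd d) (fst d) \<omega>\<bar>}) = B" by (auto simp: B_def)
  finally have B: "B \<in> sets M" .
  have "AE \<omega> in M. \<forall>d\<in>D. U (snd d) (fst d) \<omega> = Y \<omega>"
    using D(1,2) eq by (subst AE_ball_countable) auto
  then have "AE \<omega> in M. \<omega> \<in> B \<longrightarrow> \<omega> \<in> {\<omega> \<in> space M. r < \<bar>Y \<omega>\<bar>}"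
    by eventually_elim (auto simp: B_def)
  then have "measure M B \<le> measure M {\<omega> \<in> space M. r < \<bar>Y \<omega>\<bar>}"
    by (intro finite_measure_mono_AE) simp_all
  moreover have "\<omega> \<in> B" if \<omega>: "\<omega> \<in> space M" and cont: "continuous_on ?R (\<lambda>(x, t). U t x \<omega>)"
    and "x \<in> {-A..A}" "t \<in> {p..q}" "r < \<bar>U t x \<omega>\<bar>" for \<omega> x t
  proof -
    have "continuous_on ?R (\<lambda>z. \<bar>U (snd z) (fst z) \<omega>\<bar>)"
      using continuous_on_rabs[OF cont] by (simp add: case_prod_unfold)
    from exceeds_on_dense_subset[OF this D(2,3), of "(x, t)" r] that show ?thesis
      by (auto simp: B_def)
  qed
  ultimately show ?thesis using that B by blast
qed

text \<open>\<open>CZ = 0\<close> does not make the field vanish: the weight may be zero at frequency \<open>0\<close>, where the kernel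
  \<open>cos\<close> is \<open>1\<close>. The field is then almost surely constant on the rectangle.\<close>

lemma segment_tail_bound_constant:
  assumes b: "0 \<le> b k" "b k < b (Suc k)" and \<theta>: "0 < \<theta>" "\<theta> < 1" and "0 < r"
    and eps: "0 < eps_sup M U Cy A b k" and "CZ = 0"
  obtains B where "B \<in> sets M"
    and "measure M B \<le> 2 * exp (- young_fenchel \<phi> (r * (1 - \<theta>) / (2 * eps_sup M U Cy A b k)))"
    and "\<And>\<omega> x t. \<omega> \<in> space M \<Longrightarrow> continuous_on ({-A..A} \<times> {b k..b (Suc k)}) (\<lambda>(x, t). U t x \<omega>) \<Longrightarrow>
      x \<in> {-A..A} \<Longrightarrow> t \<in> {b k..b (Suc k)} \<Longrightarrow> r < \<bar>U t x \<omega>\<bar> \<Longrightarrow> \<omega> \<in> B"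
proof -
  let ?\<epsilon> = "eps_sup M U Cy A b k" and ?Y = "U (b k) 0"
  have base: "0 \<in> {-A..A}" "b k \<in> {b k..b (Suc k)}" using A b by auto
  have Y: "?Y \<in> borel_measurable M" using base b by (intro U_measurable) auto
  have eq: "AE \<omega> in M. U t x \<omega> = ?Y \<omega>" if xt: "x \<in> {-A..A}" "t \<in> {b k..b (Suc k)}" for x t
  proof -
    let ?\<Delta> = "\<lambda>\<omega>. U t x \<omega> - ?Y \<omega>"
    have "sqrt (second_moment M ?\<Delta>) \<le> 2 / Z (1 / max (2 * A) (b (Suc k) - b k) + u0) * CZ"
      using xt base b A by (intro increment_second_moment_le) auto
    then have "sqrt (second_moment M ?\<Delta>) = 0"
      using \<open>CZ = 0\<close> second_moment_nonneg[of M ?\<Delta>] by simp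
    moreover have "dominated_by_variance M \<phi> Cy ?\<Delta>"
      using xt base b by (intro increment_dominated) auto
    ultimately have "mgf_le M \<phi> ?\<Delta> 0" by (simp add: dominated_by_variance_def)
    moreover have "?\<Delta> \<in> borel_measurable M"
      using xt b by (intro borel_measurable_diff Y U_measurable) auto
    ultimately have "AE \<omega> in M. ?\<Delta> \<omega> = 0" using mgf_le_zero_imp_AE_zero[OF prob \<phi>] by blast
    then show ?thesis by simp
  qed
  obtain B where B: "B \<in> sets M" "measure M B \<le> measure M {\<omega> \<in> space M. r < \<bar>?Y \<omega>\<bar>}"
    "\<And>\<omega> x t. \<omega> \<in> space M \<Longrightarrow> continuous_on ({-A..A} \<times> {b k..b (Suc k)}) (\<lambda>(x, t). U t x \<omega>) \<Longrightarrow>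
      x \<in> {-A..A} \<Longrightarrow> t \<in> {b k..b (Suc k)} \<Longrightarrow> r < \<bar>U t x \<omega>\<bar> \<Longrightarrow> \<omega> \<in> B"
    using constant_field_tail[OF b(1) Y eq, of "b (Suc k)" r] by blast
  have "measure M {\<omega> \<in> space M. r < \<bar>?Y \<omega>\<bar>} \<le> 2 * exp (- young_fenchel \<phi> (r / ?\<epsilon>))"
    using \<open>0 < r\<close> U_mgf_le_eps_sup[OF b(1) base] eps by (intro mgf_le_tail_bound[OF prob \<phi> Y]) auto
  also have "r * (1 - \<theta>) / (2 * ?\<epsilon>) \<le> r / ?\<epsilon>"
    using \<open>0 < r\<close> \<theta> eps by (simp add: divide_simps)
  then have "young_fenchel \<phi> (r * (1 - \<theta>) / (2 * ?\<epsilon>)) \<le> young_fenchel \<phi> (r / ?\<epsilon>)"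
    using \<open>0 < r\<close> \<theta> eps by (intro young_fenchel_mono[OF \<phi>]) auto
  then have "2 * exp (- young_fenchel \<phi> (r / ?\<epsilon>)) \<le> 2 * exp (- young_fenchel \<phi> (r * (1 - \<theta>) / (2 * ?\<epsilon>)))"
    by simp
  finally show ?thesis using that B by (meson order_trans)
qed

text \<open>For the norm \<open>s\<close> the net consists of centres of rectangles of half-sides at most \<open>1 / (Z\<inverse>(K / s) - u0)\<close>, \<open>K = 2 CZ Cy\<close>:
  over such a distance the norm of an increment is at most \<open>s\<close>, and the logarithm of the number of
  rectangles is at most the entropy in the integrand.\<close>

lemma segment_tail_bound_chaining:
  assumes b: "0 \<le> b k" "b k < b (Suc k)" and \<theta>: "0 < \<theta>" "\<theta> < 1"
    and eps: "0 < eps_sup M U Cy A b k" and CZ_pos: "0 < CZ"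
    and int: "set_integrable lborel {0<..\<theta> * eps_sup M U Cy A b k} (entropy_integrand \<phi> Z u0 CZ Cy A b k)"
    and entropy: "entropy_integral \<phi> Z u0 CZ Cy A b k (\<theta> * eps_sup M U Cy A b k) * (4 / (\<theta> * (1 - \<theta>))) \<le> r"
  obtains B where "B \<in> sets M"
    and "measure M B \<le> 2 * exp (- young_fenchel \<phi> (r * (1 - \<theta>) / (2 * eps_sup M U Cy A b k)))"
    and "\<And>\<omega> x t. \<omega> \<in> space M \<Longrightarrow> continuous_on ({-A..A} \<times> {b k..b (Suc k)}) (\<lambda>(x, t). U t x \<omega>) \<Longrightarrow>
      x \<in> {-A..A} \<Longrightarrow> t \<in> {b k..b (Suc k)} \<Longrightarrow> r < \<bar>U t x \<omega>\<bar> \<Longrightarrow> \<omega> \<in> B"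
proof -
  let ?R = "{-A..A} \<times> {b k..b (Suc k)}"
  define \<epsilon> where "\<epsilon> = eps_sup M U Cy A b k"
  define S where "S = (SUP (x, t)\<in>?R. sqrt (second_moment M (U t x)))"
  have \<epsilon>_eq: "\<epsilon> = Cy * S" by (simp add: \<epsilon>_def S_def eps_sup_eq)
  have \<epsilon>: "0 < \<epsilon>" using eps by (simp add: \<epsilon>_def)
  have base: "(0, b k) \<in> ?R" using A b by auto
  have "0 \<le> sqrt (second_moment M (U (b k) 0))" using second_moment_nonneg by simp
  also have "\<dots> \<le> S"
    unfolding S_def using cSUP_upper[OF base sqrt_second_moment_bdd_above[OF b(1), of "b (Suc k)"]] by simp
  finally have "0 \<le> S" .
  then have Cy: "0 < Cy" using \<epsilon> \<epsilon>_eq by (simp add: zero_less_mult_iff)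
  define K where "K = 2 * CZ * Cy"
  have K: "0 < K" using CZ_pos Cy by (simp add: K_def)
  \<comment> \<open>The inverse of \<open>Z\<close> is evaluated only at arguments above \<open>Z u0\<close>: the kernel is at most \<open>1\<close> and the weight at least
    \<open>2 Z u0\<close>, whence \<open>\<epsilon> \<le> Cy CZ / (2 Z u0)\<close>.\<close>
  have scale: "Z u0 < K / s" if "0 < s" "s \<le> \<theta> * \<epsilon>" for s
  proof (cases "Z u0 = 0")
    case True
    then show ?thesis using K that by simp
  next
    case False
    then have Z: "0 < Z u0"
      using admissible_nonneg[OF adm admissible_offset_nonneg[OF adm]] by simp
    have "S \<le> 1 / (2 * Z u0) * CZ"
      unfolding S_def
    proof (rule cSUP_least)
      fix z
      assume "z \<in> ?R"
      then show "(case z of (x, t) \<Rightarrow> sqrt (second_moment M (U t x))) \<le> 1 / (2 * Z u0) * CZ"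
        using U_second_moment_le[OF _ _ Z, of "fst z" "snd z"] b by (auto simp: case_prod_unfold)
    qed (use base in blast)
    then have "\<epsilon> \<le> Cy * (1 / (2 * Z u0) * CZ)"
      unfolding \<epsilon>_eq using Cy by (intro mult_left_mono) auto
    then have "4 * (\<epsilon> * Z u0) \<le> K" using Z by (simp add: K_def field_simps)
    moreover have "s < 4 * \<epsilon>"
    proof -
      have "\<theta> * \<epsilon> < 1 * \<epsilon>" using \<theta> \<epsilon> by (intro mult_strict_right_mono) auto
      then show ?thesis using that \<epsilon> by linarith
    qed
    then have "s * Z u0 < 4 * \<epsilon> * Z u0" using Z by (intro mult_strict_right_mono)
    ultimately have "s * Z u0 < K" by (simp add: mult.assoc)
    then show ?thesis using that by (simp add: field_simps)
  qed
  define g where "g s = inv_pos Z (K / s) - u0" for s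
  have g_pos: "0 < g s" and g_inv: "Z (g s + u0) = K / s" if "0 < s" "s \<le> \<theta> * \<epsilon>" for s
    using admissible_inv_pos[OF adm scale[OF that]] by (auto simp: g_def)
  have g_anti: "g s' \<le> g s" if "0 < s" "s \<le> s'" "s' \<le> \<theta> * \<epsilon>" for s s'
    unfolding g_def using that scale[of s'] K
    by (intro diff_right_mono admissible_inv_pos_mono[OF adm]) (auto intro: divide_left_mono)
  define Hf where "Hf s = ln (A * g s + 1) + ln ((b (Suc k) - b k) / 2 * g s + 1)" for s
  have integrand: "entropy_integrand \<phi> Z u0 CZ Cy A b k = (\<lambda>s. Psi \<phi> (Hf s))"
    by (simp add: fun_eq_iff entropy_integrand_def Hf_def g_def K_def)
  have Hf_pos: "0 < Hf s" if "0 < s" "s \<le> \<theta> * \<epsilon>" for s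
    using g_pos[OF that] A b unfolding Hf_def by (intro add_pos_pos ln_gt_zero) auto
  have Hf_anti: "Hf s' \<le> Hf s" if "0 < s" "s \<le> s'" "s' \<le> \<theta> * \<epsilon>" for s s'
  proof -
    have "0 < g s'" using g_pos[of s'] that by simp
    then show ?thesis
      unfolding Hf_def using g_anti[OF that] A b
      by (intro add_mono ln_mono add_right_mono mult_left_mono add_nonneg_pos) auto
  qed
  define e where "e l = \<theta> ^ Suc l * \<epsilon>" for l
  have e: "0 < e l" "e l \<le> \<theta> * \<epsilon>" for l
  proof -
    show "0 < e l" using \<theta> \<epsilon> by (simp add: e_def)
    have "\<theta> ^ l \<le> 1" using \<theta> by (simp add: power_le_one)
    then show "e l \<le> \<theta> * \<epsilon>" using \<theta> \<epsilon> by (simp add: e_def mult_left_le_one_le)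
  qed
  define h where "h l = 1 / g (e l)" for l
  have h: "0 < h l" for l using g_pos[OF e] by (simp add: h_def)
  have "\<exists>\<pi>. (\<forall>z\<in>?R. \<pi> z \<in> ?R \<and> \<bar>fst z - fst (\<pi> z)\<bar> \<le> h l \<and> \<bar>snd z - snd (\<pi> z)\<bar> \<le> h l) \<and>
      finite (\<pi> ` ?R) \<and>
      real (card (\<pi> ` ?R)) \<le> ((A - - A) / (2 * h l) + 1) * ((b (Suc k) - b k) / (2 * h l) + 1)" for l
  proof -
    have "- A < A" using A by simp
    from rectangle_net[OF this b(2) h[of l]] show ?thesis by metis
  qed
  then obtain \<pi> where \<pi>: "\<And>l z. z \<in> ?R \<Longrightarrow> \<pi> l z \<in> ?R"
      "\<And>l z. z \<in> ?R \<Longrightarrow> \<bar>fst z - fst (\<pi> l z)\<bar> \<le> h l" "\<And>l z. z \<in> ?R \<Longrightarrow> \<bar>snd z - snd (\<pi> l z)\<bar> \<le> h l"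
      "\<And>l. finite (\<pi> l ` ?R)"
      "\<And>l. real (card (\<pi> l ` ?R)) \<le> ((A - - A) / (2 * h l) + 1) * ((b (Suc k) - b k) / (2 * h l) + 1)"
    by metis
  have h_lim: "h \<longlonglongrightarrow> 0"
  proof -
    have "(\<lambda>l. e l) \<longlonglongrightarrow> 0 * \<epsilon>"
      unfolding e_def using \<theta> by (intro tendsto_mult_right LIMSEQ_Suc LIMSEQ_power_zero) auto
    then have "filterlim e (at_right 0) sequentially"
      using e(1) by (intro tendsto_imp_filterlim_at_right) auto
    then have "filterlim (\<lambda>l. inverse (e l)) at_top sequentially"
      by (rule filterlim_compose[OF filterlim_inverse_at_top_right])
    then have "filterlim (\<lambda>l. K / e l) at_top sequentially"
      unfolding divide_inverse by (intro filterlim_tendsto_pos_mult_at_top[OF tendsto_const K])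
    then have "filterlim (\<lambda>l. inv_pos Z (K / e l)) at_top sequentially"
      by (rule filterlim_compose[OF admissible_inv_pos_at_top[OF adm]])
    then have "filterlim (\<lambda>l. - u0 + inv_pos Z (K / e l)) at_top sequentially"
      by (rule filterlim_tendsto_add_at_top[OF tendsto_const])
    then have "filterlim (\<lambda>l. g (e l)) at_top sequentially" by (simp add: g_def)
    from tendsto_inverse_0_at_top[OF this] show ?thesis by (simp add: h_def[abs_def] inverse_eq_divide)
  qed
  have meas: "U (snd z) (fst z) \<in> borel_measurable M" if "z \<in> ?R" for z
    using that b by (intro U_measurable) auto
  have ne: "?R \<noteq> {}" using base by blast
  have net: "\<pi> l z \<in> ?R" if "z \<in> ?R" for l z by (rule \<pi>(1)[OF that])
  have fin: "finite (\<pi> l ` ?R)" for l by (rule \<pi>(4))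
  have card: "real (card (\<pi> l ` ?R)) \<le> exp (Hf (e l))" for l
  proof -
    have "0 < A * g (e l) + 1" and "0 < (b (Suc k) - b k) / 2 * g (e l) + 1"
      using g_pos[OF e, of l] A b by (auto intro!: add_nonneg_pos)
    then have "exp (Hf (e l)) = (A * g (e l) + 1) * ((b (Suc k) - b k) / 2 * g (e l) + 1)"
      by (simp add: Hf_def exp_add)
    then show ?thesis using \<pi>(5)[of l] by (simp add: h_def)
  qed
  have H_pos: "0 < Hf (e l)" for l by (rule Hf_pos[OF e])
  have conv: "(\<lambda>l. \<pi> l z) \<longlonglongrightarrow> z" if "z \<in> ?R" for z
  proof -
    have "(\<lambda>l. fst z - fst (\<pi> l z)) \<longlonglongrightarrow> 0" "(\<lambda>l. snd z - snd (\<pi> l z)) \<longlonglongrightarrow> 0"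
      using \<pi>(2,3)[OF that] by (auto intro!: Lim_null_comparison[OF _ h_lim])
    then have "(\<lambda>l. (fst z - (fst z - fst (\<pi> l z)), snd z - (snd z - snd (\<pi> l z)))) \<longlonglongrightarrow> (fst z - 0, snd z - 0)"
      by (intro tendsto_Pair tendsto_diff tendsto_const)
    then show ?thesis by simp
  qed
  have level0: "mgf_le M \<phi> (U (snd z) (fst z)) \<epsilon>" if "z \<in> ?R" for z
    unfolding \<epsilon>_def using that by (intro U_mgf_le_eps_sup b) auto
  have incr: "mgf_le M \<phi> (\<lambda>\<omega>. U (snd z) (fst z) \<omega> - U (snd (\<pi> l z)) (fst (\<pi> l z)) \<omega>) (\<theta> ^ Suc l * \<epsilon>)"
    if z: "z \<in> ?R" for l z
  proof -
    let ?\<Delta> = "\<lambda>\<omega>. U (snd z) (fst z) \<omega> - U (snd (\<pi> l z)) (fst (\<pi> l z)) \<omega>"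
    have dom: "dominated_by_variance M \<phi> Cy ?\<Delta>"
      using z \<pi>(1)[OF z, of l] b by (intro increment_dominated) auto
    have "sqrt (second_moment M ?\<Delta>) \<le> 2 / Z (1 / h l + u0) * CZ"
      using z \<pi>(1)[OF z, of l] \<pi>(2,3)[OF z] b h by (intro increment_second_moment_le) auto
    also have "Z (1 / h l + u0) = K / e l" using g_inv[OF e] by (simp add: h_def)
    also have "2 / (K / e l) * CZ = e l / Cy" using CZ_pos Cy by (simp add: K_def)
    finally have "Cy * sqrt (second_moment M ?\<Delta>) \<le> e l" using Cy by (simp add: field_simps)
    then show ?thesis
      using dom mgf_le_mono[OF \<phi>, of M ?\<Delta> "Cy * sqrt (second_moment M ?\<Delta>)" "e l"]
      by (simp add: dominated_by_variance_def e_def)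
  qed
  \<comment> \<open>By the hypothesis on \<open>r\<close> the cost \<open>2 J\<close> of chaining is at most half of the level, which is where the
    factor \<open>2\<close> in the denominator of the exponent comes from.\<close>
  have sums: "(\<Sum>l<L. \<theta> ^ l * \<epsilon> * Psi \<phi> (Hf (e l))) \<le> r / 4" for L
  proof -
    have "(\<Sum>l<L. \<theta> ^ l * \<epsilon> * Psi \<phi> (Hf (e l))) \<le> (LINT s:{0<..\<theta> * \<epsilon>}|lborel. Psi \<phi> (Hf s)) / (\<theta> * (1 - \<theta>))"
      unfolding e_def
    proof (rule geometric_sum_le_integral[OF \<epsilon> \<theta>])
      show "set_integrable lborel {0<..\<theta> * \<epsilon>} (\<lambda>s. Psi \<phi> (Hf s))"
        using int by (simp add: integrand \<epsilon>_def)
    qed (auto intro!: Psi_mono[OF \<phi>] Psi_nonneg[OF \<phi>] Hf_pos Hf_anti)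
    also have "\<dots> = entropy_integral \<phi> Z u0 CZ Cy A b k (\<theta> * eps_sup M U Cy A b k) * (4 / (\<theta> * (1 - \<theta>))) / 4"
      by (simp add: entropy_integral_def integrand \<epsilon>_def)
    also have "\<dots> \<le> r / 4" using entropy by simp
    finally show ?thesis .
  qed
  then have "(\<Sum>l<0. \<theta> ^ l * \<epsilon> * Psi \<phi> (Hf (e l))) \<le> r / 4" .
  then have r_ge: "2 * (r / 4) \<le> r" by simp
  obtain B where B: "B \<in> sets M"
      "measure M B \<le> 2 * exp (- young_fenchel \<phi> ((r - 2 * (r / 4)) * (1 - \<theta>) / \<epsilon>))"
      "\<And>\<omega> z. \<omega> \<in> space M \<Longrightarrow> continuous_on ?R (\<lambda>z. U (snd z) (fst z) \<omega>) \<Longrightarrow> z \<in> ?R \<Longrightarrow>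
        r < \<bar>U (snd z) (fst z) \<omega>\<bar> \<Longrightarrow> \<omega> \<in> B"
    using chaining_tail_bound[where T = ?R and X = "\<lambda>z. U (snd z) (fst z)",
        OF prob \<phi> \<epsilon> \<theta> meas ne net fin card H_pos conv level0 incr sums r_ge] by blast
  have "(r - 2 * (r / 4)) * (1 - \<theta>) / \<epsilon> = r * (1 - \<theta>) / (2 * eps_sup M U Cy A b k)"
    by (simp add: \<epsilon>_def field_simps)
  then show ?thesis using that[OF B(1)] B(2,3) by (fastforce simp: case_prod_unfold)
qed

lemma segment_tail_bound:
  assumes b: "0 \<le> b k" "b k < b (Suc k)" and \<theta>: "0 < \<theta>" "\<theta> < 1" and r: "0 < r"
    and int: "set_integrable lborel {0<..\<theta> * eps_sup M U Cy A b k} (entropy_integrand \<phi> Z u0 CZ Cy A b k)"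
    and entropy: "entropy_integral \<phi> Z u0 CZ Cy A b k (\<theta> * eps_sup M U Cy A b k) * (4 / (\<theta> * (1 - \<theta>))) \<le> r"
  obtains B where "B \<in> sets M"
    and "measure M B \<le> 2 * exp_neg_conj \<phi> (r * (1 - \<theta>)) (2 * eps_sup M U Cy A b k)"
    and "\<And>\<omega> x t. \<omega> \<in> space M \<Longrightarrow> continuous_on ({-A..A} \<times> {b k..b (Suc k)}) (\<lambda>(x, t). U t x \<omega>) \<Longrightarrow>
      x \<in> {-A..A} \<Longrightarrow> t \<in> {b k..b (Suc k)} \<Longrightarrow> r < \<bar>U t x \<omega>\<bar> \<Longrightarrow> \<omega> \<in> B"
proof -
  consider "eps_sup M U Cy A b k = 0" | "0 < eps_sup M U Cy A b k" "CZ = 0"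
    | "0 < eps_sup M U Cy A b k" "0 < CZ"
    using eps_sup_nonneg[of b k] b CZ by fastforce
  then show ?thesis
  proof cases
    case 1
    have zero: "AE \<omega> in M. U t x \<omega> = 0" if "x \<in> {-A..A}" "t \<in> {b k..b (Suc k)}" for x t
      using U_mgf_le_eps_sup[OF b(1) that] that b
      by (intro mgf_le_zero_imp_AE_zero[OF prob \<phi>] U_measurable) (auto simp: 1)
    have empty: "measure M {\<omega> \<in> space M. r < \<bar>0 :: real\<bar>} = 0" using r by simp
    obtain B where B: "B \<in> sets M" "measure M B \<le> measure M {\<omega> \<in> space M. r < \<bar>0 :: real\<bar>}"
      "\<And>\<omega> x t. \<omega> \<in> space M \<Longrightarrow> continuous_on ({-A..A} \<times> {b k..b (Suc k)}) (\<lambda>(x, t). U t x \<omega>) \<Longrightarrow>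
        x \<in> {-A..A} \<Longrightarrow> t \<in> {b k..b (Suc k)} \<Longrightarrow> r < \<bar>U t x \<omega>\<bar> \<Longrightarrow> \<omega> \<in> B"
      using constant_field_tail[where Y = "\<lambda>_. 0", OF b(1) borel_measurable_const zero, of "b (Suc k)" r] by blast
    show ?thesis by (rule that[OF B(1) _ B(3)]) (use B(2) empty 1 in \<open>simp_all add: exp_neg_conj_def\<close>)
  next
    case 2
    obtain B where B: "B \<in> sets M" "measure M B \<le> 2 * exp (- young_fenchel \<phi> (r * (1 - \<theta>) / (2 * eps_sup M U Cy A b k)))"
      "\<And>\<omega> x t. \<omega> \<in> space M \<Longrightarrow> continuous_on ({-A..A} \<times> {b k..b (Suc k)}) (\<lambda>(x, t). U t x \<omega>) \<Longrightarrow>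
        x \<in> {-A..A} \<Longrightarrow> t \<in> {b k..b (Suc k)} \<Longrightarrow> r < \<bar>U t x \<omega>\<bar> \<Longrightarrow> \<omega> \<in> B"
      using segment_tail_bound_constant[OF b \<theta> r 2] by blast
    show ?thesis by (rule that[OF B(1) _ B(3)]) (use B(2) 2 in \<open>simp_all add: exp_neg_conj_def\<close>)
  next
    case 3
    obtain B where B: "B \<in> sets M" "measure M B \<le> 2 * exp (- young_fenchel \<phi> (r * (1 - \<theta>) / (2 * eps_sup M U Cy A b k)))"
      "\<And>\<omega> x t. \<omega> \<in> space M \<Longrightarrow> continuous_on ({-A..A} \<times> {b k..b (Suc k)}) (\<lambda>(x, t). U t x \<omega>) \<Longrightarrow>
        x \<in> {-A..A} \<Longrightarrow> t \<in> {b k..b (Suc k)} \<Longrightarrow> r < \<bar>U t x \<omega>\<bar> \<Longrightarrow> \<omega> \<in> B"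
      using segment_tail_bound_chaining[OF b \<theta> 3 int entropy] by blast
    show ?thesis by (rule that[OF B(1) _ B(3)]) (use B(2) 3 in \<open>simp_all add: exp_neg_conj_def\<close>)
  qed
qed

end

section \<open>The estimate on the half-strip\<close>

text \<open>With \<open>v = c\<^sub>k (1 - \<theta>)\<close> and \<open>\<epsilon> = \<epsilon>\<^sub>k\<close>, the level \<open>u c\<^sub>k\<close> on the \<open>k\<close>-th rectangle gives the exponent \<open>\<phi>\<^sup>*(p q)\<close> with \<open>p = u / s\<close> and
  \<open>q = s c\<^sub>k (1 - \<theta>) / (2 \<epsilon>\<^sub>k)\<close>, both at least \<open>2\<close>.\<close>

lemma exp_neg_conj_mult_le:
  assumes "N_function \<phi>" and "0 < s" and "2 * s \<le> u" and "0 \<le> \<epsilon>" and "4 * \<epsilon> \<le> s * v"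
  shows "exp_neg_conj \<phi> (u * v) (2 * \<epsilon>) \<le> exp (- young_fenchel \<phi> (u / s)) * exp_neg_conj \<phi> (s * v) (2 * \<epsilon>)"
proof (cases "\<epsilon> = 0")
  case False
  then have \<epsilon>: "0 < \<epsilon>" using assms by simp
  let ?p = "u / s" and ?q = "s * v / (2 * \<epsilon>)"
  have "2 \<le> ?p" using assms by (simp add: field_simps)
  moreover have "2 \<le> ?q" using assms \<epsilon> by (simp add: field_simps)
  ultimately have "young_fenchel \<phi> ?p + young_fenchel \<phi> ?q \<le> young_fenchel \<phi> (?p * ?q)"
    by (rule young_fenchel_mult_ge_add[OF assms(1)])
  also have "?p * ?q = u * v / (2 * \<epsilon>)" using assms by simp
  finally have "exp (- young_fenchel \<phi> (u * v / (2 * \<epsilon>))) \<le> exp (- young_fenchel \<phi> ?p + - young_fenchel \<phi> ?q)"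
    by simp
  then show ?thesis using \<epsilon> unfolding exp_add by (simp add: exp_neg_conj_def)
qed (simp add: exp_neg_conj_def)

lemma c_min_bounds:
  assumes "continuous_on {0..} c" and "\<And>t. t \<ge> 0 \<Longrightarrow> c t > 0" and "0 \<le> b k" and "b k \<le> b (Suc k)"
  shows "0 < c_min c b k" and "t \<in> {b k..b (Suc k)} \<Longrightarrow> c_min c b k \<le> (c t :: real)"
proof -
  let ?I = "{b k..b (Suc k)}"
  have "continuous_on ?I c" using assms by (auto intro: continuous_on_subset)
  then obtain t0 where t0: "t0 \<in> ?I" "\<And>t. t \<in> ?I \<Longrightarrow> c t0 \<le> c t"
    using continuous_attains_inf[of ?I c] assms(4) by auto
  have "c_min c b k = c t0"
    unfolding c_min_def by (rule cInf_eq_minimum) (use t0 in auto)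
  then show "0 < c_min c b k" and "t \<in> ?I \<Longrightarrow> c_min c b k \<le> c t"
    using t0 assms(2)[of t0] assms(3) by auto
qed

lemma segments_cover:
  fixes b :: "nat \<Rightarrow> real"
  assumes "b 0 = 0" and "0 < A" and "\<And>k. b (Suc k) - b k \<ge> 2 * A" and "0 \<le> t"
  obtains k where "t \<in> {b k..b (Suc k)}"
proof -
  have lower: "2 * A * real k \<le> b k" for k
  proof (induction k)
    case (Suc k)
    then show ?case using assms(3)[of k] by (simp add: algebra_simps)
  qed (simp add: assms(1))
  obtain n where "t / (2 * A) < real n" using reals_Archimedean2 by blast
  then have "t < 2 * A * real n" using assms(2) by (simp add: field_simps)
  then have ex: "\<exists>k. t < b k" using lower[of n] by (intro exI[of _ n]) linarith
  define m where "m = (LEAST k. t < b k)"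
  have m: "t < b m" unfolding m_def by (rule LeastI_ex[OF ex])
  then have "m \<noteq> 0" using assms(1,4) by (metis linorder_not_less)
  then obtain k where k: "m = Suc k" by (meson not0_implies_Suc)
  then have "\<not> t < b k" using not_less_Least[of k "\<lambda>k. t < b k"] unfolding m_def by simp
  then show ?thesis using that[of k] m k by simp
qed

text \<open>The supremum over the uncountable set is measurable only up to the null set of discontinuous
  paths.\<close>

lemma sup_event_in_completion:
  fixes V :: "'b :: {metric_space, second_countable_topology} \<Rightarrow> 'a \<Rightarrow> real"
  assumes V: "\<And>z. z \<in> T \<Longrightarrow> V z \<in> borel_measurable M"
    and cont: "AE \<omega> in M. continuous_on T (\<lambda>z. V z \<omega>)"
  shows "{\<omega> \<in> space M. \<exists>z\<in>T. u < V z \<omega>} \<in> sets (completion M)" (is "?E \<in> _")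
proof -
  obtain N where N: "N \<in> null_sets M" "{\<omega> \<in> space M. \<not> continuous_on T (\<lambda>z. V z \<omega>)} \<subseteq> N"
    using AE_E[OF cont] null_setsI by metis
  obtain D where D: "countable D" "D \<subseteq> T" "T \<subseteq> closure D" using separable by blast
  let ?E' = "\<Union>d\<in>D. {\<omega> \<in> space M. u < V d \<omega>}"
  have [measurable]: "V d \<in> borel_measurable M" if "d \<in> D" for d using V D(2) that by blast
  have "{\<omega> \<in> space M. u < V d \<omega>} \<in> sets M" if "d \<in> D" for d
    using that by measurable
  then have E': "?E' \<in> sets M" by (intro sets.countable_UN'[OF D(1)]) blast
  have "\<omega> \<in> ?E'" if "\<omega> \<in> ?E" "\<omega> \<notin> N" for \<omega>
    using that N(2) exceeds_on_dense_subset[OF _ D(2,3), of "\<lambda>z. V z \<omega>"] by blast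
  moreover have "?E' \<subseteq> ?E" using D(2) by auto
  ultimately have "?E = ?E' \<union> (?E \<inter> N)" by blast
  then show ?thesis by (rule sets_completionI[OF _ Int_lower2 N(1) E'])
qed

theorem theorem6p2:
  fixes M :: "'a measure"
    and \<phi> \<kappa> Z c :: "real \<Rightarrow> real"
    and y :: "real \<Rightarrow> 'a \<Rightarrow> real"
    and U :: "real \<Rightarrow> real \<Rightarrow> 'a \<Rightarrow> real"
    and N :: nat and a :: "nat \<Rightarrow> real" and b :: "nat \<Rightarrow> real"
    and A Cy CZ u0 \<theta> s u :: real
  assumes "prob_space M"
    and "N_function \<phi>" and "condition_Q \<phi>"
    and "strictly_sub_gaussian M \<phi> (range y) Cy"
    and "finite_variation (covariance_fun M y)"
    and "A > 0" and "N \<ge> 1"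
    and "\<kappa> = cos \<or> \<kappa> = sin"
    and "\<And>x t. x \<in> {-A..A} \<Longrightarrow> t \<ge> 0 \<Longrightarrow> has_ms_integral M y (kernel_I \<kappa> N a t x) (U t x)"
    and "AE \<omega> in M. continuous_on ({-A..A} \<times> {0..}) (\<lambda>(x, t). U t x \<omega>)"
    and "admissible \<phi> Z u0"
    and "CZ \<ge> 0"
    and "has_variation_integral (covariance_fun M y)
           (\<lambda>l m. Z_weight Z u0 N a l * Z_weight Z u0 N a m) (CZ\<^sup>2)"
    and "b 0 = 0" and "\<And>k. k \<ge> 1 \<Longrightarrow> 0 < b k \<and> b k < b (Suc k)"
    and "\<And>k. b (Suc k) - b k \<ge> 2 * A"
    and "continuous_on {0..} c" and "\<And>t. t \<ge> 0 \<Longrightarrow> c t > 0"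
    and "bdd_above (range (\<lambda>k. eps_sup M U Cy A b k / c_min c b k))"
    and "0 < \<theta>" and "\<theta> < 1"
    and "\<And>k. set_integrable lborel {0<..\<theta> * eps_sup M U Cy A b k}
                (entropy_integrand \<phi> Z u0 CZ Cy A b k)"
    and "bdd_above (range (\<lambda>k.
           entropy_integral \<phi> Z u0 CZ Cy A b k (\<theta> * eps_sup M U Cy A b k) / c_min c b k))"
    and "summable (\<lambda>k. exp_neg_conj \<phi> (s * c_min c b k * (1 - \<theta>)) (2 * eps_sup M U Cy A b k))"
    and "(SUP k. 4 * eps_sup M U Cy A b k / (c_min c b k * (1 - \<theta>))) < s" and "s < u / 2"
    and "u > (SUP k. entropy_integral \<phi> Z u0 CZ Cy A b k (\<theta> * eps_sup M U Cy A b k) / c_min c b k)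
               * (4 / (\<theta> * (1 - \<theta>)))"
  shows "{\<omega> \<in> space M. (SUP (x, t)\<in>{-A..A} \<times> {0..}. ereal (\<bar>U t x \<omega>\<bar> / c t)) > ereal u}
           \<in> sets (completion M) \<and>
         measure (completion M)
           {\<omega> \<in> space M. (SUP (x, t)\<in>{-A..A} \<times> {0..}. ereal (\<bar>U t x \<omega>\<bar> / c t)) > ereal u}
         \<le> 2 * exp (- young_fenchel \<phi> (u / s)) *
           (\<Sum>k. exp_neg_conj \<phi> (s * c_min c b k * (1 - \<theta>)) (2 * eps_sup M U Cy A b k))"
proof -
  let ?V = "{-A..A} \<times> {0..}"
  let ?\<epsilon> = "eps_sup M U Cy A b" and ?c = "c_min c b"
  let ?I = "\<lambda>k. entropy_integral \<phi> Z u0 CZ Cy A b k (\<theta> * ?\<epsilon> k)"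
  let ?term = "\<lambda>k. exp_neg_conj \<phi> (s * ?c k * (1 - \<theta>)) (2 * ?\<epsilon> k)"
  let ?E = "{\<omega> \<in> space M. (SUP (x, t)\<in>?V. ereal (\<bar>U t x \<omega>\<bar> / c t)) > ereal u}"
  interpret field: dispersive_field M \<phi> \<kappa> Z y U N a A Cy CZ u0
    by (rule dispersive_field.intro[OF assms(1,2,4,6,8,9,11,12,13)])
  interpret C: prob_space "completion M" by (rule field.prob_space_completion)
  have b_step: "b k < b (Suc k)" for k using assms(16)[of k] \<open>A > 0\<close> by linarith
  have b_nonneg: "0 \<le> b k" for k
    by (cases "k = 0") (use \<open>b 0 = 0\<close> assms(15)[of k] in \<open>auto intro: less_imp_le\<close>)
  have c_pos: "0 < ?c k" for k
    using c_min_bounds(1)[of c b k] assms(17,18) b_nonneg[of k] b_step[of k] by auto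
  have c_le: "?c k \<le> c t" if "t \<in> {b k..b (Suc k)}" for k t
    using c_min_bounds(2)[of c b k t] assms(17,18) b_nonneg[of k] b_step[of k] that by auto
  have \<epsilon>_nonneg: "0 \<le> ?\<epsilon> k" for k by (rule field.eps_sup_nonneg[OF b_nonneg[of k] less_imp_le[OF b_step[of k]]])
  have s_lower: "4 * ?\<epsilon> k / (?c k * (1 - \<theta>)) < s" for k
  proof -
    have "bdd_above (range (\<lambda>k. 4 / (1 - \<theta>) * (?\<epsilon> k / ?c k)))"
    proof -
      obtain K where "\<And>k. ?\<epsilon> k / ?c k \<le> K" using assms(19) by (auto simp: bdd_above_def)
      then show ?thesis
        using \<open>\<theta> < 1\<close> by (intro bdd_aboveI2[where M = "4 / (1 - \<theta>) * K"] mult_left_mono) auto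
    qed
    then have "bdd_above (range (\<lambda>k. 4 * ?\<epsilon> k / (?c k * (1 - \<theta>))))" by (simp add: ac_simps)
    from cSUP_upper[OF UNIV_I this, of k] assms(25) show ?thesis by linarith
  qed
  have "0 \<le> 4 * ?\<epsilon> 0 / (?c 0 * (1 - \<theta>))"
    using \<epsilon>_nonneg c_pos \<open>\<theta> < 1\<close> by (simp add: less_imp_le)
  then have s: "0 < s" using s_lower[of 0] by linarith
  then have u: "0 < u" using \<open>s < u / 2\<close> by linarith
  have entropy: "?I k * (4 / (\<theta> * (1 - \<theta>))) \<le> u * ?c k" for k
  proof -
    have "?I k / ?c k * (4 / (\<theta> * (1 - \<theta>))) \<le> (SUP k. ?I k / ?c k) * (4 / (\<theta> * (1 - \<theta>)))"
      using cSUP_upper[OF UNIV_I assms(23), of k] \<open>0 < \<theta>\<close> \<open>\<theta> < 1\<close> by (intro mult_right_mono) auto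
    also have "\<dots> \<le> u" using assms(27) by simp
    finally have "?I k * (4 / (\<theta> * (1 - \<theta>))) / ?c k \<le> u" by (simp add: mult.commute)
    then show ?thesis using c_pos[of k] by (simp only: pos_divide_le_eq)
  qed
  have "\<exists>B\<in>sets M. measure M B \<le> 2 * exp_neg_conj \<phi> (u * ?c k * (1 - \<theta>)) (2 * ?\<epsilon> k) \<and>
      (\<forall>\<omega> x t. \<omega> \<in> space M \<longrightarrow> continuous_on ?V (\<lambda>(x, t). U t x \<omega>) \<longrightarrow> x \<in> {-A..A} \<longrightarrow>
        t \<in> {b k..b (Suc k)} \<longrightarrow> u * ?c k < \<bar>U t x \<omega>\<bar> \<longrightarrow> \<omega> \<in> B)" for k
  proof -
    have sub: "{-A..A} \<times> {b k..b (Suc k)} \<subseteq> ?V" using b_nonneg[of k] by auto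
    have "0 < u * ?c k" using u c_pos by simp
    from field.segment_tail_bound[OF b_nonneg[of k] b_step[of k] \<open>0 < \<theta>\<close> \<open>\<theta> < 1\<close> this assms(22) entropy]
    obtain B where "B \<in> sets M" "measure M B \<le> 2 * exp_neg_conj \<phi> (u * ?c k * (1 - \<theta>)) (2 * ?\<epsilon> k)"
      "\<And>\<omega> x t. \<omega> \<in> space M \<Longrightarrow> continuous_on ({-A..A} \<times> {b k..b (Suc k)}) (\<lambda>(x, t). U t x \<omega>) \<Longrightarrow>
        x \<in> {-A..A} \<Longrightarrow> t \<in> {b k..b (Suc k)} \<Longrightarrow> u * ?c k < \<bar>U t x \<omega>\<bar> \<Longrightarrow> \<omega> \<in> B"
      by blast
    then show ?thesis using continuous_on_subset[OF _ sub] by blast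
  qed
  then obtain B where B_sets: "\<And>k. B k \<in> sets M"
    and B_le: "\<And>k. measure M (B k) \<le> 2 * exp_neg_conj \<phi> (u * ?c k * (1 - \<theta>)) (2 * ?\<epsilon> k)"
    and B: "\<And>k \<omega> x t. \<omega> \<in> space M \<Longrightarrow> continuous_on ?V (\<lambda>(x, t). U t x \<omega>) \<Longrightarrow> x \<in> {-A..A} \<Longrightarrow>
        t \<in> {b k..b (Suc k)} \<Longrightarrow> u * ?c k < \<bar>U t x \<omega>\<bar> \<Longrightarrow> \<omega> \<in> B k"
    by metis
  have B_le': "measure M (B k) \<le> 2 * exp (- young_fenchel \<phi> (u / s)) * ?term k" for k
  proof -
    have "4 * ?\<epsilon> k \<le> s * (?c k * (1 - \<theta>))"
      using s_lower[of k] c_pos[of k] \<open>\<theta> < 1\<close> by (simp add: pos_divide_less_eq less_imp_le)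
    from exp_neg_conj_mult_le[OF \<open>N_function \<phi>\<close> s _ \<epsilon>_nonneg this, of u] \<open>s < u / 2\<close>
    show ?thesis using B_le[of k] by (simp add: mult.assoc)
  qed
  have term_summable: "summable (\<lambda>k. 2 * exp (- young_fenchel \<phi> (u / s)) * ?term k)"
    by (rule summable_mult[OF assms(24)])
  have B_summable: "summable (\<lambda>k. measure M (B k))"
    by (rule summable_comparison_test_ev[OF _ term_summable]) (use B_le' in simp)
  have "measure M (\<Union>k. B k) \<le> (\<Sum>k. measure M (B k))"
    by (rule field.finite_measure_subadditive_countably) (use B_sets B_summable in auto)
  also have "\<dots> \<le> (\<Sum>k. 2 * exp (- young_fenchel \<phi> (u / s)) * ?term k)"
    by (rule suminf_le[OF B_le' B_summable term_summable])
  also have "\<dots> = 2 * exp (- young_fenchel \<phi> (u / s)) * (\<Sum>k. ?term k)"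
    by (rule suminf_mult[OF assms(24)])
  finally have union_le: "measure M (\<Union>k. B k) \<le> 2 * exp (- young_fenchel \<phi> (u / s)) * (\<Sum>k. ?term k)" .
  have E_eq: "?E = {\<omega> \<in> space M. \<exists>z\<in>?V. u < \<bar>U (snd z) (fst z) \<omega>\<bar> / c (snd z)}"
    by (auto simp: less_SUP_iff)
  have E_sets: "?E \<in> sets (completion M)"
    unfolding E_eq
  proof (rule sup_event_in_completion)
    show "(\<lambda>\<omega>. \<bar>U (snd z) (fst z) \<omega>\<bar> / c (snd z)) \<in> borel_measurable M" if "z \<in> ?V" for z
    proof -
      have [measurable]: "U (snd z) (fst z) \<in> borel_measurable M"
        using that by (intro field.U_measurable) auto
      show ?thesis by measurable
    qed
    show "AE \<omega> in M. continuous_on ?V (\<lambda>z. \<bar>U (snd z) (fst z) \<omega>\<bar> / c (snd z))"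
      using assms(10)
    proof eventually_elim
      case (elim \<omega>)
      have "continuous_on ?V (\<lambda>z. c (snd z))"
        by (rule continuous_on_compose2[OF assms(17)]) (auto intro: continuous_on_snd continuous_on_id)
      moreover have "c (snd z) \<noteq> 0" if "z \<in> ?V" for z using assms(18)[of "snd z"] that by auto
      ultimately show ?case
        using continuous_on_rabs[OF elim[unfolded case_prod_unfold]] by (intro continuous_on_divide) auto
    qed
  qed
  obtain N0 where N0_cont: "{\<omega> \<in> space M. \<not> continuous_on ?V (\<lambda>(x, t). U t x \<omega>)} \<subseteq> N0"
    and N0: "N0 \<in> null_sets M"
    by (rule AE_E[OF assms(10)]) (blast intro: null_setsI)
  have "?E \<subseteq> (\<Union>k. B k) \<union> N0"
  proof
    fix \<omega>
    assume "\<omega> \<in> ?E"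
    then obtain x t where \<omega>: "\<omega> \<in> space M" and xt: "x \<in> {-A..A}" "0 \<le> t" "u < \<bar>U t x \<omega>\<bar> / c t"
      unfolding E_eq by auto
    obtain k where k: "t \<in> {b k..b (Suc k)}"
      using segments_cover[OF \<open>b 0 = 0\<close> \<open>A > 0\<close> assms(16) xt(2)] by blast
    have "u * ?c k \<le> u * c t" using u c_le[OF k] by simp
    also have "\<dots> < \<bar>U t x \<omega>\<bar>" using xt assms(18)[of t] by (simp add: pos_less_divide_eq)
    finally show "\<omega> \<in> (\<Union>k. B k) \<union> N0"
      using B[OF \<omega> _ xt(1) k] N0_cont \<omega> by blast
  qed
  then have "measure (completion M) ?E \<le> measure (completion M) ((\<Union>k. B k) \<union> N0)"
    using B_sets N0 by (intro C.finite_measure_mono) auto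
  also have "\<dots> = measure M ((\<Union>k. B k) \<union> N0)"
    using B_sets N0 by (intro measure_completion) auto
  also have "\<dots> = measure M (\<Union>k. B k)"
    using B_sets N0 by (intro measure_Un_null_set) auto
  finally show ?thesis using E_sets union_le by linarith
qed

end
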